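(* Let $\mathbf{k}=(k_1,\ldots,k_n)$ be a tuple of positive integers of length $\ell\ge1$ and weight $(a_1,\ldots,a_\ell;t_1,\ldots,t_\ell;0)$. Then for every positive integer $m$, $$B_{\mathbf{k}}(m)=S_{\mathbf{k}}(\ell+m,m),\qquad b_{\mathbf{k}}(m)=s_{\mathbf{k}}(m,m-\ell).$$ Moreover, $$S_{\mathbf{k}}(\ell+m,m)=\sum_{1\le i_1\le\cdots\le i_\ell\le m} i_1^{a_1}\cdots i_\ell^{a_\ell}\binom{t_1+i_2-i_1-2}{i_2-i_1}\cdots\binom{t_{\ell-1}+i_\ell-i_{\ell-1}-2}{i_\ell-i_{\ell-1}}\binom{t_\ell+m-i_\ell-2}{m-i_\ell},$$ $$s_{\mathbf{k}}(m,m-\ell)=\sum_{1\le i_1<\cdots<i_\ell< m} i_1^{a_1}\cdots i_\ell^{a_\ell}\binom{i_2-i_1-1}{t_1-2}\cdots\binom{i_\ell-i_{\ell-1}-1}{t_{\ell-1}-2}\binom{m-i_\ell-1}{t_\ell-2}.$$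
   Context: Stirling polynomials: for $\mathbf{k}=(k_1,\ldots,k_n)$, $K=\sum k_i$, a Stirling permutation of $\{1^{k_1},\ldots,n^{k_n}\}$ is a word $\sigma(1)\cdots\sigma(K)$ with each $i$ appearing $k_i$ times such that $\sigma(i)=\sigma(j)$, $i<s<j$ imply $\sigma(s)\ge\sigma(i)$; index $i$ is a descent if $i<K$ and $\sigma(i)>\sigma(i+1)$, or $i=K$; $A_{\mathbf{k},i}$ counts those with exactly $i$ descents; $\sum_{m\ge0}B_{\mathbf{k}}(m)x^m=\frac{\sum_{i=1}^{n}A_{\mathbf{k},i}x^i}{(1-x)^{K+1}}$ and $\sum_{m\ge0}b_{\mathbf{k}}(m)x^m=\frac{\sum_{i=K-n+1}^{K}A_{\mathbf{k},K+1-i}x^i}{(1-x)^{K+1}}$. Weight: $\mathbf{k}$ has length $\ell$ and weight $(a_1,\ldots,a_\ell;t_1,\ldots,t_\ell;a)$ ($a_i\ge1,t_i\ge2,a\ge0$) if $\mathbf{k}=(1^{a_1-1},t_1,\ldots,1^{a_\ell-1},t_\ell,1^a)$, $1^r$ meaning $r$ consecutive ones. Notation: for a family $\mathcal{F}=\{B_1,\ldots,B_r\}$ of nonempty sets or multisets, $\min(\mathcal{F})=\{\min B_1,\ldots,\min B_r\}$; $a\sim_{\mathcal{F}}b$ means $a,b\in B_j$ for some $j$; $\mathrm{multiset}(\mathcal{F})=B_1\uplus\cdots\uplus B_r$ (multiset union). With a ground set $U$, $\mathcal{F}$ is segmented if for all $a<b<c$ in $U$, $a\sim_{\mathcal{F}}c$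 implies $b\in\min(\mathcal{F})$. For a permutation $\sigma$ of $[n]$ in one-line notation, $\mathrm{lmin}(\sigma)$ is its set of left-to-right minima. Let $n\ge m$ be integers, $U=[n+1]$, $\mathbf{k}$ of weight $(a_1,\ldots,a_{n-m};t_1,\ldots,t_{n-m};0)$, $M=\max(a_1,\ldots,a_{n-m})$. A $\mathbf{k}$-partition system of $[n]$ into $m$ blocks is an ordered tuple $(\pi_0,\pi_1,\ldots,\pi_M)$ with: (i) $\pi_1,\ldots,\pi_M$ are set partitions of $[n]$ into nonempty blocks; (ii) $\min(\pi_1)=\cdots=\min(\pi_M)$ and $|\min(\pi_1)|=m$; (iii) writing $[n]\setminus\min(\pi_1)=\{x_1<\cdots<x_{n-m}\}$, for all $1\le i\le n-m$ and $a_i<j\le M$ we have $x_i\sim_{\pi_j}1$; (iv) $\pi_0$ is a segmented family of nonempty multisets with $\min(\pi_0)=\min(\pi_1)$, $x_1\sim_{\pi_0}1$, and $\mathrm{multiset}(\pi_0)\subseteq\min(\pi_1)\uplus\{x_1,x_2^{t_1-2},\ldots,x_{n-m}^{t_{n-m-1}-2},(n+1)^{t_{n-m}-2}\}$. A $\mathbf{k}$-permutation system of $[n]$ with $m$ left-to-right minima is an ordered tuple $(\sigma_0,\sigma_1,\ldots,\sigma_M)$ with: (i) $\sigma_1,\ldots,\sigma_M$ are permutations of $[n]$; (ii) $\mathrm{lmin}(\sigma_1)=\cdots=\mathrm{lmin}(\sigma_M)$ and $|\mathrm{lmin}(\sigma_1)|=m$; (iii) writing $[n]\setminus\mathrm{lmin}(\sigma_1)=\{x_1<\cdots<x_{n-m}\}$,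 for all $1\le i\le n-m$ and $a_i<j\le M$: if $\sigma_j(p)=x_i$ then $\sigma_j(q)>x_i$ for all $q>p$; (iv) $\sigma_0$ is a segmented family of nonempty sets with $\min(\sigma_0)=\mathrm{lmin}(\sigma_1)$, $x_1\sim_{\sigma_0}1$, and $\mathrm{multiset}(\sigma_0)=\mathrm{lmin}(\sigma_1)\uplus\{x_1,x_2^{t_1-2},\ldots,x_{n-m}^{t_{n-m-1}-2},(n+1)^{t_{n-m}-2}\}$. $S_{\mathbf{k}}(n,m)$ is the number of $\mathbf{k}$-partition systems of $[n]$ into $m$ blocks and $s_{\mathbf{k}}(n,m)$ the number of $\mathbf{k}$-permutation systems of $[n]$ with $m$ left-to-right minima (these counts are $0$ when no such systems exist, e.g. when $m\le0$). *)

theory Defs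
  imports
    "HOL-Library.Disjoint_Sets"
    "HOL-Library.Multiset"
    "HOL-Combinatorics.Multiset_Permutations"
    "HOL-Computational_Algebra.Formal_Power_Series"
begin

subsection \<open>Stirling permutations and Stirling polynomials\<close>

text \<open>The multiset \<open>{1^(k_1), ..., n^(k_n)}\<close>; list positions are 0-based, letters are 1-based.\<close>

definition letters :: "nat list \<Rightarrow> nat multiset" where
  "letters k = (\<Sum>i<length k. replicate_mset (k ! i) (Suc i))"

definition stirling_perms :: "nat list \<Rightarrow> nat list set" where
  "stirling_perms k =
     {w \<in> permutations_of_multiset (letters k).
        \<forall>i s j. i < s \<and> s < j \<and> j < length w \<and> w ! i = w ! j \<longrightarrow> w ! s \<ge> w ! i}"

text \<open>The last position always counts as a descent.\<close>

definition descents :: "nat list \<Rightarrow> nat set" where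
  "descents w =
     {i. i < length w \<and> (Suc i < length w \<and> w ! i > w ! Suc i \<or> Suc i = length w)}"

definition stirling_eulerian :: "nat list \<Rightarrow> nat \<Rightarrow> nat" where
  "stirling_eulerian k i = card {w \<in> stirling_perms k. card (descents w) = i}"

definition stirling_B :: "nat list \<Rightarrow> nat \<Rightarrow> rat" where
  "stirling_B k m = fps_nth
     ((\<Sum>i = 1..length k. of_nat (stirling_eulerian k i) * fps_X ^ i)
        / (1 - fps_X) ^ (sum_list k + 1)) m"

definition stirling_b :: "nat list \<Rightarrow> nat \<Rightarrow> rat" where
  "stirling_b k m = fps_nth
     ((\<Sum>i = sum_list k - length k + 1..sum_list k.
          of_nat (stirling_eulerian k (sum_list k + 1 - i)) * fps_X ^ i)
        / (1 - fps_X) ^ (sum_list k + 1)) m"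

subsection \<open>Weight\<close>

definition has_weight :: "nat list \<Rightarrow> nat list \<Rightarrow> nat list \<Rightarrow> nat \<Rightarrow> bool" where
  "has_weight k a t r \<longleftrightarrow>
     length a = length t \<and> (\<forall>x \<in> set a. x \<ge> 1) \<and> (\<forall>x \<in> set t. x \<ge> 2) \<and>
     k = concat (map2 (\<lambda>x y. replicate (x - 1) 1 @ [y]) a t) @ replicate r 1"

subsection \<open>Families of sets and multisets\<close>

text \<open>
  The notions below depend only on the supports of the blocks; a family of multisets \<open>F\<close> is
  passed to them as \<open>set_mset ` F\<close>.
\<close>

definition fam_min :: "nat set set \<Rightarrow> nat set" where
  "fam_min F = Min ` F"

definition same_block :: "nat set set \<Rightarrow> nat \<Rightarrow> nat \<Rightarrow> bool" where
  "same_block F x y \<longleftrightarrow> (\<exists>B \<in> F. x \<in> B \<and> y \<in> B)"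

definition segmented :: "nat set \<Rightarrow> nat set set \<Rightarrow> bool" where
  "segmented U F \<longleftrightarrow>
     (\<forall>x \<in> U. \<forall>y \<in> U. \<forall>z \<in> U. x < y \<and> y < z \<and> same_block F x z \<longrightarrow> y \<in> fam_min F)"

text \<open>
  For \<open>xs = [x_1, ..., x_l]\<close> this is the multiset
  \<open>{x_1, x_2^(t_1 - 2), ..., x_l^(t_(l-1) - 2), (n+1)^(t_l - 2)}\<close>.
\<close>

definition extra_mset :: "nat list \<Rightarrow> nat \<Rightarrow> nat list \<Rightarrow> nat multiset" where
  "extra_mset t n xs =
     {#xs ! 0#} + (\<Sum>i<length t. replicate_mset (t ! i - 2) ((tl xs @ [n + 1]) ! i))"

subsection \<open>Partition systems\<close>

text \<open>
  A tuple \<open>(\<pi>_0, \<pi>_1, ..., \<pi>_M)\<close> is encoded as a pair \<open>(p0, ps)\<close> with \<open>\<pi>_j = ps ! (j - 1)\<close>, so that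
  the range \<open>a_i < j \<le> M\<close> becomes \<open>a ! i \<le> j < M\<close>. A family \<open>\<pi>_0\<close> is a finite set of
  multisets: repeated blocks are excluded by the bound on its multiset union, in which every
  minimum has multiplicity one. The definition is only meaningful for nonempty \<open>a\<close>.
\<close>

definition partition_system ::
    "nat list \<Rightarrow> nat list \<Rightarrow> nat \<Rightarrow> int \<Rightarrow> nat multiset set \<times> nat set set list \<Rightarrow> bool" where
  "partition_system a t n m = (\<lambda>(p0, ps).
     let M = Max (set a);
         mins = fam_min (ps ! 0);
         xs = sorted_list_of_set ({1..n} - mins)
     in length ps = M \<and>
        (\<forall>j < M. partition_on {1..n} (ps ! j)) \<and>
        (\<forall>j < M. fam_min (ps ! j) = mins) \<and> int (card mins) = m \<and>
        (\<forall>i < length a. \<forall>j. a ! i \<le> j \<and> j < M \<longrightarrow> same_block (ps ! j) (xs ! i) 1) \<and>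
        finite p0 \<and> (\<forall>B \<in> p0. B \<noteq> {#}) \<and>
        segmented {1..n + 1} (set_mset ` p0) \<and>
        fam_min (set_mset ` p0) = mins \<and>
        same_block (set_mset ` p0) (xs ! 0) 1 \<and>
        (\<Sum>B \<in> p0. B) \<subseteq># mset_set mins + extra_mset t n xs)"

definition S_count :: "nat list \<Rightarrow> nat \<Rightarrow> int \<Rightarrow> nat" where
  "S_count k n m = card {P. \<exists>a t. has_weight k a t 0 \<and> int (length a) = int n - m \<and>
                                 partition_system a t n m P}"

subsection \<open>Permutation systems\<close>

text \<open>Permutations of \<open>[n]\<close> are lists in one-line notation.\<close>

definition lmin :: "nat list \<Rightarrow> nat set" where
  "lmin w = {w ! i | i. i < length w \<and> (\<forall>j < i. w ! i < w ! j)}"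

definition permutation_system ::
    "nat list \<Rightarrow> nat list \<Rightarrow> nat \<Rightarrow> int \<Rightarrow> nat set set \<times> nat list list \<Rightarrow> bool" where
  "permutation_system a t n m = (\<lambda>(s0, ss).
     let M = Max (set a);
         mins = lmin (ss ! 0);
         xs = sorted_list_of_set ({1..n} - mins)
     in length ss = M \<and>
        (\<forall>j < M. ss ! j \<in> permutations_of_set {1..n}) \<and>
        (\<forall>j < M. lmin (ss ! j) = mins) \<and> int (card mins) = m \<and>
        (\<forall>i < length a. \<forall>j. a ! i \<le> j \<and> j < M \<longrightarrow>
           (\<forall>p < n. ss ! j ! p = xs ! i \<longrightarrow> (\<forall>q. p < q \<and> q < n \<longrightarrow> ss ! j ! q > xs ! i))) \<and>
        finite s0 \<and> (\<forall>B \<in> s0. finite B \<and> B \<noteq> {}) \<and>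
        segmented {1..n + 1} s0 \<and>
        fam_min s0 = mins \<and>
        same_block s0 (xs ! 0) 1 \<and>
        (\<Sum>B \<in> s0. mset_set B) = mset_set mins + extra_mset t n xs)"

definition s_count :: "nat list \<Rightarrow> nat \<Rightarrow> int \<Rightarrow> nat" where
  "s_count k n m = card {P. \<exists>a t. has_weight k a t 0 \<and> int (length a) = int n - m \<and>
                                 permutation_system a t n m P}"

end

theory Submission
  imports Defs "HOL-Library.Sublist"
begin

text \<open>
  The copies of the largest letter \<open>n\<close> of a Stirling permutation are contiguous, and inserting
  this block into a word for \<open>(k_1, \<dots>, k_(n-1))\<close> keeps the number of descents if it is placed
  right after a descent, and raises it by one otherwise. For the generating functions
  \<open>F_k\<close> and \<open>G_k\<close> of \<open>B_k\<close> and \<open>b_k\<close> this means that appending a part \<open>c\<close> to \<open>k\<close>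
  sends \<open>F\<close> to \<open>x F' / (1-x)^(c-1)\<close> and \<open>G\<close> to \<open>(x/(1-x))^(c-1) x G'\<close>; reading off
  coefficients gives the two sums.

  On the combinatorial side, fix the non-minima \<open>x_1 < \<dots> < x_l\<close>. A partition with the
  complementary set of minima is a choice, for each \<open>x_i\<close>, of one of the \<open>x_i - i\<close> smaller minima;
  a permutation with these left-to-right minima is a choice of one of \<open>x_i - 1\<close> insertion places;
  the marking condition leaves \<open>a_i\<close> free choices for \<open>x_i\<close>. A segmented family distributes
  the copies of \<open>x_(j+1)\<close> among the minima between \<open>x_j\<close> and \<open>x_(j+1)\<close>, where
  \<open>x_(l+1) = n + 1\<close>, which gives the binomial coefficients.
\<close>

subsection \<open>Stirling permutations and descents\<close>

text \<open>Both sides are brought to the same sum over chains. A stretch \<open>1^(a-1), t\<close>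
  of \<open>k\<close> applies the Euler operator \<open>x d/dx\<close> once per part, so
  \<open>a\<close> times, which gives the factor \<open>p^a\<close> at the coefficient of
  \<open>x^p\<close>. The ones add no further factor; \<open>t\<close> adds
  \<open>(1-x)^-(t-1)\<close> or \<open>(x/(1-x))^(t-1)\<close>. Multiplying by this power is a
  convolution whose kernel, a binomial coefficient in \<open>q - p\<close>, links consecutive chain
  indices \<open>p\<close> and \<open>q\<close>.

  For systems the chain index is the number of free choices for \<open>x_j\<close>:
  \<open>i_j = x_j - j\<close> for partitions, \<open>i_j = x_j - 1\<close> for permutations. The
  first substitution makes a strictly increasing list weakly increasing, the second keeps it strict;
  hence \<open>\<le>\<close> in one sum and \<open><\<close> in the other.

  The counts quantify over all weights of \<open>k\<close>. Because every \<open>t_i\<close> is at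
  least 2, the \<open>t_i\<close> are exactly the parts of \<open>k\<close> that differ from 1, so
  the weight is unique and a single pair \<open>(a, t)\<close> enters.\<close>

lemma subseq_Cons_split: "subseq (x # xs) w \<longleftrightarrow> (\<exists>u v. w = u @ x # v \<and> subseq xs v)"
proof
  assume "subseq (x # xs) w"
  from list_emb_ConsD[OF this] show "\<exists>u v. w = u @ x # v \<and> subseq xs v" by auto
qed (auto intro: subseq_drop_many)

lemma subseq3_nth:
  "subseq [x, y, z] w \<longleftrightarrow>
     (\<exists>i s j. i < s \<and> s < j \<and> j < length w \<and> w ! i = x \<and> w ! s = y \<and> w ! j = z)"
proof
  assume "subseq [x, y, z] w"
  then obtain u v r q where w: "w = u @ x # v @ y # r @ z # q"
    unfolding subseq_Cons_split by blast
  show "\<exists>i s j. i < s \<and> s < j \<and> j < length w \<and> w ! i = x \<and> w ! s = y \<and> w ! j = z"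
    by (rule exI[of _ "length u"], rule exI[of _ "length u + Suc (length v)"],
        rule exI[of _ "length u + Suc (length v) + Suc (length r)"])
      (simp add: w nth_append)
next
  assume "\<exists>i s j. i < s \<and> s < j \<and> j < length w \<and> w ! i = x \<and> w ! s = y \<and> w ! j = z"
  then obtain i s j where *: "i < s" "s < j" "j < length w" "w ! i = x" "w ! s = y" "w ! j = z"
    by blast
  have 1: "w = take s w @ y # drop (Suc s) w"
    using * by (metis id_take_nth_drop less_trans)
  have "x \<in> set (take s w)"
    using * by (metis (no_types, lifting) in_set_conv_nth length_take less_trans min_less_iff_conj nth_take)
  then have 2: "subseq [x] (take s w)"
    by (simp add: subseq_singleton_left)
  have "z = drop (Suc s) w ! (j - Suc s)" "j - Suc s < length (drop (Suc s) w)"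
    using * by auto
  then have "z \<in> set (drop (Suc s) w)"
    by (metis nth_mem)
  then have "subseq [y, z] (y # drop (Suc s) w)"
    by (simp add: subseq_singleton_left)
  from list_emb_append_mono[OF 2 this] show "subseq [x, y, z] w"
    using 1 by simp
qed

text \<open>As a forbidden subsequence \<open>x y x\<close> with \<open>y < x\<close>, the Stirling
  condition passes to filtered and shortened words without index arithmetic.\<close>

lemma stirling_perms_iff:
  "w \<in> stirling_perms k \<longleftrightarrow>
     mset w = letters k \<and> (\<forall>x y. subseq [x, y, x] w \<longrightarrow> x \<le> y)"
proof -
  have "(\<forall>i s j. i < s \<and> s < j \<and> j < length w \<and> w ! i = w ! j \<longrightarrow> w ! s \<ge> w ! i) \<longleftrightarrow>
    (\<forall>x y. subseq [x, y, x] w \<longrightarrow> x \<le> y)"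
    unfolding subseq3_nth by metis
  then show ?thesis
    by (simp add: stirling_perms_def permutations_of_multiset_def)
qed

lemma letters_snoc: "letters (k @ [c]) = letters k + replicate_mset c (Suc (length k))"
  by (simp add: letters_def nth_append)

lemma set_letters: "x \<in># letters k \<Longrightarrow> 1 \<le> x \<and> x \<le> length k"
  by (auto simp: letters_def set_mset_sum split: if_splits)

lemma size_letters: "size (letters k) = sum_list k"
  by (simp add: letters_def sum_list_sum_nth atLeast0LessThan)

lemma length_stirling: "w \<in> stirling_perms k \<Longrightarrow> length w = sum_list k"
  by (metis size_letters size_mset stirling_perms_iff)

lemma finite_stirling_perms: "finite (stirling_perms k)"
  by (simp add: stirling_perms_def)

lemma stirling_perms_Nil: "stirling_perms [] = {[]}"
  by (auto simp: stirling_perms_iff letters_def)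

section \<open>Insertion and removal of the block of largest letters\<close>

definition insert_block :: "nat \<Rightarrow> nat \<Rightarrow> nat list \<times> nat \<Rightarrow> nat list" where
  "insert_block c N = (\<lambda>(w, p). take p w @ replicate c N @ drop p w)"

text \<open>In a forbidden pattern \<open>x y x\<close> the letter \<open>y\<close> is below the new
  one. If \<open>x\<close> is an old letter, deleting the block leaves the pattern in
  \<open>w\<close>. If \<open>x\<close> is the new letter, both copies lie in the contiguous block,
  hence so does \<open>y\<close>, which is impossible.\<close>

lemma insert_block_stirling:
  assumes "w \<in> stirling_perms k"
  shows "insert_block c (Suc (length k)) (w, p) \<in> stirling_perms (k @ [c])"
proof -
  let ?N = "Suc (length k)"
  let ?w = "insert_block c ?N (w, p)"
  have mw: "mset w = letters k" and st: "\<And>x y. subseq [x, y, x] w \<Longrightarrow> x \<le> y"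
    using assms by (auto simp: stirling_perms_iff)
  have le: "x < ?N" if "x \<in> set w" for x
    using that mw set_letters[of x k] by (metis less_Suc_eq_le set_mset_mset)
  have "mset (take p w) + mset (drop p w) = mset w"
    by (metis append_take_drop_id mset_append)
  then have m: "mset ?w = letters (k @ [c])"
    by (simp add: insert_block_def letters_snoc flip: mw)
  have filt: "filter (\<lambda>x. x \<noteq> ?N) ?w = w"
  proof -
    have "filter (\<lambda>x. x \<noteq> ?N) (take p w) = take p w" "filter (\<lambda>x. x \<noteq> ?N) (drop p w) = drop p w"
      by (auto simp: filter_id_conv dest: le in_set_takeD in_set_dropD)
    then show ?thesis by (simp add: insert_block_def)
  qed
  have "x \<le> y" if sub: "subseq [x, y, x] ?w" for x y
  proof (rule ccontr)
    assume yx: "\<not> x \<le> y"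
    have xw: "x \<in> set ?w" "y \<in> set ?w"
      using list_emb_set[OF sub] by auto
    have "set ?w \<subseteq> insert ?N (set w)"
      by (auto simp: insert_block_def dest: in_set_takeD in_set_dropD)
    with xw le have "x \<le> ?N" by fastforce
    with yx have yN: "y < ?N" by simp
    show False
    proof (cases "x = ?N")
      case False
      with subseq_filter[OF sub, of "\<lambda>x. x \<noteq> ?N"] yN have "subseq [x, y, x] w"
        unfolding filt by simp
      with st yx show False by blast
    next
      case True
      have tk: "?N \<notin> set (take p w)" "?N \<notin> set (drop p w)"
        by (auto dest!: in_set_takeD in_set_dropD le)
      define R where "R = replicate c ?N"
      have w': "?w = take p w @ R @ drop p w"
        by (simp add: insert_block_def R_def)
      obtain i s j where ind: "i < s" "s < j" "j < length ?w" "?w ! i = ?N" "?w ! s = y" "?w ! j = ?N"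
        using sub unfolding True subseq3_nth by blast
      have "length (take p w) \<le> i"
        using ind tk(1) unfolding w' nth_append by (metis nth_mem not_le)
      moreover have "j < length (take p w) + c"
      proof (rule ccontr)
        assume "\<not> ?thesis"
        then have "?w ! j = drop p w ! (j - length (take p w) - c)"
          and "j - length (take p w) - c < length (drop p w)"
          using ind(3) unfolding w' by (auto simp: nth_append R_def)
        with ind tk(2) show False by (metis nth_mem)
      qed
      ultimately have "?w ! s = ?N"
        using ind unfolding w' by (auto simp: nth_append R_def)
      with ind yN show False by simp
    qed
  qed
  with m show ?thesis by (simp add: stirling_perms_iff)
qed

text \<open>Deleting \<open>N\<close> recovers the word, and the prefix before the first
  \<open>N\<close> recovers the position; the latter requires a nonempty block.\<close>

lemma insert_block_inj:
  assumes "c > 0" and "\<And>w p. (w, p) \<in> D \<Longrightarrow> N \<notin> set w \<and> p \<le> length w"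
  shows "inj_on (insert_block c N) D"
proof (rule inj_onI, clarify)
  fix w p w' p'
  assume D: "(w, p) \<in> D" "(w', p') \<in> D" and eq: "insert_block c N (w, p) = insert_block c N (w', p')"
  have *: "filter (\<lambda>x. x \<noteq> N) (insert_block c N (w, p)) = w \<and>
     length (takeWhile (\<lambda>x. x \<noteq> N) (insert_block c N (w, p))) = p" if "(w, p) \<in> D" for w p
  proof -
    have N: "N \<notin> set w" and p: "p \<le> length w" using assms that by auto
    have "filter (\<lambda>x. x \<noteq> N) (take p w) = take p w" "filter (\<lambda>x. x \<noteq> N) (drop p w) = drop p w"
      using N by (auto simp: filter_id_conv dest: in_set_takeD in_set_dropD)
    moreover have "takeWhile (\<lambda>x. x \<noteq> N) (take p w @ replicate c N @ drop p w) = take p w"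
      using N \<open>c > 0\<close> by (subst takeWhile_append2) (auto dest: in_set_takeD simp: gr0_conv_Suc)
    ultimately show ?thesis using p by (simp add: insert_block_def)
  qed
  show "w = w' \<and> p = p'"
    using *[OF D(1)] *[OF D(2)] eq by metis
qed

text \<open>Between the first and the last copy of the largest letter every letter is at least as
  large, hence equal to it. So the copies form one block, and what remains after its removal is a
  subsequence, which inherits the Stirling condition.\<close>

lemma stirling_perms_snocE:
  assumes w: "w \<in> stirling_perms (k @ [c])" and c: "c > 0"
  obtains u p where "u \<in> stirling_perms k" "p \<le> length u" "w = insert_block c (Suc (length k)) (u, p)"
proof -
  let ?N = "Suc (length k)"
  have mw: "mset w = letters k + replicate_mset c ?N" and st: "\<And>x y. subseq [x, y, x] w \<Longrightarrow> x \<le> y"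
    using w by (auto simp: stirling_perms_iff letters_snoc)
  have Nk: "?N \<notin># letters k" using set_letters[of ?N k] by auto
  have le: "x \<le> ?N" if "x \<in> set w" for x
  proof -
    have "x \<in># letters k + replicate_mset c ?N" using that mw by (metis set_mset_mset)
    then show ?thesis using set_letters[of x k] by (auto split: if_splits)
  qed
  have "?N \<in># mset w" using c by (simp add: mw)
  then obtain u r where ur: "w = u @ ?N # r" "?N \<notin> set u"
    by (metis set_mset_mset split_list_first)
  obtain q v where qv: "?N # r = q @ ?N # v" "?N \<notin> set v"
    using split_list_last[of ?N "?N # r"] by auto
  \<comment> \<open>\<open>q\<close> runs from the first copy of \<open>?N\<close> up to, but not
    including, the last one.\<close>
  have all: "x = ?N" if x: "x \<in> set q" for x
  proof (cases q)
    case Nil with x show ?thesis by simp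
  next
    case (Cons y q')
    with qv have y: "y = ?N" by simp
    show ?thesis
    proof (cases "x \<in> set q'")
      case True
      then have "subseq ([?N] @ [x] @ [?N]) ([?N] @ q' @ [?N])"
        by (intro list_emb_append_mono) (simp_all add: subseq_singleton_left)
      then have "subseq [?N, x, ?N] (q @ [?N])"
        by (simp add: Cons y)
      from subseq_drop_many[OF subseq_rev_drop_many[OF this]]
      have "subseq [?N, x, ?N] (u @ (q @ [?N]) @ v)" .
      then have "?N \<le> x" using st ur qv by simp
      moreover have "x \<in> set w" using x ur qv by auto
      ultimately show ?thesis using le by force
    next
      case False with x Cons y show ?thesis by simp
    qed
  qed
  define d where "d = Suc (length q)"
  have qd: "q @ [?N] = replicate d ?N"
    unfolding d_def using all by (metis replicate_length_same replicate_append_same replicate_Suc)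
  have w': "w = u @ replicate d ?N @ v"
    using ur qv by (simp flip: qd)
  have "count (mset w) ?N = d"
    using ur(2) qv(2) by (simp add: w' count_eq_zero_iff)
  moreover have "count (mset w) ?N = c"
    using Nk by (simp add: mw count_eq_zero_iff)
  ultimately have d: "d = c" by simp
  have "mset (u @ v) = letters k"
    using mw by (simp add: w' d)
  moreover have "x \<le> y" if "subseq [x, y, x] (u @ v)" for x y
  proof (rule st)
    have "subseq (u @ v) w"
      unfolding w' by (intro list_emb_append_mono subseq_drop_many) auto
    with that show "subseq [x, y, x] w" using subseq_order.order_trans by blast
  qed
  ultimately have "u @ v \<in> stirling_perms k" by (simp add: stirling_perms_iff)
  moreover have "w = insert_block c ?N (u @ v, length u)"
    by (simp add: insert_block_def w' d)
  ultimately show ?thesis using that[of "u @ v" "length u"] by simp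
qed

lemma stirling_perms_snoc:
  assumes "c > 0"
  shows "bij_betw (insert_block c (Suc (length k)))
           (stirling_perms k \<times> {..sum_list k}) (stirling_perms (k @ [c]))"
proof (rule bij_betw_imageI)
  have "Suc (length k) \<notin> set w" if "w \<in> stirling_perms k" for w
    using that set_letters[of "Suc (length k)" k] unfolding stirling_perms_iff
    by (metis not_less_eq_eq order_refl set_mset_mset)
  then show "inj_on (insert_block c (Suc (length k))) (stirling_perms k \<times> {..sum_list k})"
    using assms by (intro insert_block_inj) (auto simp: length_stirling)
  show "insert_block c (Suc (length k)) ` (stirling_perms k \<times> {..sum_list k}) = stirling_perms (k @ [c])"
  proof (intro equalityI subsetI)
    fix w assume "w \<in> stirling_perms (k @ [c])"
    then obtain u p where "u \<in> stirling_perms k" "p \<le> length u"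
        "w = insert_block c (Suc (length k)) (u, p)"
      by (rule stirling_perms_snocE[OF _ assms])
    then show "w \<in> insert_block c (Suc (length k)) ` (stirling_perms k \<times> {..sum_list k})"
      by (auto simp: length_stirling)
  qed (auto intro: insert_block_stirling)
qed

section \<open>Descents under concatenation and block insertion\<close>

lemma descents_single [simp]: "descents [x] = {0}"
  by (auto simp: descents_def)

lemma descents_Nil [simp]: "descents [] = {}"
  by (auto simp: descents_def)

lemma finite_descents [simp]: "finite (descents w)"
  by (simp add: descents_def)

lemma card_descents_Cons:
  assumes "w \<noteq> []"
  shows "card (descents (x # w)) = card (descents w) + (if x > hd w then 1 else 0)"
proof -
  have "descents (x # w) = Suc ` descents w \<union> (if x > hd w then {0} else {})"
  proof (rule set_eqI)
    fix i
    show "i \<in> descents (x # w) \<longleftrightarrow> i \<in> Suc ` descents w \<union> (if x > hd w then {0} else {})"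
      using assms by (cases i) (auto simp: descents_def hd_conv_nth)
  qed
  then show ?thesis
    by (simp add: card_image card_insert_if image_iff)
qed

text \<open>The last position of \<open>u\<close> is a descent of \<open>u\<close> by convention,
  but a descent of \<open>u @ v\<close> only if there is a genuine drop; this accounts for the
  \<open>+ 1\<close>.\<close>

lemma card_descents_append:
  assumes "u \<noteq> []" "v \<noteq> []"
  shows "card (descents (u @ v)) + 1 =
    card (descents u) + card (descents v) + (if last u > hd v then 1 else 0)"
  using assms(1)
proof (induction u rule: list_nonempty_induct)
  case (single x)
  then show ?case using assms(2) by (simp add: card_descents_Cons)
next
  case (cons x xs)
  then show ?case by (simp add: card_descents_Cons)
qed

lemma card_descents_replicate: "c > 0 \<Longrightarrow> card (descents (replicate c x)) = 1"
proof (induction c)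
  case (Suc c)
  then show ?case by (cases c) (simp_all add: card_descents_Cons)
qed simp

text \<open>Since \<open>N\<close> exceeds all letters of \<open>w\<close>, the position before the
  block is no descent, while the last position of the block is one. The block thus replaces the
  junction at \<open>p\<close> by exactly one descent, and the count grows unless that junction
  already was one. At \<open>p = length w > 0\<close> it was, by the convention on the last
  position.\<close>

lemma card_descents_insert_block:
  assumes c: "c > 0" and N: "\<And>x. x \<in> set w \<Longrightarrow> x < N" and p: "p \<le> length w"
  shows "card (descents (insert_block c N (w, p))) =
    card (descents w) + (if p \<in> Suc ` descents w then 0 else 1)"
proof -
  define u v R where "u = take p w" and "v = drop p w" and "R = replicate c N"
  have uv: "w = u @ v" and lu: "length u = p"
    using p by (simp_all add: u_def v_def)
  have ins: "insert_block c N (w, p) = u @ R @ v"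
    by (simp add: insert_block_def u_def v_def R_def)
  have R: "R \<noteq> []" "hd R = N" "last R = N" "card (descents R) = 1"
    using c by (auto simp: R_def card_descents_replicate hd_replicate)
  have lt: "last u < N" if "u \<noteq> []" using that N uv by auto
  have hlt: "hd v < N" if "v \<noteq> []" using that N uv by auto
  have iff: "p \<in> Suc ` descents w \<longleftrightarrow> u \<noteq> [] \<and> (v = [] \<or> last u > hd v)"
  proof (cases "u = []")
    case True
    then show ?thesis using lu by auto
  next
    case False
    then obtain q where q: "p = Suc q" using lu by (cases p) auto
    have "last u = w ! q" using False lu by (simp add: uv last_conv_nth nth_append q)
    moreover have "v \<noteq> [] \<Longrightarrow> hd v = w ! Suc q" using lu by (simp add: uv hd_conv_nth nth_append q)
    ultimately show ?thesis using lu False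
      by (auto simp: q descents_def uv)
  qed
  have Rv: "card (descents (R @ v)) = 1 + card (descents v)"
  proof (cases "v = []")
    case False
    then show ?thesis using card_descents_append[OF R(1) False] hlt R by simp
  qed (simp add: R)
  show ?thesis
  proof (cases "u = []")
    case True
    then show ?thesis unfolding ins iff using Rv uv by simp
  next
    case False
    have "card (descents (u @ R @ v)) + 1 = card (descents u) + card (descents (R @ v))"
      using card_descents_append[OF False, of "R @ v"] R lt[OF False] by simp
    then have 1: "card (descents (u @ R @ v)) = card (descents u) + card (descents v)"
      using Rv by simp
    show ?thesis
    proof (cases "v = []")
      case True
      then show ?thesis unfolding ins iff 1 using False by (simp add: uv)
    next
      case v: False
      show ?thesis unfolding ins iff 1 using card_descents_append[OF False v] False v
        by (auto simp: uv)
    qed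
  qed
qed

lemma card_descents_le_length: "card (descents w) \<le> length w"
proof -
  have "descents w \<subseteq> {..<length w}" by (auto simp: descents_def)
  then show ?thesis by (metis card_lessThan card_mono finite_lessThan)
qed

lemma stirling_perms_less:
  assumes "w \<in> stirling_perms k" "x \<in> set w"
  shows "x < Suc (length k)"
  using assms set_letters[of x k] unfolding stirling_perms_iff
  by (metis le_imp_less_Suc set_mset_mset)

text \<open>Of the \<open>sum_list k + 1\<close> insertion places, those right after a descent keep
  the count and the others raise it. The weight \<open>g\<close> is left general because the two
  series use different exponents, \<open>d\<close> and
  \<open>sum_list k + c + 1 - d\<close>.\<close>

lemma sum_stirling_perms_snoc:
  fixes g :: "nat \<Rightarrow> 'a::comm_semiring_1"
  assumes c: "c > 0"
  shows "(\<Sum>w\<in>stirling_perms (k @ [c]). g (card (descents w))) =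
    (\<Sum>w\<in>stirling_perms k. of_nat (card (descents w)) * g (card (descents w)) +
       of_nat (sum_list k + 1 - card (descents w)) * g (Suc (card (descents w))))"
proof -
  let ?N = "Suc (length k)" and ?d = "\<lambda>w. card (descents w)"
  have "(\<Sum>w\<in>stirling_perms (k @ [c]). g (?d w)) =
     (\<Sum>(w, p)\<in>stirling_perms k \<times> {..sum_list k}. g (?d (insert_block c ?N (w, p))))"
    using sum.reindex_bij_betw[OF stirling_perms_snoc[OF c, of k], of "\<lambda>w. g (?d w)"]
    by (simp add: case_prod_unfold)
  also have "\<dots> = (\<Sum>w\<in>stirling_perms k. \<Sum>p\<le>sum_list k. g (?d (insert_block c ?N (w, p))))"
    by (simp add: sum.cartesian_product)
  also have "\<dots> = (\<Sum>w\<in>stirling_perms k. of_nat (?d w) * g (?d w) +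
       of_nat (sum_list k + 1 - ?d w) * g (Suc (?d w)))"
  proof (rule sum.cong[OF refl])
    fix w assume w: "w \<in> stirling_perms k"
    let ?D = "Suc ` descents w" and ?P = "{..sum_list k}"
    have sub: "?D \<subseteq> ?P"
      using length_stirling[OF w] by (auto simp: descents_def)
    have "(\<Sum>p\<in>?P. g (?d (insert_block c ?N (w, p)))) =
        (\<Sum>p\<in>?P. if p \<in> ?D then g (?d w) else g (Suc (?d w)))"
      using stirling_perms_less[OF w] length_stirling[OF w] c
      by (intro sum.cong refl) (simp add: card_descents_insert_block)
    also have "\<dots> = (\<Sum>p\<in>?D. g (?d w)) + (\<Sum>p\<in>?P - ?D. g (Suc (?d w)))"
      using sub by (subst sum.If_cases) (auto simp: Int_absorb1 Int_commute Diff_eq)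
    also have "card (?P - ?D) = sum_list k + 1 - ?d w"
      using sub by (subst card_Diff_subset) (auto simp: card_image)
    then have "(\<Sum>p\<in>?D. g (?d w)) + (\<Sum>p\<in>?P - ?D. g (Suc (?d w))) =
       of_nat (?d w) * g (?d w) + of_nat (sum_list k + 1 - ?d w) * g (Suc (?d w))"
      by (simp add: card_image)
    finally show "(\<Sum>p\<in>?P. g (?d (insert_block c ?N (w, p)))) = \<dots>" .
  qed
  finally show ?thesis .
qed

lemma card_descents_stirling_le:
  assumes "\<forall>x\<in>set k. x > 0" "w \<in> stirling_perms k"
  shows "card (descents w) \<le> length k"
  using assms
proof (induction k arbitrary: w rule: rev_induct)
  case Nil
  then show ?case by (simp add: stirling_perms_Nil)
next
  case (snoc c k)
  then have c: "c > 0" by simp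
  obtain u p where u: "u \<in> stirling_perms k" "p \<le> length u" "w = insert_block c (Suc (length k)) (u, p)"
    using stirling_perms_snocE[OF snoc.prems(2) c] .
  have "card (descents w) \<le> card (descents u) + 1"
    unfolding u(3) using stirling_perms_less[OF u(1)] u(2)
    by (subst card_descents_insert_block[OF c]) auto
  also have "\<dots> \<le> Suc (length k)" using snoc u by simp
  finally show ?case by simp
qed

lemma card_descents_pos: "w \<noteq> [] \<Longrightarrow> card (descents w) > 0"
  by (auto simp: card_gt_0_iff descents_def intro!: exI[of _ "length w - 1"])

subsection \<open>Generating functions\<close>

text \<open>
  Both sums of the theorem range over chains \<open>i_1 R \<dots> R i_l R m\<close> of positive integers, with \<open>R\<close>
  either \<open>\<le>\<close> or \<open><\<close>. Setting \<open>i_(l+1) = m\<close> absorbs the last binomial factor into the product.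
\<close>

definition chains :: "(nat \<Rightarrow> nat \<Rightarrow> bool) \<Rightarrow> nat \<Rightarrow> nat \<Rightarrow> nat list set" where
  "chains R l m = {i. length i = l \<and> 0 \<notin> set i \<and> sorted_wrt R (i @ [m])}"

definition chain_sum ::
    "(nat \<Rightarrow> nat \<Rightarrow> bool) \<Rightarrow> (nat \<Rightarrow> nat \<Rightarrow> nat \<Rightarrow> nat) \<Rightarrow> nat \<Rightarrow> nat \<Rightarrow> nat" where
  "chain_sum R \<phi> l m = (\<Sum>i\<in>chains R l m. \<Prod>j<l. \<phi> j (i ! j) ((i @ [m]) ! Suc j))"

lemma finite_chains:
  assumes "\<And>p q. R p q \<Longrightarrow> p \<le> q"
  shows "finite (chains R l m)"
proof (rule finite_subset)
  show "chains R l m \<subseteq> {i. set i \<subseteq> {..m} \<and> length i = l}"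
    using assms by (auto simp: chains_def sorted_wrt_append)
qed (simp add: finite_lists_length_eq)

lemma chain_sum_0 [simp]: "chain_sum R \<phi> 0 m = 1"
proof -
  have "chains R 0 m = {[]}" by (auto simp: chains_def)
  then show ?thesis by (simp add: chain_sum_def)
qed

lemma chain_sum_cong:
  assumes "\<And>j. j < l \<Longrightarrow> \<phi> j = \<psi> j"
  shows "chain_sum R \<phi> l m = chain_sum R \<psi> l m"
  using assms by (simp add: chain_sum_def)

text \<open>The last index \<open>p\<close> of a chain becomes the end point for the indices before
  it. Transitivity is what keeps a chain below \<open>p\<close> also below \<open>m\<close>.\<close>

lemma chain_sum_Suc:
  assumes R: "\<And>p q. R p q \<Longrightarrow> p \<le> q" and tr: "transp R"
  shows "chain_sum R \<phi> (Suc l) m = (\<Sum>p | 0 < p \<and> R p m. \<phi> l p m * chain_sum R \<phi> l p)"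
proof -
  let ?f = "\<lambda>(p, i). i @ [p] :: nat list"
  let ?D = "SIGMA p:{p. 0 < p \<and> R p m}. chains R l p"
  have fin: "finite {p. 0 < p \<and> R p m}"
    using R by (auto intro: finite_subset[of _ "{..m}"])
  have bij: "bij_betw ?f ?D (chains R (Suc l) m)"
  proof (rule bij_betw_imageI)
    show "inj_on ?f ?D" by (auto simp: inj_on_def)
    show "?f ` ?D = chains R (Suc l) m"
    proof (intro equalityI subsetI)
      fix i assume i: "i \<in> chains R (Suc l) m"
      then obtain i' p where "i = i' @ [p]"
        by (cases i rule: rev_cases) (auto simp: chains_def)
      with i show "i \<in> ?f ` ?D"
        by (auto simp: chains_def sorted_wrt_append image_iff)
    next
      fix i assume "i \<in> ?f ` ?D"
      then show "i \<in> chains R (Suc l) m"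
        using tr by (auto simp: chains_def sorted_wrt_append dest: transpD)
    qed
  qed
  have "chain_sum R \<phi> (Suc l) m =
     (\<Sum>(p, i)\<in>?D. \<Prod>j<Suc l. \<phi> j ((i @ [p]) ! j) ((i @ [p] @ [m]) ! Suc j))"
    unfolding chain_sum_def sum.reindex_bij_betw[OF bij, symmetric]
    by (simp add: case_prod_unfold)
  also have "\<dots> = (\<Sum>(p, i)\<in>?D. \<phi> l p m * (\<Prod>j<l. \<phi> j (i ! j) ((i @ [p]) ! Suc j)))"
    by (intro sum.cong refl)
      (auto simp: chains_def nth_append mult.commute intro!: prod.cong arg_cong2[of _ _ _ _ "(*)"])
  also have "\<dots> = (\<Sum>p | 0 < p \<and> R p m. \<phi> l p m * chain_sum R \<phi> l p)"
    using fin by (simp add: chain_sum_def sum_distrib_left sum.Sigma finite_chains[OF R])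
  finally show ?thesis .
qed

section \<open>Powers of the geometric series under the Euler operator\<close>

abbreviation geo :: "rat fps" where
  "geo \<equiv> inverse (1 - fps_X)"

lemma geo_power_Suc: "geo ^ n = (1 - fps_X) * geo ^ Suc n"
proof -
  have "(1 - fps_X) * geo = 1" by (simp add: inverse_mult_eq_1')
  then have "(1 - fps_X) * geo * geo ^ n = geo ^ n" by simp
  then show ?thesis by (simp only: power_Suc mult.assoc)
qed

lemma fps_deriv_geo_power: "fps_deriv (geo ^ n) = of_nat n * geo ^ Suc n"
proof (induction n)
  case (Suc n)
  have "fps_deriv geo = geo * geo"
    by (subst fps_inverse_deriv) (simp_all add: power2_eq_square)
  with Suc show ?case by (simp add: algebra_simps)
qed simp

text \<open>For a word of length \<open>K\<close> with \<open>d\<close> descents and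
  \<open>n = K + 1\<close>, the coefficients \<open>d\<close> and \<open>n - d\<close> are the
  numbers of insertion places that keep and that raise the number of descents. So one application of
  the Euler operator performs one insertion.\<close>

lemma theta_monomial_geo:
  "fps_X * fps_deriv (fps_X ^ d * geo ^ n) =
     (of_nat d * fps_X ^ d + (of_nat n - of_nat d) * fps_X ^ Suc d) * geo ^ Suc n"
proof -
  have 1: "fps_X * fps_deriv (fps_X ^ d) = (of_nat d * fps_X ^ d :: rat fps)"
    by (induction d) (simp_all add: algebra_simps)
  have "fps_X * fps_deriv (fps_X ^ d * geo ^ n) =
      fps_X * fps_deriv (fps_X ^ d) * geo ^ n + fps_X ^ Suc d * fps_deriv (geo ^ n)"
    by (simp add: algebra_simps)
  also have "\<dots> = of_nat d * fps_X ^ d * ((1 - fps_X) * geo ^ Suc n) +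
      fps_X ^ Suc d * (of_nat n * geo ^ Suc n)"
    unfolding 1 fps_deriv_geo_power by (subst geo_power_Suc) simp
  also have "\<dots> = (of_nat d * fps_X ^ d + (of_nat n - of_nat d) * fps_X ^ Suc d) * geo ^ Suc n"
    by (simp add: algebra_simps)
  finally show ?thesis .
qed

text \<open>
  These series are defined directly by summing over words. Unlike the defining sums of
  \<open>stirling_B\<close> and \<open>stirling_b\<close>, which start at one descent, they are also correct
  for \<open>k = []\<close>, where the recursion starts.
\<close>

definition B_gf :: "nat list \<Rightarrow> rat fps" where
  "B_gf k = (\<Sum>w\<in>stirling_perms k. fps_X ^ card (descents w)) * geo ^ (sum_list k + 1)"

definition b_gf :: "nat list \<Rightarrow> rat fps" where
  "b_gf k = (\<Sum>w\<in>stirling_perms k. fps_X ^ (sum_list k + 1 - card (descents w))) * geo ^ (sum_list k + 1)"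

text \<open>The Euler operator carries out the insertion and raises the exponent of
  \<open>geo\<close> from \<open>K + 1\<close> to \<open>K + 2\<close>. The new words have length
  \<open>K + c\<close>, so \<open>c - 1\<close> further factors are missing.\<close>

lemma B_gf_snoc:
  assumes c: "c > 0"
  shows "B_gf (k @ [c]) = geo ^ (c - 1) * (fps_X * fps_deriv (B_gf k))"
proof -
  let ?d = "\<lambda>w. card (descents w)" and ?K = "sum_list k"
  have "fps_X * fps_deriv (B_gf k) =
      (\<Sum>w\<in>stirling_perms k. fps_X * fps_deriv (fps_X ^ ?d w * geo ^ (?K + 1)))"
    by (simp add: B_gf_def sum_distrib_right sum_distrib_left fps_deriv_sum)
  also have "\<dots> = (\<Sum>w\<in>stirling_perms k. of_nat (?d w) * fps_X ^ ?d w +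
       of_nat (?K + 1 - ?d w) * fps_X ^ Suc (?d w)) * geo ^ Suc (?K + 1)"
    unfolding theta_monomial_geo sum_distrib_right
  proof (intro sum.cong refl)
    fix w assume "w \<in> stirling_perms k"
    \<comment> \<open>This bound makes the truncated difference of naturals agree with the
      difference of series.\<close>
    then have "?d w \<le> ?K + 1"
      using card_descents_le_length length_stirling by (metis trans_le_add1)
    then have "(of_nat (?K + 1 - ?d w) :: rat fps) = of_nat (?K + 1) - of_nat (?d w)"
      by (rule of_nat_diff)
    then show "(of_nat (?d w) * fps_X ^ ?d w + (of_nat (?K + 1) - of_nat (?d w)) * fps_X ^ Suc (?d w)) *
          geo ^ Suc (?K + 1) =
        (of_nat (?d w) * fps_X ^ ?d w + of_nat (?K + 1 - ?d w) * fps_X ^ Suc (?d w)) * geo ^ Suc (?K + 1)"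
      by (simp only:)
  qed
  also have "\<dots> = (\<Sum>w\<in>stirling_perms (k @ [c]). fps_X ^ ?d w) * geo ^ Suc (?K + 1)"
    by (simp only: sum_stirling_perms_snoc[OF c, of "\<lambda>d. fps_X ^ d"])
  finally have "geo ^ (c - 1) * (fps_X * fps_deriv (B_gf k)) =
      (\<Sum>w\<in>stirling_perms (k @ [c]). fps_X ^ ?d w) * geo ^ (c - 1 + Suc (?K + 1))"
    by (simp only: power_add mult_ac)
  also have "c - 1 + Suc (?K + 1) = sum_list (k @ [c]) + 1"
    using c by simp
  finally show ?thesis unfolding B_gf_def by (rule sym)
qed

text \<open>With exponent \<open>e = K + 1 - d\<close> the two cases change places: \<open>e\<close>
  counts the insertions that raise \<open>d\<close>, and \<open>K + 1 - e = d\<close> those that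
  keep it. Lengthening the words by \<open>c\<close> instead of 1 shifts all exponents by
  \<open>c - 1\<close>, whence the additional power of \<open>fps_X\<close>.\<close>

lemma b_gf_snoc:
  assumes c: "c > 0"
  shows "b_gf (k @ [c]) = (fps_X * geo) ^ (c - 1) * (fps_X * fps_deriv (b_gf k))"
proof -
  let ?d = "\<lambda>w. card (descents w)" and ?K = "sum_list k"
  have "fps_X * fps_deriv (b_gf k) =
      (\<Sum>w\<in>stirling_perms k. fps_X * fps_deriv (fps_X ^ (?K + 1 - ?d w) * geo ^ (?K + 1)))"
    by (simp add: b_gf_def sum_distrib_right sum_distrib_left fps_deriv_sum)
  also have "\<dots> = (\<Sum>w\<in>stirling_perms k. of_nat (?d w) * fps_X ^ (?K + 2 - ?d w) +
       of_nat (?K + 1 - ?d w) * fps_X ^ (?K + 1 - ?d w)) * geo ^ Suc (?K + 1)"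
    unfolding theta_monomial_geo sum_distrib_right
  proof (intro sum.cong refl)
    fix w assume "w \<in> stirling_perms k"
    then have le: "?d w \<le> ?K" using card_descents_le_length length_stirling by metis
    then have "Suc (?K + 1 - ?d w) = ?K + 2 - ?d w" by simp
    moreover have "of_nat (?K + 1) - of_nat (?K + 1 - ?d w) = (of_nat (?d w) :: rat fps)"
      using le by (simp add: of_nat_diff)
    ultimately show "(of_nat (?K + 1 - ?d w) * fps_X ^ (?K + 1 - ?d w) +
          (of_nat (?K + 1) - of_nat (?K + 1 - ?d w)) * fps_X ^ Suc (?K + 1 - ?d w)) * geo ^ Suc (?K + 1) =
        (of_nat (?d w) * fps_X ^ (?K + 2 - ?d w) +
          of_nat (?K + 1 - ?d w) * fps_X ^ (?K + 1 - ?d w)) * geo ^ Suc (?K + 1)"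
      by (simp only: add.commute)
  qed
  finally have "(fps_X * geo) ^ (c - 1) * (fps_X * fps_deriv (b_gf k)) =
      fps_X ^ (c - 1) * (\<Sum>w\<in>stirling_perms k. of_nat (?d w) * fps_X ^ (?K + 2 - ?d w) +
       of_nat (?K + 1 - ?d w) * fps_X ^ (?K + 1 - ?d w)) * geo ^ (c - 1 + Suc (?K + 1))"
    by (simp only: power_add power_mult_distrib mult_ac)
  also have "c - 1 + Suc (?K + 1) = sum_list (k @ [c]) + 1"
    using c by simp
  also have "fps_X ^ (c - 1) * (\<Sum>w\<in>stirling_perms k. of_nat (?d w) * fps_X ^ (?K + 2 - ?d w) +
       of_nat (?K + 1 - ?d w) * fps_X ^ (?K + 1 - ?d w)) =
     (\<Sum>w\<in>stirling_perms k. of_nat (?d w) * (fps_X :: rat fps) ^ (?K + c + 1 - ?d w) +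
       of_nat (?K + 1 - ?d w) * fps_X ^ (?K + c + 1 - Suc (?d w)))"
    unfolding sum_distrib_left
  proof (intro sum.cong refl)
    fix w assume "w \<in> stirling_perms k"
    then have le: "?d w \<le> ?K" using card_descents_le_length length_stirling by metis
    then have "?K + c + 1 - ?d w = c - 1 + (?K + 2 - ?d w)"
       "?K + c + 1 - Suc (?d w) = c - 1 + (?K + 1 - ?d w)"
      using c by auto
    then show "fps_X ^ (c - 1) * (of_nat (?d w) * fps_X ^ (?K + 2 - ?d w) +
          of_nat (?K + 1 - ?d w) * fps_X ^ (?K + 1 - ?d w)) =
        (of_nat (?d w) * fps_X ^ (?K + c + 1 - ?d w) +
       of_nat (?K + 1 - ?d w) * fps_X ^ (?K + c + 1 - Suc (?d w)) :: rat fps)"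
      by (simp only: power_add distrib_left mult_ac)
  qed
  also have "\<dots> = (\<Sum>w\<in>stirling_perms (k @ [c]). fps_X ^ (sum_list (k @ [c]) + 1 - ?d w))"
    by (simp add: sum_stirling_perms_snoc[OF c, of "\<lambda>d. fps_X ^ (?K + c + 1 - d)", simplified])
  finally show ?thesis unfolding b_gf_def by (rule sym)
qed

section \<open>From Eulerian numbers to series over words\<close>

lemma sum_powers_by_value:
  assumes "finite A" "f ` A \<subseteq> I" "finite I"
  shows "(\<Sum>i\<in>I. of_nat (card {w\<in>A. f w = i}) * g i) = (\<Sum>w\<in>A. (g (f w) :: 'a :: comm_semiring_1))"
proof -
  have "(\<Sum>w\<in>A. g (f w)) = (\<Sum>i\<in>I. \<Sum>w\<in>{w\<in>A. f w = i}. g (f w))"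
    using assms by (intro sum.group[symmetric]) auto
  also have "\<dots> = (\<Sum>i\<in>I. \<Sum>w\<in>{w\<in>A. f w = i}. g i)"
    by (intro sum.cong) auto
  finally show ?thesis by simp
qed

lemma length_le_sum_list: "\<forall>x\<in>set k. x > 0 \<Longrightarrow> length k \<le> sum_list (k :: nat list)"
  by (induction k) auto

text \<open>The range is that of the defining sums, so grouping words by their number of descents
  loses no word.\<close>

lemma card_descents_stirling_range:
  assumes pos: "\<forall>x\<in>set k. x > 0" and ne: "k \<noteq> []" and w: "w \<in> stirling_perms k"
  shows "card (descents w) \<in> {1..length k}"
proof -
  have "length w \<ge> length k"
    using length_le_sum_list[OF pos] length_stirling[OF w] by simp
  then have "w \<noteq> []" using ne by auto
  then show ?thesis
    using card_descents_pos card_descents_stirling_le[OF pos w] by (simp add: Suc_leI)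
qed

lemma fps_divide_geo: "f / (1 - fps_X) ^ n = f * geo ^ n"
  by (subst fps_divide_unit) (simp_all add: fps_inverse_power fps_power_zeroth)

lemma stirling_B_eq:
  assumes "\<forall>x\<in>set k. x > 0" "k \<noteq> []"
  shows "stirling_B k m = fps_nth (B_gf k) m"
proof -
  have "(\<Sum>i = 1..length k. of_nat (stirling_eulerian k i) * fps_X ^ i) =
      (\<Sum>w\<in>stirling_perms k. (fps_X :: rat fps) ^ card (descents w))"
    unfolding stirling_eulerian_def using card_descents_stirling_range[OF assms]
    by (intro sum_powers_by_value) (auto simp: finite_stirling_perms)
  then show ?thesis unfolding stirling_B_def B_gf_def fps_divide_geo by simp
qed

lemma stirling_b_eq:
  assumes "\<forall>x\<in>set k. x > 0" "k \<noteq> []"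
  shows "stirling_b k m = fps_nth (b_gf k) m"
proof -
  let ?K = "sum_list k"
  have le: "length k \<le> ?K" using assms by (simp add: length_le_sum_list)
  have "(\<Sum>i = ?K - length k + 1..?K. of_nat (stirling_eulerian k (?K + 1 - i)) * fps_X ^ i) =
      (\<Sum>i = 1..length k. of_nat (stirling_eulerian k i) * (fps_X :: rat fps) ^ (?K + 1 - i))"
    using le by (intro sum.reindex_bij_witness[of _ "\<lambda>i. ?K + 1 - i" "\<lambda>i. ?K + 1 - i"]) auto
  also have "\<dots> = (\<Sum>w\<in>stirling_perms k. (fps_X :: rat fps) ^ (?K + 1 - card (descents w)))"
    unfolding stirling_eulerian_def using card_descents_stirling_range[OF assms]
    by (intro sum_powers_by_value) (auto simp: finite_stirling_perms)
  finally show ?thesis unfolding stirling_b_def b_gf_def fps_divide_geo by simp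
qed

section \<open>Coefficients for one stretch of ones followed by a larger part\<close>

lemma fps_nth_theta: "fps_nth (fps_X * fps_deriv f) m = of_nat m * fps_nth f m"
  by (cases m) (simp_all)

lemma geo_power_nth: "fps_nth (geo ^ Suc n) d = of_nat ((n + d) choose d)"
  using one_minus_const_fps_X_neg_power'[of "Suc n" "1::rat"]
  by (simp add: fps_inverse_power del: power_Suc)

text \<open>The shift by \<open>Suc n\<close> and the symmetry of binomial coefficients give the
  formula. The case \<open>d = n = 0\<close> has to be excluded: there the coefficient is 0, but
  \<open>(d - 1) choose n\<close> is 1.\<close>

lemma X_geo_power_nth:
  assumes "d > 0"
  shows "fps_nth ((fps_X * geo) ^ Suc n) d = of_nat ((d - 1) choose n)"
proof -
  have "fps_nth ((fps_X * geo) ^ Suc n) d = fps_nth (fps_X ^ Suc n * geo ^ Suc n) d"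
    by (simp only: power_mult_distrib)
  also have "\<dots> = (if d < Suc n then 0 else fps_nth (geo ^ Suc n) (d - Suc n))"
    by (rule fps_X_power_mult_nth)
  also have "\<dots> = of_nat ((d - 1) choose n)"
  proof (cases "d < Suc n")
    case False
    then have "(d - 1 choose (d - Suc n)) = (d - 1 choose n)"
      using binomial_symmetric[of n "d - 1"] by simp
    with False show ?thesis by (simp add: geo_power_nth del: power_Suc)
  qed (use assms in simp)
  finally show ?thesis .
qed

lemma B_gf_ones: "fps_nth (B_gf (k @ replicate r 1)) m = of_nat m ^ r * fps_nth (B_gf k) m"
proof (induction r)
  case (Suc r)
  have "k @ replicate (Suc r) 1 = (k @ replicate r 1) @ [1]"
    by (simp add: replicate_append_same)
  then show ?case using Suc by (simp only: B_gf_snoc zero_less_one) (simp add: fps_nth_theta)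
qed simp

lemma b_gf_ones: "fps_nth (b_gf (k @ replicate r 1)) m = of_nat m ^ r * fps_nth (b_gf k) m"
proof (induction r)
  case (Suc r)
  have "k @ replicate (Suc r) 1 = (k @ replicate r 1) @ [1]"
    by (simp add: replicate_append_same)
  then show ?case using Suc by (simp only: b_gf_snoc zero_less_one) (simp add: fps_nth_theta)
qed simp

text \<open>The ones and the part \<open>y\<close> apply the Euler operator \<open>x\<close> times,
  giving \<open>p ^ x\<close>; the remaining \<open>geo ^ (y - 1)\<close> acts by convolution. The
  term \<open>p = 0\<close> vanishes because \<open>x \<ge> 1\<close>.\<close>

lemma B_gf_segment:
  assumes "x \<ge> 1" "y \<ge> 2"
  shows "fps_nth (B_gf (k @ replicate (x - 1) 1 @ [y])) m =
    (\<Sum>p\<in>{1..m}. of_nat (p ^ x * ((y + m - p - 2) choose (m - p))) * fps_nth (B_gf k) p)"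
proof -
  define x' y' where "x' = x - 1" and "y' = y - 2"
  then have xy: "x = Suc x'" "y = Suc (Suc y')"
    using assms by auto
  have "B_gf (k @ replicate (x - 1) 1 @ [y]) =
     (fps_X * fps_deriv (B_gf (k @ replicate x' 1))) * geo ^ Suc y'"
    using B_gf_snoc[of y "k @ replicate x' 1"] by (simp add: xy mult_ac)
  then have "fps_nth (B_gf (k @ replicate (x - 1) 1 @ [y])) m =
     (\<Sum>p = 0..m. of_nat p * (of_nat p ^ x' * fps_nth (B_gf k) p) * of_nat ((y' + (m - p)) choose (m - p)))"
    by (simp only: fps_mult_nth[of "fps_X * fps_deriv (B_gf (k @ replicate x' 1))"] fps_nth_theta B_gf_ones geo_power_nth)
  also have "\<dots> = (\<Sum>p\<in>{1..m}. of_nat p * (of_nat p ^ x' * fps_nth (B_gf k) p) * of_nat ((y' + (m - p)) choose (m - p)))"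
    by (intro sum.mono_neutral_right) (auto simp: not_less_eq_eq)
  also have "\<dots> = (\<Sum>p\<in>{1..m}. of_nat (p ^ x * ((y + m - p - 2) choose (m - p))) * fps_nth (B_gf k) p)"
    by (intro sum.cong refl) (simp add: xy)
  finally show ?thesis .
qed

lemma b_gf_segment:
  assumes "x \<ge> 1" "y \<ge> 2"
  shows "fps_nth (b_gf (k @ replicate (x - 1) 1 @ [y])) m =
    (\<Sum>p\<in>{1..<m}. of_nat (p ^ x * ((m - p - 1) choose (y - 2))) * fps_nth (b_gf k) p)"
proof -
  define x' y' where "x' = x - 1" and "y' = y - 2"
  then have xy: "x = Suc x'" "y = Suc (Suc y')"
    using assms by auto
  have "b_gf (k @ replicate (x - 1) 1 @ [y]) =
     (fps_X * fps_deriv (b_gf (k @ replicate x' 1))) * (fps_X * geo) ^ Suc y'"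
    using b_gf_snoc[of y "k @ replicate x' 1"] by (simp add: xy mult_ac)
  then have "fps_nth (b_gf (k @ replicate (x - 1) 1 @ [y])) m =
     (\<Sum>p = 0..m. of_nat p * (of_nat p ^ x' * fps_nth (b_gf k) p) * fps_nth ((fps_X * geo) ^ Suc y') (m - p))"
    by (simp only: fps_mult_nth[of "fps_X * fps_deriv (b_gf (k @ replicate x' 1))"] fps_nth_theta b_gf_ones)
  also have "\<dots> = (\<Sum>p\<in>{1..<m}. of_nat p * (of_nat p ^ x' * fps_nth (b_gf k) p) * fps_nth ((fps_X * geo) ^ Suc y') (m - p))"
  proof (intro sum.mono_neutral_right ballI)
    \<comment> \<open>The term \<open>p = 0\<close> carries the factor \<open>of_nat p\<close>; the
      term \<open>p = m\<close> meets the constant term of a positive power of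
      \<open>fps_X * geo\<close>, which is 0.\<close>
    fix p assume "p \<in> {0..m} - {1..<m}"
    then have "p = 0 \<or> p = m" by auto
    then show "of_nat p * (of_nat p ^ x' * fps_nth (b_gf k) p) * fps_nth ((fps_X * geo) ^ Suc y') (m - p) = 0"
      by auto
  qed auto
  also have "\<dots> = (\<Sum>p\<in>{1..<m}. of_nat (p ^ x * ((m - p - 1) choose (y - 2))) * fps_nth (b_gf k) p)"
    by (intro sum.cong refl) (simp add: xy X_geo_power_nth del: power_Suc, simp)
  finally show ?thesis .
qed

definition of_weight :: "nat list \<Rightarrow> nat list \<Rightarrow> nat list" where
  "of_weight a t = concat (map2 (\<lambda>x y. replicate (x - 1) 1 @ [y]) a t)"

lemma of_weight_snoc:
  "length a = length t \<Longrightarrow> of_weight (a @ [x]) (t @ [y]) = of_weight a t @ replicate (x - 1) 1 @ [y]"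
  by (simp add: of_weight_def)

text \<open>The binomial coefficient is the coefficient of \<open>x^(q-p)\<close> in
  \<open>(1-x)^-(t_j - 1)\<close> for \<open>p \<le> q\<close>; the one in \<open>b_kernel\<close>
  is that of \<open>(x/(1-x))^(t_j - 1)\<close> for \<open>p < q\<close>.\<close>

definition B_kernel :: "nat list \<Rightarrow> nat list \<Rightarrow> nat \<Rightarrow> nat \<Rightarrow> nat \<Rightarrow> nat" where
  "B_kernel a t j p q = p ^ (a ! j) * ((t ! j + q - p - 2) choose (q - p))"

definition b_kernel :: "nat list \<Rightarrow> nat list \<Rightarrow> nat \<Rightarrow> nat \<Rightarrow> nat \<Rightarrow> nat" where
  "b_kernel a t j p q = p ^ (a ! j) * ((q - p - 1) choose (t ! j - 2))"

lemma B_gf_chain_sum: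
  assumes "length a = length t" "\<forall>x\<in>set a. x \<ge> 1" "\<forall>y\<in>set t. y \<ge> 2"
  shows "fps_nth (B_gf (of_weight a t)) m = of_nat (chain_sum (\<le>) (B_kernel a t) (length a) m)"
  using assms
proof (induction a arbitrary: t m rule: rev_induct)
  case Nil
  then show ?case using geo_power_nth[of 0 m]
    by (simp add: of_weight_def B_gf_def stirling_perms_Nil)
next
  case (snoc x a t')
  then obtain t y where t': "t' = t @ [y]"
    by (cases t' rule: rev_cases) auto
  with snoc.prems have len: "length a = length t" and xy: "x \<ge> 1" "y \<ge> 2"
    by auto
  have IH: "fps_nth (B_gf (of_weight a t)) p = of_nat (chain_sum (\<le>) (B_kernel a t) (length a) p)" for p
    using snoc t' by auto
  have "chain_sum (\<le>) (B_kernel (a @ [x]) (t @ [y])) (length a) p =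
      chain_sum (\<le>) (B_kernel a t) (length a) p" for p
    by (intro chain_sum_cong ext) (simp add: B_kernel_def nth_append flip: len)
  note ch = this
  have ker: "B_kernel (a @ [x]) (t @ [y]) (length a) p m = p ^ x * ((y + m - p - 2) choose (m - p))" for p
    by (simp add: B_kernel_def nth_append len)
  have set: "{p. 0 < p \<and> p \<le> m} = {1..m}" by auto
  have "fps_nth (B_gf (of_weight (a @ [x]) t')) m =
      (\<Sum>p\<in>{1..m}. of_nat (p ^ x * ((y + m - p - 2) choose (m - p))) * fps_nth (B_gf (of_weight a t)) p)"
    by (simp only: t' of_weight_snoc[OF len] B_gf_segment[OF xy])
  also have "\<dots> = of_nat (\<Sum>p\<in>{1..m}. p ^ x * ((y + m - p - 2) choose (m - p)) * chain_sum (\<le>) (B_kernel a t) (length a) p)"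
    by (simp add: IH)
  also have "\<dots> = of_nat (chain_sum (\<le>) (B_kernel (a @ [x]) t') (Suc (length a)) m)"
    by (subst chain_sum_Suc) (simp_all add: t' ch ker set transp_on_le)
  finally show ?case by simp
qed

text \<open>The series of the empty tuple is \<open>x/(1-x)\<close>: its positive coefficients are
  1, like the empty chain sum, but its constant term is 0. Hence the restriction to
  \<open>m > 0\<close>, which the recursion respects since it only reaches
  \<open>p \<ge> 1\<close>.\<close>

lemma b_gf_chain_sum:
  assumes "length a = length t" "\<forall>x\<in>set a. x \<ge> 1" "\<forall>y\<in>set t. y \<ge> 2" "m > 0"
  shows "fps_nth (b_gf (of_weight a t)) m = of_nat (chain_sum (<) (b_kernel a t) (length a) m)"
  using assms
proof (induction a arbitrary: t m rule: rev_induct)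
  case Nil
  then show ?case using geo_power_nth[of 0 "m - 1"]
    by (simp add: of_weight_def b_gf_def stirling_perms_Nil)
next
  case (snoc x a t')
  then obtain t y where t': "t' = t @ [y]"
    by (cases t' rule: rev_cases) auto
  with snoc.prems have len: "length a = length t" and xy: "x \<ge> 1" "y \<ge> 2"
    by auto
  have IH: "fps_nth (b_gf (of_weight a t)) p = of_nat (chain_sum (<) (b_kernel a t) (length a) p)"
    if "p > 0" for p
    using snoc t' that by auto
  have "chain_sum (<) (b_kernel (a @ [x]) (t @ [y])) (length a) p =
      chain_sum (<) (b_kernel a t) (length a) p" for p
    by (intro chain_sum_cong ext) (simp add: b_kernel_def nth_append flip: len)
  note ch = this
  have ker: "b_kernel (a @ [x]) (t @ [y]) (length a) p m = p ^ x * ((m - p - 1) choose (y - 2))" for p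
    by (simp add: b_kernel_def nth_append len)
  have set: "{p. 0 < p \<and> p < m} = {1..<m}" by auto
  have "fps_nth (b_gf (of_weight (a @ [x]) t')) m =
      (\<Sum>p\<in>{1..<m}. of_nat (p ^ x * ((m - p - 1) choose (y - 2))) * fps_nth (b_gf (of_weight a t)) p)"
    by (simp only: t' of_weight_snoc[OF len] b_gf_segment[OF xy])
  also have "\<dots> = of_nat (\<Sum>p\<in>{1..<m}. p ^ x * ((m - p - 1) choose (y - 2)) * chain_sum (<) (b_kernel a t) (length a) p)"
    by (simp add: IH)
  also have "\<dots> = of_nat (chain_sum (<) (b_kernel (a @ [x]) t') (Suc (length a)) m)"
    by (subst chain_sum_Suc) (simp_all add: t' ch ker set transp_on_less)
  finally show ?case by simp
qed

subsection \<open>Counting functions and set partitions\<close>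

lemma card_lists_nth:
  "card {ps. length ps = M \<and> (\<forall>j<M. ps ! j \<in> Q j)} = (\<Prod>j<M. card (Q j))"
proof -
  have "bij_betw (\<lambda>f. map f [0..<M]) (PiE {..<M} Q) {ps. length ps = M \<and> (\<forall>j<M. ps ! j \<in> Q j)}"
    by (rule bij_betw_byWitness[where f' = "\<lambda>ps. restrict ((!) ps) {..<M}"])
      (auto simp: PiE_def extensional_def intro!: ext nth_equalityI)
  then show ?thesis
    by (simp add: card_PiE flip: bij_betw_same_card)
qed

text \<open>Restriction to the fibres of \<open>f\<close> and gluing are mutually inverse, so
  conditions that each see a single fibre are counted independently. With \<open>f\<close> the map
  \<open>nxt\<close>, the fibres are the gaps of a segmented family.\<close>

lemma card_PiE_fibres:
  assumes Z: "finite Z" and f: "f ` Y \<subseteq> Z"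
  shows "card {h \<in> Y \<rightarrow>\<^sub>E V. \<forall>z\<in>Z. P z (restrict h {y \<in> Y. f y = z})} =
    (\<Prod>z\<in>Z. card {h \<in> {y \<in> Y. f y = z} \<rightarrow>\<^sub>E V. P z h})"
proof -
  let ?I = "\<lambda>z. {y \<in> Y. f y = z}"
  let ?L = "{h \<in> Y \<rightarrow>\<^sub>E V. \<forall>z\<in>Z. P z (restrict h (?I z))}"
  let ?R = "PiE Z (\<lambda>z. {h \<in> ?I z \<rightarrow>\<^sub>E V. P z h})"
  have glue: "restrict (\<lambda>y. H (f y) y) (?I z) = H z" if "H \<in> ?R" "z \<in> Z" for H z
  proof -
    have "H z \<in> ?I z \<rightarrow>\<^sub>E V" using that by auto
    then show ?thesis by (auto simp: PiE_def extensional_def restrict_def)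
  qed
  have "bij_betw (\<lambda>h. \<lambda>z\<in>Z. restrict h (?I z)) ?L ?R"
  proof (rule bij_betw_byWitness[where f' = "\<lambda>H. \<lambda>y\<in>Y. H (f y) y"])
    show "\<forall>h\<in>?L. (\<lambda>y\<in>Y. (\<lambda>z\<in>Z. restrict h (?I z)) (f y) y) = h"
    proof (intro ballI ext)
      fix h y assume "h \<in> ?L"
      then show "(\<lambda>y\<in>Y. (\<lambda>z\<in>Z. restrict h (?I z)) (f y) y) y = h y"
        using f by (cases "y \<in> Y") (auto simp: PiE_def extensional_def)
    qed
    show "\<forall>H\<in>?R. (\<lambda>z\<in>Z. restrict (\<lambda>y\<in>Y. H (f y) y) (?I z)) = H"
    proof
      fix H assume H: "H \<in> ?R"
      show "(\<lambda>z\<in>Z. restrict (\<lambda>y\<in>Y. H (f y) y) (?I z)) = H"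
      proof
        fix z
        have "restrict (\<lambda>y\<in>Y. H (f y) y) (?I z) = restrict (\<lambda>y. H (f y) y) (?I z)"
          by (auto simp: restrict_def)
        then show "(\<lambda>z\<in>Z. restrict (\<lambda>y\<in>Y. H (f y) y) (?I z)) z = H z"
          using glue[OF H, of z] H by (cases "z \<in> Z") (auto simp: PiE_def extensional_def)
      qed
    qed
    show "(\<lambda>h. \<lambda>z\<in>Z. restrict h (?I z)) ` ?L \<subseteq> ?R"
      by (auto simp: PiE_def extensional_def)
    show "(\<lambda>H. \<lambda>y\<in>Y. H (f y) y) ` ?R \<subseteq> ?L"
    proof
      fix h assume "h \<in> (\<lambda>H. \<lambda>y\<in>Y. H (f y) y) ` ?R"
      then obtain H where H: "H \<in> ?R" and h: "h = (\<lambda>y\<in>Y. H (f y) y)" by blast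
      have res: "restrict h (?I z) = H z" if "z \<in> Z" for z
      proof -
        have "restrict h (?I z) = restrict (\<lambda>y. H (f y) y) (?I z)"
          by (auto simp: restrict_def h)
        then show ?thesis using glue[OF H that] by simp
      qed
      have "h y \<in> V" if "y \<in> Y" for y
      proof -
        have "f y \<in> Z" using f that by auto
        then have "H (f y) \<in> ?I (f y) \<rightarrow>\<^sub>E V" using H by auto
        then show ?thesis using that by (auto simp: h)
      qed
      moreover have "h \<in> extensional Y" by (simp add: h)
      ultimately show "h \<in> ?L" using H res by (auto simp: PiE_def)
    qed
  qed
  from bij_betw_same_card[OF this] show ?thesis
    using Z by (simp add: card_PiE)
qed

lemma PiE_nat_sum_le_finite:
  fixes c :: nat
  assumes "finite I"
  shows "finite {h \<in> I \<rightarrow>\<^sub>E UNIV. sum h I \<le> c}"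
proof (rule finite_subset)
  show "{h \<in> I \<rightarrow>\<^sub>E UNIV. sum h I \<le> c} \<subseteq> I \<rightarrow>\<^sub>E {..c}"
    using assms by (auto simp: PiE_def Pi_def intro: order_trans[OF member_le_sum])
qed (use assms in \<open>simp add: finite_PiE\<close>)

text \<open>Stars and bars with a slack variable: splitting by the value at one point leads to the
  hockey-stick identity \<open>choose_rising_sum\<close>.\<close>

lemma card_PiE_nat_sum_le:
  fixes c :: nat
  assumes "finite I"
  shows "card {h \<in> I \<rightarrow>\<^sub>E UNIV. sum h I \<le> c} = (c + card I) choose card I"
  using assms
proof (induction I arbitrary: c rule: finite_induct)
  case empty
  have "{h \<in> {} \<rightarrow>\<^sub>E UNIV. sum h {} \<le> c} = {\<lambda>x. undefined}" by auto
  then show ?case by simp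
next
  case (insert x I)
  let ?H = "\<lambda>I c. {h \<in> I \<rightarrow>\<^sub>E (UNIV :: nat set). sum h I \<le> c}"
  have "bij_betw (\<lambda>(v, h). h(x := v)) (SIGMA v:{..c}. ?H I (c - v)) (?H (insert x I) c)"
  \<comment> \<open>Resetting the value at \<open>x\<close> to \<open>undefined\<close> restores
    extensionality on \<open>I\<close>.\<close>
  proof (rule bij_betw_byWitness[where f' = "\<lambda>h. (h x, h(x := undefined))"])
    have *: "sum (h(x := v)) I = sum h I" for h v
      using insert by (intro sum.cong) auto
    note [simp del] = fun_upd_apply
    note [simp] = fun_upd_same fun_upd_other
    show "\<forall>p\<in>SIGMA v:{..c}. ?H I (c - v). (\<lambda>h. (h x, h(x := undefined))) ((\<lambda>(v, h). h(x := v)) p) = p"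
      using insert(1,2) by (auto simp: PiE_def extensional_def fun_upd_apply)
    show "\<forall>h\<in>?H (insert x I) c. (\<lambda>(v, h). h(x := v)) (h x, h(x := undefined)) = h"
      by auto
    show "(\<lambda>(v, h). h(x := v)) ` (SIGMA v:{..c}. ?H I (c - v)) \<subseteq> ?H (insert x I) c"
      using insert(1,2) by (auto simp: PiE_def extensional_def *)
    show "(\<lambda>h. (h x, h(x := undefined))) ` ?H (insert x I) c \<subseteq> (SIGMA v:{..c}. ?H I (c - v))"
    proof (rule image_subsetI)
      fix h assume h: "h \<in> ?H (insert x I) c"
      then have "h x + sum h I \<le> c" using insert(1,2) by simp
      with h have "h x \<in> {..c}" "h(x := undefined) \<in> ?H I (c - h x)"
        unfolding mem_Collect_eq * by (auto simp: PiE_def extensional_def fun_upd_apply)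
      then show "(h x, h(x := undefined)) \<in> (SIGMA v:{..c}. ?H I (c - v))" by (rule SigmaI)
    qed
  qed
  from bij_betw_same_card[OF this]
  have "card (?H (insert x I) c) = (\<Sum>v\<le>c. card (?H I (c - v)))"
    using insert by (simp add: PiE_nat_sum_le_finite)
  also have "\<dots> = (\<Sum>v\<le>c. (c - v + card I) choose card I)"
    using insert by simp
  also have "\<dots> = (\<Sum>v\<le>c. (card I + v) choose card I)"
    by (rule sum.reindex_bij_witness[of _ "\<lambda>v. c - v" "\<lambda>v. c - v"]) (auto simp: add.commute)
  also have "\<dots> = (card I + c + 1) choose (card I + 1)"
    by (rule choose_rising_sum)
  finally show ?case using insert by (simp add: add.commute)
qed

lemma card_PiE_01_sum_eq:
  assumes "finite I"
  shows "card {h \<in> I \<rightarrow>\<^sub>E {0, 1 :: nat}. sum h I = c} = card I choose c"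
proof -
  have supp: "sum h I = card {i \<in> I. h i = 1}" if "h \<in> I \<rightarrow>\<^sub>E {0, 1 :: nat}" for h
  proof -
    have "sum h I = (\<Sum>i\<in>I. if h i = 1 then 1 else 0)"
      using that by (intro sum.cong) (auto simp: PiE_def Pi_def)
    then show ?thesis using assms by (simp add: sum.If_cases Int_def)
  qed
  have "bij_betw (\<lambda>h. {i \<in> I. h i = 1}) {h \<in> I \<rightarrow>\<^sub>E {0, 1 :: nat}. sum h I = c} {A. A \<subseteq> I \<and> card A = c}"
  proof (rule bij_betw_byWitness[where f' = "\<lambda>A. \<lambda>i\<in>I. if i \<in> A then 1 else 0"])
    have "(\<lambda>i\<in>I. if i \<in> {i \<in> I. h i = 1} then 1 else 0) = h" if "h \<in> I \<rightarrow>\<^sub>E {0, 1 :: nat}" for h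
      using that by (intro ext) (auto simp: PiE_def Pi_def extensional_def)
    then show "\<forall>h\<in>{h \<in> I \<rightarrow>\<^sub>E {0, 1 :: nat}. sum h I = c}.
       (\<lambda>i\<in>I. if i \<in> {i \<in> I. h i = 1} then 1 else 0) = h"
      by blast
    show "\<forall>A\<in>{A. A \<subseteq> I \<and> card A = c}. {i \<in> I. (\<lambda>i\<in>I. if i \<in> A then 1 else 0 :: nat) i = 1} = A"
      by (auto split: if_split_asm)
    show "(\<lambda>h. {i \<in> I. h i = 1}) ` {h \<in> I \<rightarrow>\<^sub>E {0, 1 :: nat}. sum h I = c} \<subseteq> {A. A \<subseteq> I \<and> card A = c}"
      using supp by auto
    have "(\<Sum>i\<in>I. if i \<in> A then 1 else 0) = card A" if "A \<subseteq> I" for A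
      using assms that by (simp add: sum.If_cases Int_absorb1 flip: Int_def)
    then show "(\<lambda>A. \<lambda>i\<in>I. if i \<in> A then 1 else 0) ` {A. A \<subseteq> I \<and> card A = c}
       \<subseteq> {h \<in> I \<rightarrow>\<^sub>E {0, 1 :: nat}. sum h I = c}"
      by (auto split: if_splits)
  qed
  from bij_betw_same_card[OF this] show ?thesis
    using n_subsets[OF assms] by simp
qed

section \<open>Set partitions with prescribed minima as functions\<close>

definition partition_of_map :: "nat set \<Rightarrow> nat set \<Rightarrow> (nat \<Rightarrow> nat) \<Rightarrow> nat set set" where
  "partition_of_map Y X f = (\<lambda>y. insert y {x \<in> X. f x = y}) ` Y"

lemma same_block_partition_of_map:
  assumes "Y \<inter> X = {}" "x \<in> X" "y \<in> Y"
  shows "same_block (partition_of_map Y X f) x y \<longleftrightarrow> f x = y"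
  using assms by (auto simp: same_block_def partition_of_map_def)

lemma partition_of_map_props:
  assumes Y: "finite Y" and X: "finite X" and disj: "Y \<inter> X = {}"
    and f: "f \<in> (\<Pi>\<^sub>E x\<in>X. {y \<in> Y. y < x})"
  shows "partition_on (Y \<union> X) (partition_of_map Y X f)" "fam_min (partition_of_map Y X f) = Y"
proof -
  have fx: "f x \<in> Y" "f x < x" if "x \<in> X" for x
    using f that by auto
  show "partition_on (Y \<union> X) (partition_of_map Y X f)"
    using fx disj by (intro partition_onI) (auto simp: partition_of_map_def disjnt_def)
  have "Min (insert y {x \<in> X. f x = y}) = y" if "y \<in> Y" for y
    using X fx by (intro Min_eqI) (auto intro: less_imp_le)
  then show "fam_min (partition_of_map Y X f) = Y"
    by (auto simp: fam_min_def partition_of_map_def image_image)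
qed

text \<open>The function sends each non-minimum to the minimum of its block, which is smaller and
  lies in \<open>Y\<close>. Blocks are disjoint, so a block is determined by its minimum and can be
  recovered as a fibre.\<close>

lemma partition_obtain_map:
  assumes Y: "finite Y" and X: "finite X" and disj: "Y \<inter> X = {}"
    and part: "partition_on (Y \<union> X) \<pi>" and min: "fam_min \<pi> = Y"
  obtains f where "f \<in> (\<Pi>\<^sub>E x\<in>X. {y \<in> Y. y < x})" "\<pi> = partition_of_map Y X f"
proof -
  have ex: "\<exists>!B. B \<in> \<pi> \<and> x \<in> B" if "x \<in> Y \<union> X" for x
    using part that unfolding partition_on_def disjoint_def by blast
  define blk where "blk x = (THE B. B \<in> \<pi> \<and> x \<in> B)" for x
  have blk: "blk x \<in> \<pi>" "x \<in> blk x" if "x \<in> Y \<union> X" for x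
    using theI'[OF ex[OF that]] by (auto simp: blk_def)
  have blk_eq: "blk x = B" if "B \<in> \<pi>" "x \<in> B" for x B
  proof -
    have "x \<in> Y \<union> X" using part that by (auto simp: partition_on_def)
    from ex[OF this] that show ?thesis unfolding blk_def by (intro the1_equality) auto
  qed
  have B: "B \<subseteq> Y \<union> X" "finite B" "B \<noteq> {}" "Min B \<in> B" "Min B \<in> Y" if "B \<in> \<pi>" for B
  proof -
    show sub: "B \<subseteq> Y \<union> X" and ne: "B \<noteq> {}" using part that by (auto simp: partition_on_def)
    then show "finite B" using X Y finite_subset by blast
    then show "Min B \<in> B" using ne by simp
    show "Min B \<in> Y" using min that by (auto simp: fam_min_def)
  qed
  have Yblk: "Min (blk y) = y" if yY: "y \<in> Y" for y
  proof -
    obtain B where "B \<in> \<pi>" "y = Min B" using yY min by (auto simp: fam_min_def)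
    with B[of B] blk_eq[of B y] show ?thesis by simp
  qed
  define f where "f = (\<lambda>x\<in>X. Min (blk x))"
  show thesis
  proof (rule that)
    show "f \<in> (\<Pi>\<^sub>E x\<in>X. {y \<in> Y. y < x})"
    proof (rule PiE_I)
      fix x assume x: "x \<in> X"
      then have "Min (blk x) \<in> Y" "Min (blk x) \<le> x" using B[of "blk x"] blk[of x] by auto
      moreover have "Min (blk x) \<noteq> x" using calculation x disj by auto
      ultimately show "f x \<in> {y \<in> Y. y < x}" using x by (simp add: f_def)
    qed (simp add: f_def)
    \<comment> \<open>Each block consists of its minimum and the fibre over it: if
      \<open>Min (blk x) = Min C\<close>, the two blocks share an element and coincide.\<close>
    have eq: "insert (Min C) {x \<in> X. f x = Min C} = C" if C: "C \<in> \<pi>" for C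
    proof (intro equalityI subsetI)
      fix x assume x: "x \<in> insert (Min C) {x \<in> X. f x = Min C}"
      show "x \<in> C"
      proof (cases "x = Min C")
        case True then show ?thesis using B[OF C] by simp
      next
        case False
        with x have xX: "x \<in> X" and m: "Min (blk x) = Min C" by (auto simp: f_def)
        have "blk (Min C) = C" using blk_eq[OF C] B(4)[OF C] by simp
        moreover have "blk (Min (blk x)) = blk x" using blk_eq B(4) blk(1) xX by auto
        ultimately show ?thesis using m blk(2)[of x] xX by simp
      qed
    next
      fix x assume x: "x \<in> C"
      then have bx: "blk x = C" using blk_eq C by simp
      show "x \<in> insert (Min C) {x \<in> X. f x = Min C}"
      proof (cases "x \<in> Y")
        case True
        then show ?thesis using Yblk[of x] bx by simp
      next
        case False
        then have "x \<in> X" using B(1)[OF C] x by auto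
        then show ?thesis using bx by (simp add: f_def)
      qed
    qed
    have "partition_of_map Y X f = (\<lambda>C. insert (Min C) {x \<in> X. f x = Min C}) ` \<pi>"
      unfolding partition_of_map_def min[symmetric] fam_min_def by (simp add: image_image)
    also have "\<dots> = (\<lambda>C. C) ` \<pi>" using eq by (intro image_cong) auto
    finally show "\<pi> = partition_of_map Y X f" by simp
  qed
qed

text \<open>The marked elements \<open>C\<close> are forced into the block of \<open>b\<close>. As
  \<open>b\<close> lies below all of \<open>X\<close>, this is always an admissible value; in the
  application \<open>b = 1\<close>.\<close>

lemma bij_betw_partition_of_map:
  assumes Y: "finite Y" and X: "finite X" and disj: "Y \<inter> X = {}"
    and b: "b \<in> Y" "\<And>x. x \<in> X \<Longrightarrow> b < x" and C: "C \<subseteq> X"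
  shows "bij_betw (partition_of_map Y X) (\<Pi>\<^sub>E x\<in>X. if x \<in> C then {b} else {y \<in> Y. y < x})
    {\<pi>. partition_on (Y \<union> X) \<pi> \<and> fam_min \<pi> = Y \<and> (\<forall>x\<in>C. same_block \<pi> x b)}"
    (is "bij_betw _ ?F ?P")
proof (rule bij_betw_imageI)
  have F: "?F = {f \<in> (\<Pi>\<^sub>E x\<in>X. {y \<in> Y. y < x}). \<forall>x\<in>C. f x = b}"
    using b C by (auto simp: PiE_def Pi_def split: if_splits)
  show "inj_on (partition_of_map Y X) ?F"
  proof (rule inj_onI)
    fix f g assume fg: "f \<in> ?F" "g \<in> ?F" and eq: "partition_of_map Y X f = partition_of_map Y X g"
    show "f = g"
    proof (rule PiE_ext)
      show "f \<in> (\<Pi>\<^sub>E x\<in>X. {y \<in> Y. y < x})" "g \<in> (\<Pi>\<^sub>E x\<in>X. {y \<in> Y. y < x})" using fg F by auto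
      then have "f x \<in> Y" if "x \<in> X" for x using that by auto
      then show "f x = g x" if "x \<in> X" for x
        using same_block_partition_of_map[OF disj that, of "f x"] eq that by metis
    qed
  qed
  show "partition_of_map Y X ` ?F = ?P"
  proof (intro equalityI subsetI)
    fix \<pi> assume "\<pi> \<in> partition_of_map Y X ` ?F"
    then obtain f where f: "f \<in> (\<Pi>\<^sub>E x\<in>X. {y \<in> Y. y < x})" "\<forall>x\<in>C. f x = b" "\<pi> = partition_of_map Y X f"
      unfolding F by auto
    then show "\<pi> \<in> ?P"
      using partition_of_map_props[OF Y X disj f(1)] same_block_partition_of_map[OF disj] b C by auto
  next
    fix \<pi> assume \<pi>: "\<pi> \<in> ?P"
    then obtain f where f: "f \<in> (\<Pi>\<^sub>E x\<in>X. {y \<in> Y. y < x})" "\<pi> = partition_of_map Y X f"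
      using partition_obtain_map[OF Y X disj] by auto
    have "f x = b" if "x \<in> C" for x
      using \<pi> that same_block_partition_of_map[OF disj, of x b f] b C f by auto
    with f show "\<pi> \<in> partition_of_map Y X ` ?F" unfolding F by auto
  qed
qed

lemma card_partitions_fam_min:
  assumes "finite Y" "finite X" "Y \<inter> X = {}"
    and "b \<in> Y" "\<And>x. x \<in> X \<Longrightarrow> b < x" "C \<subseteq> X"
  shows "card {\<pi>. partition_on (Y \<union> X) \<pi> \<and> fam_min \<pi> = Y \<and> (\<forall>x\<in>C. same_block \<pi> x b)} =
    (\<Prod>x\<in>X. if x \<in> C then 1 else card {y \<in> Y. y < x})"
proof -
  have "card {\<pi>. partition_on (Y \<union> X) \<pi> \<and> fam_min \<pi> = Y \<and> (\<forall>x\<in>C. same_block \<pi> x b)} =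
    (\<Prod>x\<in>X. card (if x \<in> C then {b} else {y \<in> Y. y < x}))"
    using bij_betw_same_card[OF bij_betw_partition_of_map[OF assms]] assms(2) by (simp add: card_PiE)
  also have "\<dots> = (\<Prod>x\<in>X. if x \<in> C then 1 else card {y \<in> Y. y < x})"
    by (intro prod.cong) auto
  finally show ?thesis .
qed

subsection \<open>Segmented families\<close>

text \<open>
  Here \<open>X\<close> plays the role of the non-minima \<open>{x_1 < \<dots> < x_l}\<close>, and \<open>Y\<close> that of the minima.
  In a segmented family with minima \<open>Y\<close>, the only element which can join the block of
  \<open>y\<close> is \<open>nxt y\<close>, the first element of \<open>X \<union> {n+1}\<close> above \<open>y\<close>. So a family amounts to a
  multiplicity \<open>h y\<close> for each \<open>y\<close>, constrained separately on each gap.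
\<close>

locale split_ground =
  fixes n :: nat and X :: "nat set"
  assumes X_sub: "X \<subseteq> {2..n}" and X_ne: "X \<noteq> {}"
begin

definition Y :: "nat set" where "Y = {1..n} - X"
definition Z :: "nat set" where "Z = insert (n + 1) X"
definition nxt :: "nat \<Rightarrow> nat" where "nxt y = Min {z \<in> Z. y < z}"
definition gap :: "nat \<Rightarrow> nat set" where "gap z = {y \<in> Y. nxt y = z}"
definition family :: "(nat \<Rightarrow> nat) \<Rightarrow> nat multiset set" where
  "family h = (\<lambda>y. add_mset y (replicate_mset (h y) (nxt y))) ` Y"
definition segmented_family :: "nat multiset set \<Rightarrow> bool" where
  "segmented_family F \<longleftrightarrow> finite F \<and> (\<forall>B\<in>F. B \<noteq> {#}) \<and>
     segmented {1..n + 1} (set_mset ` F) \<and> fam_min (set_mset ` F) = Y"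

lemma finite_sets [simp]: "finite X" "finite Y" "finite Z" "finite (gap z)"
  using X_sub finite_subset by (auto simp: Y_def Z_def gap_def)

lemma YZ_disjoint: "Y \<inter> Z = {}"
  by (auto simp: Y_def Z_def)

lemma YZ_union: "{1..n + 1} = Y \<union> Z"
  using X_sub by (auto simp: Y_def Z_def)

lemma one_in_Y: "1 \<in> Y"
  using X_sub X_ne by (force simp: Y_def)

lemma nxt:
  assumes "y \<in> Y"
  shows "nxt y \<in> Z" "y < nxt y" "\<And>z. z \<in> Z \<Longrightarrow> y < z \<Longrightarrow> nxt y \<le> z"
proof -
  have "finite {z \<in> Z. y < z}" "{z \<in> Z. y < z} \<noteq> {}"
    using assms by (auto simp: Y_def Z_def)
  from Min_in[OF this] Min_le[OF this(1)] 
  show "nxt y \<in> Z" "y < nxt y" "\<And>z. z \<in> Z \<Longrightarrow> y < z \<Longrightarrow> nxt y \<le> z"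
    by (auto simp: nxt_def)
qed

lemma nxt_eqI:
  assumes "y \<in> Y" "z \<in> Z" "y < z" "\<And>v. y < v \<Longrightarrow> v < z \<Longrightarrow> v \<notin> Z"
  shows "nxt y = z"
  using nxt[OF assms(1)] assms by (meson le_neq_implies_less)

lemma Min_family_block:
  assumes "y \<in> Y"
  shows "Min (set_mset (add_mset y (replicate_mset (h y) (nxt y)))) = y"
  using nxt[OF assms] by (intro Min_eqI) (auto split: if_splits)

lemma inj_family_blocks: "inj_on (\<lambda>y. add_mset y (replicate_mset (h y) (nxt y))) Y"
  using Min_family_block by (metis (no_types, lifting) inj_onI)

lemma count_sum_family:
  "count (\<Sum>B\<in>family h. B) v = (if v \<in> Y then 1 else 0) + sum h (gap v)"
proof -
  have "count (\<Sum>B\<in>family h. B) v = (\<Sum>y\<in>Y. count (add_mset y (replicate_mset (h y) (nxt y))) v)"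
    unfolding family_def by (simp add: sum.reindex[OF inj_family_blocks] count_sum)
  also have "\<dots> = (\<Sum>y\<in>Y. (if y = v then 1 else 0) + (if nxt y = v then h y else 0))"
    by (intro sum.cong) auto
  also have "\<dots> = (if v \<in> Y then 1 else 0) + sum h (gap v)"
    by (simp add: sum.distrib gap_def sum.If_cases Int_def)
  finally show ?thesis .
qed

lemma segmented_family_family: "segmented_family (family h)"
proof -
  have fm: "fam_min (set_mset ` family h) = Y"
    using Min_family_block by (auto simp: fam_min_def family_def image_image)
  have "y \<in> Y" if xyz: "x \<in> {1..n + 1}" "y \<in> {1..n + 1}" "z \<in> {1..n + 1}" "x < y" "y < z"
    "same_block (set_mset ` family h) x z" for x y z
  proof -
    obtain v where v: "v \<in> Y" "x \<in># add_mset v (replicate_mset (h v) (nxt v))"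
      "z \<in># add_mset v (replicate_mset (h v) (nxt v))"
      using xyz(6) by (auto simp: same_block_def family_def)
    then have "x = v \<or> x = nxt v" "z = v \<or> z = nxt v"
      by (auto split: if_splits)
    with nxt[OF v(1)] xyz have "x = v" "z = nxt v" by auto
    with nxt(3)[OF v(1), of y] xyz have "y \<notin> Z" by auto
    with xyz YZ_union show "y \<in> Y" by auto
  qed
  then have "segmented {1..n + 1} (set_mset ` family h)"
    unfolding segmented_def fm by blast
  moreover have "\<forall>B\<in>family h. B \<noteq> {#}" "finite (family h)"
    by (auto simp: family_def)
  ultimately show ?thesis using fm by (simp add: segmented_family_def)
qed

text \<open>The bound gives every element of \<open>Y\<close> total multiplicity at most one,
  because \<open>E\<close> lives on \<open>Z\<close>. So no minimum occurs in the block of another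
  one, and any further element of the block of \<open>y\<close> lies in \<open>Z\<close>.
  Segmentation forbids elements of \<open>Z\<close> strictly in between, which leaves only
  \<open>nxt y\<close>; the block is then determined by its multiplicity.\<close>

lemma segmented_family_obtain:
  assumes F: "segmented_family F" and sub: "(\<Sum>B\<in>F. B) \<subseteq># mset_set Y + E" and E: "set_mset E \<subseteq> Z"
  obtains h where "h \<in> Y \<rightarrow>\<^sub>E UNIV" "F = family h"
proof -
  have fin: "finite F" and ne: "\<And>B. B \<in> F \<Longrightarrow> B \<noteq> {#}"
    and seg: "segmented {1..n + 1} (set_mset ` F)" and fm: "(\<lambda>B. Min (set_mset B)) ` F = Y"
    using F by (auto simp: segmented_family_def fam_min_def image_image)
  have le: "(\<Sum>B\<in>F. count B v) \<le> count (mset_set Y + E) v" for v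
    using mset_subset_eq_count[OF sub, of v] by (simp add: count_sum)
  have Yle: "(\<Sum>B\<in>F. count B y) \<le> 1" if "y \<in> Y" for y
  proof -
    have "y \<notin># E" using that E YZ_disjoint by auto
    then have "count E y = 0" by (simp add: count_eq_zero_iff)
    then show ?thesis using le[of y] that by simp
  qed
  have Min_in_block: "Min (set_mset B) \<in># B" if "B \<in> F" for B
    using ne[OF that] by (metis Min_in finite_set_mset set_mset_eq_empty_iff)
  have uniq: "B = B'" if B: "B \<in> F" "B' \<in> F" "y \<in># B" "y \<in># B'" "y \<in> Y" for B B' y
  proof (rule ccontr)
    assume "B \<noteq> B'"
    then have "(\<Sum>C\<in>{B, B'}. count C y) \<ge> 2"
      using B(3,4) by (simp add: Suc_le_eq numeral_2_eq_2 add_strict_mono flip: count_greater_zero_iff)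
    moreover have "(\<Sum>C\<in>{B, B'}. count C y) \<le> (\<Sum>C\<in>F. count C y)"
      using fin B by (intro sum_mono2) auto
    ultimately show False using Yle[OF B(5)] by simp
  qed
  have one: "count B y = 1" if B: "B \<in> F" "y \<in># B" "y \<in> Y" for B y
  proof -
    have "count B y \<le> (\<Sum>C\<in>F. count C y)"
      using fin B by (intro member_le_sum) auto
    moreover have "count B y > 0" using B(2) by simp
    ultimately show ?thesis using Yle[OF B(3)] by linarith
  qed
  have blk: "B = add_mset (Min (set_mset B)) (replicate_mset (count B (nxt (Min (set_mset B)))) (nxt (Min (set_mset B))))"
    if B: "B \<in> F" for B
  proof -
    let ?y = "Min (set_mset B)"
    have y: "?y \<in> Y" "?y \<in># B" using B fm Min_in_block by auto
    have other: "x = nxt ?y" if x: "x \<in># B" "x \<noteq> ?y" for x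
    proof -
      have "x \<in># (\<Sum>B\<in>F. B)" using B x fin by (auto simp: set_mset_sum)
      then have "x \<in># mset_set Y + E" by (rule mset_subset_eqD[OF sub])
      then have xYZ: "x \<in> Y \<union> Z" using E by auto
      have "?y \<le> x" using x(1) by (intro Min_le) simp_all
      then have gt: "?y < x" using x(2) by linarith
      \<comment> \<open>Otherwise some block has \<open>x\<close> as its minimum; by
        \<open>uniq\<close> it would be \<open>B\<close>, whose minimum is smaller than
        \<open>x\<close>.\<close>
      have "x \<notin> Y"
      proof
        assume xY: "x \<in> Y"
        then have "x \<in> (\<lambda>B. Min (set_mset B)) ` F" using fm by simp
        then obtain B' where B': "B' \<in> F" "Min (set_mset B') = x" by blast
        then have "x \<in># B'" using Min_in_block by auto
        with uniq[OF B B'(1) x(1) _ xY] B' x show False by simp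
      qed
      then have xZ: "x \<in> Z" using xYZ by simp
      have "v \<notin> Z" if v: "?y < v" "v < x" for v
      proof -
        have "same_block (set_mset ` F) ?y x"
          using B x y by (auto simp: same_block_def)
        moreover have "?y \<in> {1..n + 1}" "x \<in> {1..n + 1}" using y xZ YZ_union by auto
        moreover from this have "v \<in> {1..n + 1}" using v by auto
        ultimately have "v \<in> fam_min (set_mset ` F)"
          using seg v unfolding segmented_def by blast
        then have "v \<in> Y" using fm by (simp add: fam_min_def image_image)
        then show ?thesis using YZ_disjoint by auto
      qed
      then show ?thesis using nxt_eqI[OF y(1) xZ gt] by simp
    qed
    have "B = add_mset w (replicate_mset (count B (nxt w)) (nxt w))"
      if "count B w = 1" "w < nxt w" "\<And>x. x \<in># B \<Longrightarrow> x \<noteq> w \<Longrightarrow> x = nxt w" for w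
    proof (rule multiset_eqI)
      fix x
      consider "x = w" | "x = nxt w" "x \<noteq> w" | "x \<noteq> w" "x \<noteq> nxt w" by blast
      then show "count B x = count (add_mset w (replicate_mset (count B (nxt w)) (nxt w))) x"
      proof cases
        case 3
        then have "x \<notin># B" using that(3) by blast
        then have "count B x = 0" by (simp add: count_eq_zero_iff)
        with 3 show ?thesis by simp
      qed (use that in auto)
    qed
    then show ?thesis using one[OF B y(2,1)] nxt(2)[OF y(1)] other by blast
  qed
  \<comment> \<open>By \<open>uniq\<close> a block of \<open>F\<close> is determined by its minimum,
    so the description is unique.\<close>
  define block where "block y = (THE B. B \<in> F \<and> Min (set_mset B) = y)" for y
  have block: "block (Min (set_mset B)) = B" if B: "B \<in> F" for B
    unfolding block_def
  proof (rule the_equality)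
    fix C assume C: "C \<in> F \<and> Min (set_mset C) = Min (set_mset B)"
    then show "C = B"
      using uniq[of C B "Min (set_mset B)"] B Min_in_block[of C] Min_in_block[OF B] fm by auto
  qed (use B in simp)
  define h where "h = (\<lambda>y\<in>Y. count (block y) (nxt y))"
  have "family h = (\<lambda>B. add_mset (Min (set_mset B)) (replicate_mset (h (Min (set_mset B))) (nxt (Min (set_mset B))))) ` F"
    unfolding family_def by (subst fm[symmetric]) (simp add: image_image)
  also have "\<dots> = (\<lambda>B. B) ` F"
  proof (rule image_cong[OF refl])
    fix B assume B: "B \<in> F"
    then have "Min (set_mset B) \<in> Y" using fm by auto
    with block[OF B] blk[OF B]
    show "add_mset (Min (set_mset B)) (replicate_mset (h (Min (set_mset B))) (nxt (Min (set_mset B)))) = B"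
      by (simp add: h_def)
  qed
  finally have "F = family h" by simp
  moreover have "h \<in> Y \<rightarrow>\<^sub>E UNIV" by (simp add: h_def)
  ultimately show thesis by (rule that[rotated])
qed

lemma inj_family: "inj_on family (Y \<rightarrow>\<^sub>E UNIV)"
proof (rule inj_onI)
  fix h g assume hg: "h \<in> Y \<rightarrow>\<^sub>E UNIV" "g \<in> Y \<rightarrow>\<^sub>E UNIV" and eq: "family h = family g"
  show "h = g"
  proof (rule PiE_ext[OF hg])
    fix y assume y: "y \<in> Y"
    then have "add_mset y (replicate_mset (h y) (nxt y)) \<in> family g"
      unfolding eq[symmetric] by (auto simp: family_def)
    then obtain v where v: "v \<in> Y" "add_mset y (replicate_mset (h y) (nxt y)) = add_mset v (replicate_mset (g v) (nxt v))"
      by (auto simp: family_def)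
    then have "y = v" using Min_family_block y by metis
    with v have "replicate_mset (h y) (nxt y) = replicate_mset (g y) (nxt y)" by simp
    then show "h y = g y" by (metis size_replicate_mset)
  qed
qed

lemma same_block_family:
  assumes "x1 = nxt 1"
  shows "same_block (set_mset ` family h) x1 1 \<longleftrightarrow> h 1 \<ge> 1"
proof
  assume "same_block (set_mset ` family h) x1 1"
  then obtain v where v: "v \<in> Y" "x1 \<in># add_mset v (replicate_mset (h v) (nxt v))"
      "1 \<in># add_mset v (replicate_mset (h v) (nxt v))"
    by (auto simp: same_block_def family_def)
  have "1 \<notin> Z" using one_in_Y YZ_disjoint by auto
  with v(3) nxt(1)[OF v(1)] have v1: "v = 1" by (auto split: if_splits)
  with v(2) assms nxt(2)[OF one_in_Y] show "h 1 \<ge> 1" by (auto split: if_splits)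
next
  assume "h 1 \<ge> 1"
  then show "same_block (set_mset ` family h) x1 1"
    unfolding same_block_def family_def image_image using one_in_Y assms
    by (intro bexI[of _ "set_mset (add_mset 1 (replicate_mset (h 1) (nxt 1)))"]) auto
qed

text \<open>Elements of \<open>Y\<close> have multiplicity one on both sides and elements outside
  \<open>Y \<union> Z\<close> have multiplicity zero, so only \<open>Z\<close> is left to
  compare.\<close>

lemma sum_family_subseteq:
  assumes E: "set_mset E \<subseteq> Z"
  shows "(\<Sum>B\<in>family h. B) \<subseteq># mset_set Y + E \<longleftrightarrow> (\<forall>z\<in>Z. sum h (gap z) \<le> count E z)"
    and "(\<Sum>B\<in>family h. B) = mset_set Y + E \<longleftrightarrow> (\<forall>z\<in>Z. sum h (gap z) = count E z)"
proof -
  have c: "count (mset_set Y + E) v = (if v \<in> Y then 1 else 0) + count E v" for v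
    by (simp add: count_mset_set')
  have 0: "sum h (gap v) = 0 \<and> count E v = 0" if "v \<notin> Z" for v
  proof -
    have "gap v = {}" using nxt that by (auto simp: gap_def)
    moreover have "v \<notin># E" using E that by auto
    ultimately show ?thesis by (simp add: count_eq_zero_iff)
  qed
  have "(\<Sum>B\<in>family h. B) \<subseteq># mset_set Y + E \<longleftrightarrow> (\<forall>v. sum h (gap v) \<le> count E v)"
    unfolding subseteq_mset_def count_sum_family c by auto
  then show "(\<Sum>B\<in>family h. B) \<subseteq># mset_set Y + E \<longleftrightarrow> (\<forall>z\<in>Z. sum h (gap z) \<le> count E z)"
    using 0 by (metis le_refl)
  have "(\<Sum>B\<in>family h. B) = mset_set Y + E \<longleftrightarrow> (\<forall>v. sum h (gap v) = count E v)"
    unfolding multiset_eq_iff count_sum_family c by auto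
  then show "(\<Sum>B\<in>family h. B) = mset_set Y + E \<longleftrightarrow> (\<forall>z\<in>Z. sum h (gap z) = count E z)"
    using 0 by metis
qed

section \<open>Counting segmented families gap by gap\<close>

definition mset_families :: "nat multiset \<Rightarrow> nat multiset set set" where
  "mset_families E = {F. segmented_family F \<and> same_block (set_mset ` F) (nxt 1) 1 \<and>
     (\<Sum>B\<in>F. B) \<subseteq># mset_set Y + E}"

definition set_families :: "nat multiset \<Rightarrow> nat set set set" where
  "set_families E = {F. finite F \<and> (\<forall>B\<in>F. finite B \<and> B \<noteq> {}) \<and> segmented {1..n + 1} F \<and>
     fam_min F = Y \<and> same_block F (nxt 1) 1 \<and> (\<Sum>B\<in>F. mset_set B) = mset_set Y + E}"

lemma bij_mset_families:
  assumes E: "set_mset E \<subseteq> Z"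
  shows "bij_betw family {h \<in> Y \<rightarrow>\<^sub>E UNIV. h 1 \<ge> 1 \<and> (\<forall>z\<in>Z. sum h (gap z) \<le> count E z)}
    (mset_families E)"
proof (rule bij_betw_imageI)
  show "inj_on family {h \<in> Y \<rightarrow>\<^sub>E UNIV. h 1 \<ge> 1 \<and> (\<forall>z\<in>Z. sum h (gap z) \<le> count E z)}"
    by (rule inj_on_subset[OF inj_family]) auto
  show "family ` {h \<in> Y \<rightarrow>\<^sub>E UNIV. h 1 \<ge> 1 \<and> (\<forall>z\<in>Z. sum h (gap z) \<le> count E z)} = mset_families E"
    (is "family ` ?H = _")
  proof (intro equalityI subsetI)
    fix F assume "F \<in> family ` ?H"
    then show "F \<in> mset_families E"
      using segmented_family_family same_block_family sum_family_subseteq(1)[OF E]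
      by (auto simp: mset_families_def)
  next
    fix F assume F: "F \<in> mset_families E"
    then obtain h where "h \<in> Y \<rightarrow>\<^sub>E UNIV" "F = family h"
      using segmented_family_obtain[OF _ _ E] by (auto simp: mset_families_def)
    with F show "F \<in> family ` ?H"
      using same_block_family sum_family_subseteq(1)[OF E]
      by (auto simp: mset_families_def)
  qed
qed

lemma finite_mset_families:
  assumes E: "set_mset E \<subseteq> Z"
  shows "finite (mset_families E)"
proof -
  have "{h \<in> Y \<rightarrow>\<^sub>E UNIV. h 1 \<ge> 1 \<and> (\<forall>z\<in>Z. sum h (gap z) \<le> count E z)} \<subseteq> Y \<rightarrow>\<^sub>E {..size E}"
  proof
    fix h assume h: "h \<in> {h \<in> Y \<rightarrow>\<^sub>E UNIV. h 1 \<ge> 1 \<and> (\<forall>z\<in>Z. sum h (gap z) \<le> count E z)}"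
    have "h y \<le> size E" if y: "y \<in> Y" for y
    proof -
      have "h y \<le> sum h (gap (nxt y))"
        using y by (intro member_le_sum) (auto simp: gap_def)
      also have "\<dots> \<le> count E (nxt y)" using h nxt(1)[OF y] by auto
      also have "\<dots> \<le> size E" by (rule count_le_size)
      finally show ?thesis .
    qed
    with h show "h \<in> Y \<rightarrow>\<^sub>E {..size E}" by (auto simp: PiE_def)
  qed
  then have "finite {h \<in> Y \<rightarrow>\<^sub>E UNIV. h 1 \<ge> 1 \<and> (\<forall>z\<in>Z. sum h (gap z) \<le> count E z)}"
    by (rule finite_subset) (simp add: finite_PiE)
  then show ?thesis using bij_betw_finite[OF bij_mset_families[OF E]] by simp
qed

text \<open>Families of sets are the families of multisets with all multiplicities in
  \<open>{0, 1}\<close>; on these \<open>set_mset\<close> and \<open>mset_set\<close> are inverse to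
  each other and preserve the multiset union.\<close>

lemma bij_set_families:
  assumes E: "set_mset E \<subseteq> Z"
  shows "bij_betw (\<lambda>h. set_mset ` family h)
    {h \<in> Y \<rightarrow>\<^sub>E {0, 1}. h 1 \<ge> 1 \<and> (\<forall>z\<in>Z. sum h (gap z) = count E z)} (set_families E)"
    (is "bij_betw _ ?H _")
proof (rule bij_betw_imageI)
  have simple: "mset_set (set_mset B) = B" if hB: "h \<in> Y \<rightarrow>\<^sub>E {0, 1}" "B \<in> family h" for h B
  proof -
    obtain y where y: "y \<in> Y" "B = add_mset y (replicate_mset (h y) (nxt y))"
      using hB by (auto simp: family_def)
    then have "h y \<in> {0, 1}" using hB by auto
    with y nxt(2)[OF y(1)] show ?thesis by auto
  qed
  then have undo: "mset_set ` set_mset ` family h = family h" if "h \<in> Y \<rightarrow>\<^sub>E {0, 1}" for h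
    using that by (auto simp: image_image image_iff)
  have H: "?H \<subseteq> Y \<rightarrow>\<^sub>E UNIV" by (auto simp: PiE_def)
  show "inj_on (\<lambda>h. set_mset ` family h) ?H"
  proof (rule inj_onI)
    fix h g assume hg: "h \<in> ?H" "g \<in> ?H" and eq: "set_mset ` family h = set_mset ` family g"
    have "h \<in> Y \<rightarrow>\<^sub>E {0, 1}" "g \<in> Y \<rightarrow>\<^sub>E {0, 1}" using hg by blast+
    from undo[OF this(1)] undo[OF this(2)] have "family h = family g"
      unfolding eq by (rule trans[OF sym])
    then show "h = g"
      by (rule inj_onD[OF inj_family _ subsetD[OF H hg(1)] subsetD[OF H hg(2)]])
  qed
  have sum_eq: "(\<Sum>B\<in>set_mset ` family h. mset_set B) = (\<Sum>B\<in>family h. B)" if "h \<in> Y \<rightarrow>\<^sub>E {0, 1}" for h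
  proof -
    have "inj_on set_mset (family h)"
      using simple[OF that] by (metis (no_types, lifting) inj_onI)
    then have "(\<Sum>B\<in>set_mset ` family h. mset_set B) = (\<Sum>B\<in>family h. mset_set (set_mset B))"
      by (simp add: sum.reindex)
    also have "\<dots> = (\<Sum>B\<in>family h. B)" using simple[OF that] by (intro sum.cong) auto
    finally show ?thesis .
  qed
  show "(\<lambda>h. set_mset ` family h) ` ?H = set_families E"
  proof (intro equalityI subsetI)
    fix F assume "F \<in> (\<lambda>h. set_mset ` family h) ` ?H"
    then obtain h where h: "h \<in> ?H" "F = set_mset ` family h" by auto
    show "F \<in> set_families E"
      using h segmented_family_family[of h] same_block_family[of "nxt 1" h]
        sum_family_subseteq(2)[OF E, of h] sum_eq[of h]
      by (auto simp: set_families_def segmented_family_def)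
  next
    fix F assume F: "F \<in> set_families E"
    then have fin: "finite F" and finB: "\<And>B. B \<in> F \<Longrightarrow> finite B \<and> B \<noteq> {}"
      and Fsum: "(\<Sum>B\<in>F. mset_set B) = mset_set Y + E"
      by (auto simp: set_families_def)
    let ?G = "mset_set ` F"
    have set_G: "set_mset ` ?G = F"
      using finB by (auto simp: image_image image_iff)
    have "inj_on mset_set F"
      using finB by (metis (no_types, lifting) finite_set_mset_mset_set inj_onI)
    then have Gsum: "(\<Sum>B\<in>?G. B) = mset_set Y + E"
      using Fsum by (simp add: sum.reindex)
    have "segmented_family ?G"
      using F finB unfolding segmented_family_def set_G set_families_def
      by (auto simp: mset_set_empty_iff)
    then obtain h where h: "h \<in> Y \<rightarrow>\<^sub>E UNIV" "?G = family h"
      by (rule segmented_family_obtain[OF _ _ E]) (simp add: Gsum)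
    have "h y \<in> {0, 1}" if y: "y \<in> Y" for y
    proof -
      have "add_mset y (replicate_mset (h y) (nxt y)) \<in> ?G"
        using y unfolding h(2) by (auto simp: family_def)
      then obtain B where "mset_set B = add_mset y (replicate_mset (h y) (nxt y))" by auto
      then have "count (add_mset y (replicate_mset (h y) (nxt y))) (nxt y) = count (mset_set B) (nxt y)"
        by simp
      also have "\<dots> \<le> 1" by (simp add: count_mset_set')
      finally have "h y \<le> 1" using nxt(2)[OF y] by simp
      then show ?thesis by auto
    qed
    with h have h01: "h \<in> Y \<rightarrow>\<^sub>E {0, 1}" by (auto simp: PiE_def)
    moreover have "h 1 \<ge> 1"
      using F same_block_family[of "nxt 1" h] set_G h(2) by (auto simp: set_families_def)
    moreover have "\<forall>z\<in>Z. sum h (gap z) = count E z"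
      using Gsum sum_family_subseteq(2)[OF E, of h] h(2) by simp
    ultimately have "h \<in> ?H" by simp
    moreover have "F = set_mset ` family h" using set_G h(2) by simp
    ultimately show "F \<in> (\<lambda>h. set_mset ` family h) ` ?H" by blast
  qed
qed

lemma finite_set_families:
  assumes E: "set_mset E \<subseteq> Z"
  shows "finite (set_families E)"
proof -
  have "finite {h \<in> Y \<rightarrow>\<^sub>E {0, 1 :: nat}. h 1 \<ge> 1 \<and> (\<forall>z\<in>Z. sum h (gap z) = count E z)}"
    by (rule finite_subset[of _ "Y \<rightarrow>\<^sub>E {0, 1}"]) (auto simp: finite_PiE)
  then show ?thesis using bij_betw_finite[OF bij_set_families[OF E]] by simp
qed

lemma one_in_gap: "1 \<in> gap z \<longleftrightarrow> z = nxt 1"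
  using one_in_Y by (auto simp: gap_def)

text \<open>The extra condition \<open>h 1 \<ge> 1\<close> concerns only the gap that contains 1.
  \<open>R\<close> is \<open>\<le>\<close> for partition systems and \<open>=\<close> for
  permutation systems.\<close>

lemma card_gap_functions:
  fixes R :: "nat \<Rightarrow> nat \<Rightarrow> bool"
  shows "card {h \<in> Y \<rightarrow>\<^sub>E V. h 1 \<ge> 1 \<and> (\<forall>z\<in>Z. R (sum h (gap z)) (count E z))} =
    card {h \<in> gap (nxt 1) \<rightarrow>\<^sub>E V. h 1 \<ge> 1 \<and> R (sum h (gap (nxt 1))) (count E (nxt 1))} *
    (\<Prod>z\<in>Z - {nxt 1}. card {h \<in> gap z \<rightarrow>\<^sub>E V. R (sum h (gap z)) (count E z)})"
proof -
  let ?P = "\<lambda>z h. (z = nxt 1 \<longrightarrow> h 1 \<ge> 1) \<and> R (sum h (gap z)) (count E z)"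
  have 1: "{h \<in> Y \<rightarrow>\<^sub>E V. h 1 \<ge> 1 \<and> (\<forall>z\<in>Z. R (sum h (gap z)) (count E z))} =
      {h \<in> Y \<rightarrow>\<^sub>E V. \<forall>z\<in>Z. ?P z (restrict h {y \<in> Y. nxt y = z})}"
    using nxt(1)[OF one_in_Y] one_in_gap unfolding gap_def[symmetric] by auto
  have 2: "card {h \<in> Y \<rightarrow>\<^sub>E V. \<forall>z\<in>Z. ?P z (restrict h {y \<in> Y. nxt y = z})} =
      (\<Prod>z\<in>Z. card {h \<in> gap z \<rightarrow>\<^sub>E V. ?P z h})"
    using card_PiE_fibres[of Z nxt Y V ?P] nxt(1) unfolding gap_def by (simp add: image_subset_iff)
  have 3: "(\<Prod>z\<in>Z. card {h \<in> gap z \<rightarrow>\<^sub>E V. ?P z h}) =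
      card {h \<in> gap (nxt 1) \<rightarrow>\<^sub>E V. ?P (nxt 1) h} *
      (\<Prod>z\<in>Z - {nxt 1}. card {h \<in> gap z \<rightarrow>\<^sub>E V. ?P z h})"
    by (rule prod.remove[OF finite_sets(3) nxt(1)[OF one_in_Y],
          of "\<lambda>z. card {h \<in> gap z \<rightarrow>\<^sub>E V. ?P z h}"])
  have 4: "(\<Prod>z\<in>Z - {nxt 1}. card {h \<in> gap z \<rightarrow>\<^sub>E V. ?P z h}) =
      (\<Prod>z\<in>Z - {nxt 1}. card {h \<in> gap z \<rightarrow>\<^sub>E V. R (sum h (gap z)) (count E z)})"
    by (rule prod.cong) auto
  show ?thesis unfolding 1 2 3 4 by simp
qed

text \<open>The single available copy of \<open>x_1\<close> is used up by the block of 1, so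
  \<open>h\<close> vanishes on the rest of the first gap. This is why no binomial coefficient
  belongs to \<open>x_1\<close>.\<close>

lemma first_gap_unique:
  assumes V: "{0, 1} \<subseteq> V" and R: "R = (\<le>) \<or> R = (=)"
  shows "card {h \<in> gap (nxt 1) \<rightarrow>\<^sub>E V. h 1 \<ge> 1 \<and> R (sum h (gap (nxt 1))) (1::nat)} = 1"
proof -
  let ?G = "gap (nxt 1)"
  let ?e = "\<lambda>y\<in>?G. if y = 1 then 1 else 0 :: nat"
  have 1: "1 \<in> ?G" using one_in_gap by blast
  have "h = ?e" if h: "h \<in> ?G \<rightarrow>\<^sub>E V" "h 1 \<ge> 1" "R (sum h ?G) 1" for h
  proof (rule ext)
    fix y
    have "sum h ?G \<le> 1" using h(3) R by auto
    moreover have "sum h ?G = h 1 + sum h (?G - {1})" using 1 by (intro sum.remove) auto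
    ultimately have "h 1 = 1" "sum h (?G - {1}) = 0" using h(2) by linarith+
    then show "h y = ?e y" using h(1) by (auto simp: PiE_def extensional_def)
  qed
  moreover have "?e \<in> ?G \<rightarrow>\<^sub>E V" "?e 1 \<ge> 1" using V 1 by auto
  moreover have "sum ?e ?G = 1"
  proof -
    have "sum ?e ?G = (\<Sum>y\<in>?G. if y = 1 then 1 else 0)" by (intro sum.cong) auto
    then show ?thesis using 1 by simp
  qed
  moreover from this have "R (sum ?e ?G) 1" using R by (elim disjE) (simp_all only: order_refl)
  ultimately have "{h \<in> ?G \<rightarrow>\<^sub>E V. h 1 \<ge> 1 \<and> R (sum h ?G) 1} = {?e}"
    by blast
  then show ?thesis by simp
qed

lemma card_mset_families:
  assumes E: "set_mset E \<subseteq> Z" "count E (nxt 1) = 1"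
  shows "card (mset_families E) =
    (\<Prod>z\<in>Z - {nxt 1}. (count E z + card (gap z)) choose card (gap z))"
proof -
  have "card (mset_families E) = card {h \<in> Y \<rightarrow>\<^sub>E UNIV. h 1 \<ge> 1 \<and> (\<forall>z\<in>Z. sum h (gap z) \<le> count E z)}"
    using bij_betw_same_card[OF bij_mset_families[OF E(1)]] by simp
  also have "\<dots> = (\<Prod>z\<in>Z - {nxt 1}. card {h \<in> gap z \<rightarrow>\<^sub>E UNIV. sum h (gap z) \<le> count E z})"
    using card_gap_functions[of UNIV "(\<le>)" E] first_gap_unique[of UNIV "(\<le>)"] E(2) by simp
  finally show ?thesis by (simp only: card_PiE_nat_sum_le finite_sets)
qed

lemma card_set_families:
  assumes E: "set_mset E \<subseteq> Z" "count E (nxt 1) = 1"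
  shows "card (set_families E) = (\<Prod>z\<in>Z - {nxt 1}. card (gap z) choose count E z)"
proof -
  have "card (set_families E) = card {h \<in> Y \<rightarrow>\<^sub>E {0, 1}. h 1 \<ge> 1 \<and> (\<forall>z\<in>Z. sum h (gap z) = count E z)}"
    using bij_betw_same_card[OF bij_set_families[OF E(1)]] by simp
  also have "\<dots> = (\<Prod>z\<in>Z - {nxt 1}. card {h \<in> gap z \<rightarrow>\<^sub>E {0, 1}. sum h (gap z) = count E z})"
    using card_gap_functions[of "{0, 1}" "(=)" E] first_gap_unique[of "{0, 1}" "(=)"] E(2) by simp
  finally show ?thesis by (simp only: card_PiE_01_sum_eq finite_sets)
qed

end

subsection \<open>Permutations with given left-to-right minima\<close>

lemma lmin_Nil [simp]: "lmin [] = {}"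
  by (simp add: lmin_def)

lemma lmin_Cons: "lmin (x # w) = insert x {y \<in> lmin w. y < x}"
proof (intro equalityI subsetI)
  fix v assume "v \<in> lmin (x # w)"
  then obtain i where i: "i < length (x # w)" "\<forall>j<i. (x # w) ! i < (x # w) ! j" "v = (x # w) ! i"
    by (auto simp: lmin_def)
  show "v \<in> insert x {y \<in> lmin w. y < x}"
  proof (cases i)
    case (Suc i')
    have "w ! i' < x" using i(2) Suc by auto
    moreover have "\<forall>j<i'. w ! i' < w ! j" using i(2) Suc by auto
    ultimately show ?thesis using i Suc by (auto simp: lmin_def)
  qed (use i in simp)
next
  fix v assume v: "v \<in> insert x {y \<in> lmin w. y < x}"
  show "v \<in> lmin (x # w)"
  proof (cases "v = x")
    case True
    then show ?thesis by (auto simp: lmin_def intro!: exI[of _ 0])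
  next
    case False
    with v obtain i where i: "i < length w" "\<forall>j<i. w ! i < w ! j" "v = w ! i" "v < x"
      by (auto simp: lmin_def)
    then have "(x # w) ! Suc i = v \<and> Suc i < length (x # w) \<and> (\<forall>j<Suc i. (x # w) ! Suc i < (x # w) ! j)"
      by (auto simp: less_Suc_eq_0_disj)
    then show ?thesis unfolding lmin_def by blast
  qed
qed

lemma lmin_append: "lmin (u @ v) = lmin u \<union> {x \<in> lmin v. \<forall>z\<in>set u. x < z}"
  by (induction u) (auto simp: lmin_Cons)

lemma lmin_subset: "lmin w \<subseteq> set w"
  by (auto simp: lmin_def)

lemma Min_in_lmin:
  assumes "x \<in> set w" "\<And>y. y \<in> set w \<Longrightarrow> x \<le> y"
  shows "x \<in> lmin w"
proof -
  obtain u v where w: "w = u @ x # v" "x \<notin> set u" using split_list_first[OF assms(1)] by blast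
  have "\<forall>z\<in>set u. x < z" using assms(2) w by (metis Un_iff le_neq_implies_less set_append)
  then show ?thesis by (simp add: w lmin_append lmin_Cons)
qed

text \<open>The marking condition of permutation systems, stated without \<open>n\<close> so that it
  can be decomposed along concatenations.\<close>

definition tail_min :: "nat \<Rightarrow> nat list \<Rightarrow> bool" where
  "tail_min x w \<longleftrightarrow> (\<forall>p q. p < q \<and> q < length w \<and> w ! p = x \<longrightarrow> x < w ! q)"

lemma tail_min_Nil [simp]: "tail_min x []"
  by (simp add: tail_min_def)

lemma tail_min_Cons: "tail_min x (y # w) \<longleftrightarrow> tail_min x w \<and> (y = x \<longrightarrow> (\<forall>z\<in>set w. x < z))"
proof
  assume L: "tail_min x (y # w)"
  have "x < w ! q" if "p < q" "q < length w" "w ! p = x" for p q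
    using L[unfolded tail_min_def, rule_format, of "Suc p" "Suc q"] that by simp
  moreover have "x < w ! q" if "y = x" "q < length w" for q
    using L[unfolded tail_min_def, rule_format, of 0 "Suc q"] that by simp
  ultimately show "tail_min x w \<and> (y = x \<longrightarrow> (\<forall>z\<in>set w. x < z))"
    by (auto simp: tail_min_def in_set_conv_nth)
next
  assume R: "tail_min x w \<and> (y = x \<longrightarrow> (\<forall>z\<in>set w. x < z))"
  show "tail_min x (y # w)"
    unfolding tail_min_def
  proof (intro allI impI)
    fix p q assume pq: "p < q \<and> q < length (y # w) \<and> (y # w) ! p = x"
    then obtain q' where q: "q = Suc q'" by (cases q) auto
    show "x < (y # w) ! q"
      using R pq by (cases p) (auto simp: q tail_min_def)
  qed
qed

lemma tail_min_append:
  "tail_min x (u @ v) \<longleftrightarrow> tail_min x u \<and> tail_min x v \<and> (x \<in> set u \<longrightarrow> (\<forall>z\<in>set v. x < z))"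
  by (induction u) (auto simp: tail_min_Cons)

text \<open>
  A permutation is built by inserting \<open>1, 2, \<dots>, n\<close> in turn: \<open>x\<close> becomes a left-to-right minimum
  iff it is put in front, and \<open>tail_min x\<close> holds iff it is put at the end.
\<close>

definition lmin_perms :: "nat \<Rightarrow> nat set \<Rightarrow> nat set \<Rightarrow> nat list set" where
  "lmin_perms n Y C = {w \<in> permutations_of_set {1..n}. lmin w = Y \<inter> {1..n} \<and> (\<forall>x\<in>C \<inter> {1..n}. tail_min x w)}"

text \<open>Inserting the largest value disturbs neither the left-to-right minima nor the tail
  condition of the smaller values. Both \<open>Y\<close> and \<open>C\<close> are cut down to
  \<open>{1..n}\<close> in \<open>lmin_perms\<close> so that they can stay fixed while
  \<open>n\<close> grows.\<close>

lemma insert_block_lmin_perms: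
  assumes w: "set w = {1..n}" "distinct w" and p: "p \<le> n"
  shows "insert_block 1 (Suc n) (w, p) \<in> lmin_perms (Suc n) Y C \<longleftrightarrow>
    w \<in> lmin_perms n Y C \<and> (Suc n \<in> Y \<longleftrightarrow> p = 0) \<and> (Suc n \<in> C \<longrightarrow> p = n)"
proof -
  define u v where "u = take p w" and "v = drop p w"
  have uv: "w = u @ v" by (simp add: u_def v_def)
  have lw: "length w = n" using w distinct_card[of w] by simp
  have lens: "u = [] \<longleftrightarrow> p = 0" "v = [] \<longleftrightarrow> p = n" using p lw by (auto simp: u_def v_def)
  have ins: "insert_block 1 (Suc n) (w, p) = u @ Suc n # v"
    by (simp add: insert_block_def u_def v_def)
  have lt: "z < Suc n" if "z \<in> set u \<or> z \<in> set v" for z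
  proof -
    have "z \<in> set w" using that by (auto simp: uv)
    then show ?thesis using w(1) by simp
  qed
  have perms: "u @ Suc n # v \<in> permutations_of_set {1..Suc n}" "w \<in> permutations_of_set {1..n}"
    using w lt by (auto simp: permutations_of_set_def uv atLeastAtMostSuc_conv)
  have lm: "lmin (u @ Suc n # v) = lmin w \<union> (if u = [] then {Suc n} else {})"
  proof (cases "u = []")
    case True
    then show ?thesis using lt lmin_subset[of v] by (auto simp: uv lmin_Cons)
  next
    case False
    then have "\<not> (\<forall>z\<in>set u. Suc n < z)" using lt by (metis last_in_set less_asym)
    then show ?thesis using False lt lmin_subset[of v] by (auto simp: uv lmin_append lmin_Cons)
  qed
  have "lmin w \<subseteq> {1..n}" using lmin_subset[of w] w by simp
  have lm_iff: "lmin (u @ Suc n # v) = Y \<inter> {1..Suc n} \<longleftrightarrow> lmin w = Y \<inter> {1..n} \<and> (Suc n \<in> Y \<longleftrightarrow> p = 0)"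
  proof -
    have "A \<union> (if b then {N} else {}) = Y \<inter> insert N B \<longleftrightarrow> A = Y \<inter> B \<and> (N \<in> Y \<longleftrightarrow> b)"
      if "A \<subseteq> B" "N \<notin> B" for A B N b
    proof
      assume eq: "A \<union> (if b then {N} else {}) = Y \<inter> insert N B"
      have "A = (A \<union> (if b then {N} else {})) \<inter> B" using that by auto
      also have "\<dots> = Y \<inter> B" unfolding eq by blast
      finally have "A = Y \<inter> B" .
      moreover have "N \<in> Y \<longleftrightarrow> N \<in> A \<union> (if b then {N} else {})" unfolding eq by blast
      ultimately show "A = Y \<inter> B \<and> (N \<in> Y \<longleftrightarrow> b)" using that by auto
    qed (use that in auto)
    from this[of "lmin w" "{1..n}" "Suc n" "p = 0"] \<open>lmin w \<subseteq> {1..n}\<close> show ?thesis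
      unfolding lm lens(1) by (simp add: atLeastAtMostSuc_conv)
  qed
  have tm: "tail_min x (u @ Suc n # v) \<longleftrightarrow> tail_min x w" if "x \<in> {1..n}" for x
    using that by (auto simp: uv tail_min_append tail_min_Cons)
  have tmN: "tail_min (Suc n) (u @ Suc n # v) \<longleftrightarrow> p = n"
  proof -
    have "Suc n \<notin> set u" "Suc n \<notin> set v" using lt by blast+
    then have "tail_min (Suc n) u" "tail_min (Suc n) v"
      unfolding tail_min_def by (metis nth_mem order.strict_trans)+
    moreover have "(\<forall>z\<in>set v. Suc n < z) \<longleftrightarrow> v = []"
      using lt by (metis empty_iff empty_set last_in_set less_asym)
    ultimately show ?thesis using \<open>Suc n \<notin> set u\<close> lens by (simp add: tail_min_append tail_min_Cons)
  qed
  have "C \<inter> {1..Suc n} = C \<inter> {1..n} \<union> (if Suc n \<in> C then {Suc n} else {})"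
    by (auto simp: atLeastAtMostSuc_conv)
  then have "(\<forall>x\<in>C \<inter> {1..Suc n}. tail_min x (u @ Suc n # v)) \<longleftrightarrow>
      (\<forall>x\<in>C \<inter> {1..n}. tail_min x w) \<and> (Suc n \<in> C \<longrightarrow> p = n)"
    using tm tmN by (simp add: ball_Un)
  with perms lm_iff show ?thesis
    unfolding ins lmin_perms_def by (simp only: mem_Collect_eq) blast
qed

lemma card_lmin_perms_Suc:
  assumes CY: "C \<inter> Y = {}" and 1: "1 \<in> Y"
  shows "card (lmin_perms (Suc n) Y C) =
    card (lmin_perms n Y C) * (if Suc n \<in> Y \<or> Suc n \<in> C then 1 else n)"
proof -
  define D where "D = {p. p \<le> n \<and> (Suc n \<in> Y \<longleftrightarrow> p = 0) \<and> (Suc n \<in> C \<longrightarrow> p = n)}"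
  have perm: "set w = {1..n}" "distinct w" "length w = n" if "w \<in> lmin_perms n Y C" for w n
    using that distinct_card[of w] by (auto simp: lmin_perms_def permutations_of_set_def)
  have "bij_betw (insert_block 1 (Suc n)) (lmin_perms n Y C \<times> D) (lmin_perms (Suc n) Y C)"
  proof (rule bij_betw_imageI)
    show "inj_on (insert_block 1 (Suc n)) (lmin_perms n Y C \<times> D)"
      using perm by (intro insert_block_inj) (auto simp: D_def)
    show "insert_block 1 (Suc n) ` (lmin_perms n Y C \<times> D) = lmin_perms (Suc n) Y C"
    proof (intro equalityI subsetI)
      fix w assume "w \<in> insert_block 1 (Suc n) ` (lmin_perms n Y C \<times> D)"
      then show "w \<in> lmin_perms (Suc n) Y C"
        using insert_block_lmin_perms[OF perm(1,2)] by (auto simp: D_def)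
    next
      fix w assume w: "w \<in> lmin_perms (Suc n) Y C"
      have sw: "set w = {1..Suc n}" "distinct w" using perm[OF w] by auto
      then have "Suc n \<in> set w" by simp
      then obtain u v where uv: "w = u @ Suc n # v" by (meson split_list)
      have "insert (Suc n) (set u \<union> set v) = insert (Suc n) {1..n}" "Suc n \<notin> set u \<union> set v"
        using sw by (auto simp: uv atLeastAtMostSuc_conv)
      then have "set (u @ v) = {1..n}" by (simp add: insert_ident)
      moreover have "distinct (u @ v)" using sw by (simp add: uv)
      moreover from calculation have "length u \<le> n" using distinct_card[of "u @ v"] by simp
      moreover have ins: "w = insert_block 1 (Suc n) (u @ v, length u)"
        by (simp add: insert_block_def uv)
      ultimately have "u @ v \<in> lmin_perms n Y C" "length u \<in> D"
        using insert_block_lmin_perms[of "u @ v" n "length u"] w by (auto simp: D_def)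
      then show "w \<in> insert_block 1 (Suc n) ` (lmin_perms n Y C \<times> D)"
        unfolding ins by blast
    qed
  qed
  from bij_betw_same_card[OF this] have "card (lmin_perms (Suc n) Y C) = card (lmin_perms n Y C) * card D"
    by (simp add: card_cartesian_product)
  moreover have "card D = (if Suc n \<in> Y \<or> Suc n \<in> C then 1 else n)"
  proof -
    \<comment> \<open>The final place is then not also the front, so a marked non-minimum still has
      its one place.\<close>
    have "n > 0" if "Suc n \<notin> Y" using 1 that by (cases n) auto
    then have "D = (if Suc n \<in> Y then {0} else if Suc n \<in> C then {n} else {1..n})"
      using CY by (auto simp: D_def)
    then show ?thesis by simp
  qed
  ultimately show ?thesis by simp
qed

lemma card_lmin_perms:
  assumes "C \<inter> Y = {}" "1 \<in> Y"
  shows "card (lmin_perms n Y C) = (\<Prod>x\<in>{1..n} - Y. if x \<in> C then 1 else x - 1)"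
proof (induction n)
  case 0
  have "lmin_perms 0 Y C = {[]}" by (auto simp: lmin_perms_def)
  then show ?case by simp
next
  case (Suc n)
  have "{1..Suc n} - Y = (if Suc n \<in> Y then {1..n} - Y else insert (Suc n) ({1..n} - Y))"
    by (auto simp: atLeastAtMostSuc_conv)
  then show ?case
    unfolding card_lmin_perms_Suc[OF assms] Suc.IH by simp
qed

subsection \<open>Systems\<close>

lemma strict_sorted_nth_add_le:
  assumes "sorted_wrt (<) (zs :: nat list)" "i \<le> j" "j < length zs"
  shows "zs ! i + (j - i) \<le> zs ! j"
  using assms(2,3)
proof (induction j rule: dec_induct)
  case (step j)
  have "zs ! j < zs ! Suc j" using step assms(1) by (intro sorted_wrt_nth_less) auto
  with step show ?case by simp
qed simp

text \<open>The range starts at 2 because 1 is always a minimum.\<close>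

definition nonmin_lists :: "nat \<Rightarrow> nat \<Rightarrow> nat list set" where
  "nonmin_lists l n = {xs. length xs = l \<and> set xs \<subseteq> {2..n} \<and> sorted_wrt (<) xs}"

lemma finite_nonmin_lists: "finite (nonmin_lists l n)"
  by (rule finite_subset[OF _ finite_lists_length_eq[of "{2..n}" l]]) (auto simp: nonmin_lists_def)

locale split_list =
  fixes n :: nat and xs :: "nat list"
  assumes xs_sub: "set xs \<subseteq> {2..n}" and xs_sorted: "sorted_wrt (<) xs" and xs_ne: "xs \<noteq> []"
begin

sublocale split_ground n "set xs"
  by unfold_locales (use xs_sub xs_ne in auto)

abbreviation (input) zs :: "nat list" where "zs \<equiv> xs @ [n + 1]"

lemma zs_sorted: "sorted_wrt (<) zs"
  using xs_sorted xs_sub by (auto simp: sorted_wrt_append)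

lemma zs_distinct: "distinct zs"
  using zs_sorted strict_sorted_iff by blast

lemma Z_eq: "Z = set zs"
  by (simp add: Z_def)

lemma zs_less: "i < j \<Longrightarrow> j \<le> length xs \<Longrightarrow> zs ! i < zs ! j"
  using sorted_wrt_nth_less[OF zs_sorted, of i j] by simp

lemma nxt_one: "nxt 1 = xs ! 0"
proof (rule nxt_eqI[OF one_in_Y])
  show "xs ! 0 \<in> Z" using xs_ne by (simp add: Z_def)
  show "1 < xs ! 0" using xs_sub xs_ne nth_mem[of 0 xs] by fastforce
  fix v assume "v < xs ! 0"
  show "v \<notin> Z"
  proof
    assume "v \<in> Z"
    then obtain j where "j \<le> length xs" "v = zs ! j"
      unfolding Z_eq in_set_conv_nth by (auto simp: less_Suc_eq_le)
    with zs_less[of 0 j] \<open>v < xs ! 0\<close> xs_ne show False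
      by (cases "j = 0") (auto simp: nth_append)
  qed
qed

lemma gap_zs:
  assumes j: "j < length xs"
  shows "gap (zs ! Suc j) = {zs ! j<..<zs ! Suc j}"
proof (intro equalityI subsetI)
  fix y assume "y \<in> gap (zs ! Suc j)"
  then have y: "y \<in> Y" "nxt y = zs ! Suc j" by (auto simp: gap_def)
  have jZ: "zs ! j \<in> Z" unfolding Z_eq using j by (intro nth_mem) simp
  have "y \<noteq> zs ! j" using jZ y(1) YZ_disjoint by auto
  moreover have "\<not> y < zs ! j"
    using nxt(3)[OF y(1) jZ] zs_less[of j "Suc j"] j y(2) by auto
  ultimately show "y \<in> {zs ! j<..<zs ! Suc j}" using nxt(2)[OF y(1)] y(2) by auto
next
  fix y assume y: "y \<in> {zs ! j<..<zs ! Suc j}"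
  have no: "v \<notin> Z" if v: "zs ! j < v" "v < zs ! Suc j" for v
  proof
    assume "v \<in> Z"
    then obtain i where i: "i \<le> length xs" "v = zs ! i"
      unfolding Z_eq in_set_conv_nth by (auto simp: less_Suc_eq_le)
    consider "i \<le> j" | "Suc j \<le> i" by linarith
    then show False
    proof cases
      case 1
      with zs_less[of i j] i v j show False by (cases "i = j") auto
    next
      case 2
      with zs_less[of "Suc j" i] i v show False by (cases "i = Suc j") auto
    qed
  qed
  have S: "zs ! Suc j \<in> Z" unfolding Z_eq using j by (intro nth_mem) simp
  then have "zs ! Suc j \<le> n + 1" using xs_sub by (auto simp: Z_def)
  with y have "y \<in> {1..n + 1}" by auto
  with no[of y] y YZ_union have yY: "y \<in> Y" by auto
  have "nxt y = zs ! Suc j"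
    by (rule nxt_eqI[OF yY S]) (use y no in auto)
  with yY show "y \<in> gap (zs ! Suc j)" by (simp add: gap_def)
qed

lemma card_gap_zs: "j < length xs \<Longrightarrow> card (gap (zs ! Suc j)) = zs ! Suc j - xs ! j - 1"
  by (subst gap_zs) (simp_all add: nth_append)

lemma nth_tl_snoc: "j < length xs \<Longrightarrow> (tl xs @ [n + 1]) ! j = zs ! Suc j"
  using xs_ne by (cases xs) auto

lemma prod_Z_minus_first: "(\<Prod>z\<in>Z - {nxt 1}. f z) = (\<Prod>j<length xs. f (zs ! Suc j))"
proof -
  have xs: "set xs = insert (xs ! 0) (set (tl xs))" "xs ! 0 \<notin> set (tl xs)" "xs ! 0 \<noteq> n + 1"
    using zs_distinct xs_ne by (cases xs; auto)+
  have "Z - {nxt 1} = set (tl xs @ [n + 1])"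
    unfolding Z_def nxt_one using xs by auto
  moreover have "bij_betw ((!) (tl xs @ [n + 1])) {..<length xs} (set (tl xs @ [n + 1]))"
    using zs_distinct xs_ne by (intro bij_betw_nth) (cases xs; auto)+
  ultimately have "(\<Prod>z\<in>Z - {nxt 1}. f z) = (\<Prod>j<length xs. f ((tl xs @ [n + 1]) ! j))"
    using prod.reindex_bij_betw[of "(!) (tl xs @ [n + 1])" "{..<length xs}" _ f] by metis
  also have "\<dots> = (\<Prod>j<length xs. f (zs ! Suc j))"
    by (rule prod.cong[OF refl]) (simp only: lessThan_iff nth_tl_snoc)
  finally show ?thesis .
qed

text \<open>Of the \<open>xs ! i - 1\<close> positive numbers below \<open>xs ! i\<close>, the
  \<open>i\<close> earlier list entries are non-minima; with 1-based indices this is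
  \<open>x_i - i\<close>.\<close>

lemma card_mins_less:
  assumes i: "i < length xs"
  shows "card {y \<in> Y. y < xs ! i} = xs ! i - Suc i"
proof -
  have idx: "xs ! j < xs ! i \<longleftrightarrow> j < i" if "j < length xs" for j
    using sorted_wrt_nth_less[OF xs_sorted, of j i] sorted_wrt_nth_less[OF xs_sorted, of i j] that i
    by (metis linorder_neqE_nat order_less_asym)
  have sub: "set (take i xs) \<subseteq> {1..<xs ! i}"
  proof
    fix x assume "x \<in> set (take i xs)"
    then obtain j where "j < i" "x = xs ! j" using i by (auto simp: in_set_conv_nth)
    with idx[of j] i xs_sub nth_mem[of j xs] show "x \<in> {1..<xs ! i}" by fastforce
  qed
  have "{y \<in> Y. y < xs ! i} = {1..<xs ! i} - set (take i xs)"
  proof (intro equalityI subsetI)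
    fix y assume "y \<in> {y \<in> Y. y < xs ! i}"
    then show "y \<in> {1..<xs ! i} - set (take i xs)"
      by (auto simp: Y_def dest: in_set_takeD)
  next
    fix y assume y: "y \<in> {1..<xs ! i} - set (take i xs)"
    have "y \<notin> set xs"
    proof
      assume "y \<in> set xs"
      then obtain j where j: "j < length xs" "y = xs ! j" by (auto simp: in_set_conv_nth)
      with idx[of j] y have "j < i" by auto
      with j y show False by (auto simp: in_set_conv_nth)
    qed
    moreover have "xs ! i \<le> n" using i xs_sub nth_mem[of i xs] by fastforce
    ultimately show "y \<in> {y \<in> Y. y < xs ! i}" using y by (auto simp: Y_def)
  qed
  also have "card \<dots> = card {1..<xs ! i} - card (set (take i xs))"
    using sub by (intro card_Diff_subset) auto
  also have "card (set (take i xs)) = i"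
    using zs_distinct i by (simp add: distinct_card distinct_take)
  finally show ?thesis by simp
qed

lemma extra_mset_facts:
  assumes t: "length t = length xs"
  shows "set_mset (extra_mset t n xs) \<subseteq> Z" "count (extra_mset t n xs) (nxt 1) = 1"
    "\<And>j. j < length xs \<Longrightarrow> count (extra_mset t n xs) (zs ! Suc j) = t ! j - 2"
proof -
  have E: "extra_mset t n xs = {#zs ! 0#} + (\<Sum>i<length xs. replicate_mset (t ! i - 2) (zs ! Suc i))"
  proof -
    have "(\<Sum>i<length t. replicate_mset (t ! i - 2) ((tl xs @ [n + 1]) ! i)) =
        (\<Sum>i<length xs. replicate_mset (t ! i - 2) (zs ! Suc i))"
      by (rule sum.cong) (simp_all only: t lessThan_iff nth_tl_snoc)
    then show ?thesis using xs_ne unfolding extra_mset_def by (simp add: nth_append)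
  qed
  have "zs ! j \<in> Z" if "j \<le> length xs" for j
    unfolding Z_eq using that by (intro nth_mem) simp
  then show "set_mset (extra_mset t n xs) \<subseteq> Z"
    unfolding E by (auto simp: set_mset_sum split: if_splits)
  have inj: "zs ! i = zs ! j \<longleftrightarrow> i = j" if "i \<le> length xs" "j \<le> length xs" for i j
    using nth_eq_iff_index_eq[OF zs_distinct, of i j] that by simp
  have cnt: "count (extra_mset t n xs) (zs ! j) =
      (if j = 0 then 1 else 0) + (\<Sum>i<length xs. if Suc i = j then t ! i - 2 else 0)"
    if "j \<le> length xs" for j
  proof -
    have "count (extra_mset t n xs) (zs ! j) = (if zs ! 0 = zs ! j then 1 else 0) +
        (\<Sum>i<length xs. if zs ! Suc i = zs ! j then t ! i - 2 else 0)"
      unfolding E by (auto simp: count_sum intro!: sum.cong)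
    also have "(\<Sum>i<length xs. if zs ! Suc i = zs ! j then t ! i - 2 else 0) =
        (\<Sum>i<length xs. if Suc i = j then t ! i - 2 else 0)"
      by (rule sum.cong[OF refl]) (simp only: inj[OF _ that] lessThan_iff Suc_le_eq)
    also have "zs ! 0 = zs ! j \<longleftrightarrow> j = 0" using inj[of 0 j] that by auto
    finally show ?thesis .
  qed
  have "zs ! 0 = nxt 1" using xs_ne by (subst nxt_one) (simp add: nth_append)
  with cnt[of 0] show "count (extra_mset t n xs) (nxt 1) = 1" by simp
  show "count (extra_mset t n xs) (zs ! Suc j) = t ! j - 2" if "j < length xs" for j
    using cnt[of "Suc j"] that by simp
qed

lemma card_mset_families_list:
  assumes "length t = length xs"
  shows "card (mset_families (extra_mset t n xs)) =
    (\<Prod>j<length xs. let g = zs ! Suc j - xs ! j - 1 in (t ! j - 2 + g) choose g)"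
  unfolding card_mset_families[OF extra_mset_facts(1,2)[OF assms]] prod_Z_minus_first
  by (rule prod.cong[OF refl]) (simp only: lessThan_iff card_gap_zs extra_mset_facts(3)[OF assms] Let_def)

lemma card_set_families_list:
  assumes "length t = length xs"
  shows "card (set_families (extra_mset t n xs)) =
    (\<Prod>j<length xs. (zs ! Suc j - xs ! j - 1) choose (t ! j - 2))"
  unfolding card_set_families[OF extra_mset_facts(1,2)[OF assms]] prod_Z_minus_first
  by (rule prod.cong[OF refl]) (simp only: lessThan_iff card_gap_zs extra_mset_facts(3)[OF assms] Let_def)

lemma prod_set_xs: "(\<Prod>x\<in>set xs. f x) = (\<Prod>i<length xs. f (xs ! i))"
proof -
  have "bij_betw ((!) xs) {..<length xs} (set xs)"
    using zs_distinct by (intro bij_betw_nth) auto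
  then show ?thesis by (rule prod.reindex_bij_betw[symmetric])
qed

lemma nth_mem_marked:
  assumes "i < length xs"
  shows "xs ! i \<in> {xs ! i |i. i < length xs \<and> a ! i \<le> j} \<longleftrightarrow> a ! i \<le> (j :: nat)"
  using assms zs_distinct by (auto simp: nth_eq_iff_index_eq)

text \<open>The list index \<open>j\<close> stands for the component \<open>j + 1\<close>, so
  \<open>a ! i \<le> j\<close> expresses \<open>a_i < j + 1\<close>.\<close>

lemma card_marked_partitions:
  fixes a :: "nat list"
  shows "card {\<pi>. partition_on {1..n} \<pi> \<and> fam_min \<pi> = {1..n} - set xs \<and>
       (\<forall>i<length xs. a ! i \<le> j \<longrightarrow> same_block \<pi> (xs ! i) 1)} =
    (\<Prod>i<length xs. if a ! i \<le> j then 1 else xs ! i - Suc i)"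
proof -
  let ?C = "{xs ! i |i. i < length xs \<and> a ! i \<le> j}"
  have "Y \<union> set xs = {1..n}" using xs_sub by (auto simp: Y_def)
  moreover have "Y \<inter> set xs = {}" by (auto simp: Y_def)
  moreover have "?C \<subseteq> set xs" by auto
  moreover have "1 < x" if "x \<in> set xs" for x using that xs_sub by auto
  ultimately have "card {\<pi>. partition_on {1..n} \<pi> \<and> fam_min \<pi> = Y \<and> (\<forall>x\<in>?C. same_block \<pi> x 1)} =
      (\<Prod>x\<in>set xs. if x \<in> ?C then 1 else card {y \<in> Y. y < x})"
    using card_partitions_fam_min[of Y "set xs" 1 ?C] one_in_Y by (simp del: One_nat_def)
  also have "\<dots> = (\<Prod>i<length xs. if a ! i \<le> j then 1 else xs ! i - Suc i)"
    unfolding prod_set_xs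
  proof (rule prod.cong[OF refl])
    fix i assume "i \<in> {..<length xs}"
    then have i: "i < length xs" by simp
    show "(if xs ! i \<in> ?C then 1 else card {y \<in> Y. y < xs ! i}) = (if a ! i \<le> j then 1 else xs ! i - Suc i)"
      unfolding card_mins_less[OF i] by (rule if_cong[OF nth_mem_marked[OF i] refl refl])
  qed
  also have "{\<pi>. partition_on {1..n} \<pi> \<and> fam_min \<pi> = Y \<and> (\<forall>x\<in>?C. same_block \<pi> x 1)} =
     {\<pi>. partition_on {1..n} \<pi> \<and> fam_min \<pi> = {1..n} - set xs \<and>
       (\<forall>i<length xs. a ! i \<le> j \<longrightarrow> same_block \<pi> (xs ! i) 1)}"
    by (auto simp: Y_def)
  finally show ?thesis .
qed

lemma card_marked_perms:
  fixes a :: "nat list"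
  shows "card (lmin_perms n ({1..n} - set xs) {xs ! i |i. i < length xs \<and> a ! i \<le> j}) =
    (\<Prod>i<length xs. if a ! i \<le> j then 1 else xs ! i - 1)"
proof -
  let ?C = "{xs ! i |i. i < length xs \<and> a ! i \<le> j}"
  have "?C \<inter> Y = {}" by (auto simp: Y_def)
  then have "card (lmin_perms n Y ?C) = (\<Prod>x\<in>{1..n} - Y. if x \<in> ?C then 1 else x - 1)"
    using card_lmin_perms[OF _ one_in_Y] by blast
  also have "{1..n} - Y = set xs" using xs_sub by (auto simp: Y_def)
  also have "(\<Prod>x\<in>set xs. if x \<in> ?C then 1 else x - 1) = (\<Prod>i<length xs. if a ! i \<le> j then 1 else xs ! i - 1)"
    unfolding prod_set_xs
  proof (rule prod.cong[OF refl])
    fix i assume "i \<in> {..<length xs}"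
    then have i: "i < length xs" by simp
    show "(if xs ! i \<in> ?C then 1 else xs ! i - 1) = (if a ! i \<le> j then 1 else xs ! i - 1)"
      by (rule if_cong[OF nth_mem_marked[OF i] refl refl])
  qed
  finally show ?thesis by (simp add: Y_def)
qed

end

section \<open>Systems grouped by their non-minima\<close>

lemma split_list_nonmin_lists:
  "xs \<in> nonmin_lists l n \<Longrightarrow> l \<ge> 1 \<Longrightarrow> split_list n xs"
  by unfold_locales (auto simp: nonmin_lists_def)

lemma sorted_list_nonmin_lists:
  assumes "xs \<in> nonmin_lists l n"
  shows "sorted_list_of_set ({1..n} - ({1..n} - set xs)) = xs" "card ({1..n} - set xs) = n - l"
    "l \<le> n"
proof -
  have xs: "set xs \<subseteq> {1..n}" "sorted_wrt (<) xs" "length xs = l"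
    using assms by (auto simp: nonmin_lists_def)
  then have "{1..n} - ({1..n} - set xs) = set xs" by auto
  then show "sorted_list_of_set ({1..n} - ({1..n} - set xs)) = xs"
    using xs(2) by (simp add: sorted_list_of_set.idem_if_sorted_distinct strict_sorted_iff)
  have "card (set xs) = l" using xs by (simp add: distinct_card strict_sorted_iff)
  then show "card ({1..n} - set xs) = n - l" "l \<le> n"
    using xs(1) card_mono[OF _ xs(1)] by (simp_all add: card_Diff_subset)
qed

lemma sorted_list_in_nonmin_lists:
  assumes Y: "Y \<subseteq> {1..n}" "1 \<in> Y" "int (card Y) = int n - int l"
  shows "sorted_list_of_set ({1..n} - Y) \<in> nonmin_lists l n"
    "{1..n} - set (sorted_list_of_set ({1..n} - Y)) = Y"
proof -
  have "card ({1..n} - Y) = n - card Y"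
    using Y(1) by (simp add: card_Diff_subset finite_subset)
  then have "card ({1..n} - Y) = l" using Y(3) by linarith
  moreover have "x \<noteq> 1" if "x \<in> {1..n} - Y" for x using that Y(2) by auto
  ultimately show "sorted_list_of_set ({1..n} - Y) \<in> nonmin_lists l n"
    by (force simp: nonmin_lists_def)
  show "{1..n} - set (sorted_list_of_set ({1..n} - Y)) = Y" using Y(1) by auto
qed

text \<open>Disjointness is asked of the second components only: the list of partitions or
  permutations reveals the minima.\<close>

lemma card_fibred_product:
  assumes "finite I" "\<And>i. i \<in> I \<Longrightarrow> finite (A i)" "\<And>i. i \<in> I \<Longrightarrow> finite (B i)"
    and "\<And>i j x. i \<in> I \<Longrightarrow> j \<in> I \<Longrightarrow> x \<in> B i \<Longrightarrow> x \<in> B j \<Longrightarrow> i = j"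
  shows "card (\<Union>i\<in>I. A i \<times> B i) = (\<Sum>i\<in>I. card (A i) * card (B i))"
proof -
  have "card (\<Union>i\<in>I. A i \<times> B i) = (\<Sum>i\<in>I. card (A i \<times> B i))"
    using assms by (intro card_UN_disjoint) blast+
  then show ?thesis by (simp add: card_cartesian_product)
qed

lemma finite_lists_nth:
  assumes "finite A" "\<And>j. Q j \<subseteq> A"
  shows "finite {ps. length ps = M \<and> (\<forall>j<M. ps ! j \<in> Q j)}"
  by (rule finite_subset[OF _ finite_lists_length_eq[OF assms(1), of M]])
    (use assms(2) in \<open>fastforce simp: in_set_conv_nth\<close>)

text \<open>After exchanging the products, the element \<open>x_i\<close> has \<open>d i\<close>
  choices in the first \<open>a ! i\<close> components and a single one in the others.\<close>

lemma card_marked_lists: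
  fixes d :: "nat \<Rightarrow> nat"
  assumes "\<And>j. card (Q j) = (\<Prod>i<l. if a ! i \<le> j then 1 else d i)"
    and "\<And>i. i < l \<Longrightarrow> a ! i \<le> M"
  shows "card {ps. length ps = M \<and> (\<forall>j<M. ps ! j \<in> Q j)} = (\<Prod>i<l. d i ^ (a ! i))"
proof -
  have "(\<Prod>j<M. if a ! i \<le> j then 1 else d i) = d i ^ (a ! i)" if "i < l" for i
  proof -
    have "(\<Prod>j<M. if a ! i \<le> j then 1 else d i) = (\<Prod>j<a ! i. d i)"
      using assms(2)[OF that] by (intro prod.mono_neutral_cong_right) auto
    then show ?thesis by simp
  qed
  moreover have "(\<Prod>j<M. \<Prod>i<l. if a ! i \<le> j then 1 else d i) = (\<Prod>i<l. \<Prod>j<M. if a ! i \<le> j then 1 else d i)"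
    by (rule prod.swap)
  ultimately show ?thesis unfolding card_lists_nth assms(1) by simp
qed

lemma fam_min_partition:
  assumes "partition_on {1..n} \<pi>" "n \<ge> 1"
  shows "fam_min \<pi> \<subseteq> {1..n}" "1 \<in> fam_min \<pi>"
proof -
  have B: "B \<subseteq> {1..n}" "B \<noteq> {}" "finite B" if "B \<in> \<pi>" for B
    using assms that finite_subset[of B "{1..n}"] by (auto simp: partition_on_def)
  show "fam_min \<pi> \<subseteq> {1..n}" using B Min_in by (fastforce simp: fam_min_def)
  have "1 \<in> \<Union>\<pi>" using assms by (simp add: partition_on_def)
  then obtain C where C: "C \<in> \<pi>" "1 \<in> C" by blast
  have "Min C = 1" using B[OF C(1)] C(2) by (intro Min_eqI) auto
  then show "1 \<in> fam_min \<pi>" using C(1) unfolding fam_min_def by (metis image_eqI)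
qed

definition marked_partitions :: "nat list \<Rightarrow> nat \<Rightarrow> nat list \<Rightarrow> nat \<Rightarrow> nat set set set" where
  "marked_partitions a n xs j = {\<pi>. partition_on {1..n} \<pi> \<and> fam_min \<pi> = {1..n} - set xs \<and>
       (\<forall>i<length xs. a ! i \<le> j \<longrightarrow> same_block \<pi> (xs ! i) 1)}"

definition marked_perms :: "nat list \<Rightarrow> nat \<Rightarrow> nat list \<Rightarrow> nat \<Rightarrow> nat list set" where
  "marked_perms a n xs j = lmin_perms n ({1..n} - set xs) {xs ! i |i. i < length xs \<and> a ! i \<le> j}"

text \<open>Once the minima are fixed, the conditions on \<open>p0\<close> and on \<open>ps\<close>
  no longer interact, so the systems with these minima form a product.
  \<open>Max (set a) \<ge> 1\<close> makes \<open>ps ! 0\<close>, from which the minima are read, an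
  actual component; \<open>n \<ge> 1\<close> makes 1 one of them.\<close>

lemma partition_systems_eq:
  assumes l: "length a = l" "l \<ge> 1" and M: "Max (set a) \<ge> 1" and n: "n \<ge> 1"
  shows "{P. partition_system a t n (int n - int l) P} =
    (\<Union>xs\<in>nonmin_lists l n. split_ground.mset_families n (set xs) (extra_mset t n xs) \<times>
       {ps. length ps = Max (set a) \<and> (\<forall>j<Max (set a). ps ! j \<in> marked_partitions a n xs j)})"
    (is "?L = ?R")
proof -
  have mem: "F \<in> split_ground.mset_families n (set xs) (extra_mset t n xs) \<longleftrightarrow>
     finite F \<and> (\<forall>B\<in>F. B \<noteq> {#}) \<and> segmented {1..n + 1} (set_mset ` F) \<and>
     fam_min (set_mset ` F) = {1..n} - set xs \<and> same_block (set_mset ` F) (xs ! 0) 1 \<and>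
     (\<Sum>B\<in>F. B) \<subseteq># mset_set ({1..n} - set xs) + extra_mset t n xs"
    if "xs \<in> nonmin_lists l n" for xs F
  proof -
    interpret split_list n xs by (rule split_list_nonmin_lists[OF that l(2)])
    show ?thesis
      unfolding mset_families_def segmented_family_def Y_def nxt_one mem_Collect_eq by blast
  qed
  have sys: "partition_system a t n (int n - int l) (F, ps) \<longleftrightarrow>
      F \<in> split_ground.mset_families n (set xs) (extra_mset t n xs) \<and>
      length ps = Max (set a) \<and> (\<forall>j<Max (set a). ps ! j \<in> marked_partitions a n xs j)"
    if xs: "xs \<in> nonmin_lists l n" and fm: "fam_min (ps ! 0) = {1..n} - set xs" for xs F ps
  proof -
    have "length xs = l" using xs by (simp add: nonmin_lists_def)
    moreover have "int (card ({1..n} - set xs)) = int n - int l"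
      using sorted_list_nonmin_lists(2,3)[OF xs] by simp
    ultimately show ?thesis
      unfolding mem[OF xs] partition_system_def prod.case Let_def fm sorted_list_nonmin_lists(1)[OF xs]
        marked_partitions_def mem_Collect_eq l(1) by blast
  qed
  show ?thesis
  proof (intro equalityI subsetI)
    fix P assume "P \<in> ?L"
    then obtain F ps where P: "P = (F, ps)" and ps: "partition_system a t n (int n - int l) (F, ps)"
      by (cases P) auto
    let ?Y = "fam_min (ps ! 0)"
    have "\<forall>j<Max (set a). partition_on {1..n} (ps ! j)" and card: "int (card ?Y) = int n - int l"
      using ps unfolding partition_system_def prod.case Let_def by blast+
    then have "partition_on {1..n} (ps ! 0)" using M by (simp add: Suc_le_eq)
    note xs = sorted_list_in_nonmin_lists[OF fam_min_partition[OF this n] card]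
    show "P \<in> ?R"
      unfolding P using sys[OF xs(1) xs(2)[symmetric]] ps by (intro UN_I[OF xs(1)]) simp
  next
    fix P assume "P \<in> ?R"
    then obtain F ps xs where P: "P = (F, ps)" and xs: "xs \<in> nonmin_lists l n"
      and *: "F \<in> split_ground.mset_families n (set xs) (extra_mset t n xs)"
        "length ps = Max (set a)" "\<forall>j<Max (set a). ps ! j \<in> marked_partitions a n xs j"
      by blast
    have "fam_min (ps ! 0) = {1..n} - set xs"
    proof -
      have "ps ! 0 \<in> marked_partitions a n xs 0" using *(3) M by (simp add: Suc_le_eq)
      then show ?thesis by (simp add: marked_partitions_def)
    qed
    from sys[OF xs this] * show "P \<in> ?L" unfolding P by blast
  qed
qed

lemma permutation_systems_eq:
  assumes l: "length a = l" "l \<ge> 1" and M: "Max (set a) \<ge> 1" and n: "n \<ge> 1"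
  shows "{P. permutation_system a t n (int n - int l) P} =
    (\<Union>xs\<in>nonmin_lists l n. split_ground.set_families n (set xs) (extra_mset t n xs) \<times>
       {ss. length ss = Max (set a) \<and> (\<forall>j<Max (set a). ss ! j \<in> marked_perms a n xs j)})"
    (is "?L = ?R")
proof -
  have mem: "F \<in> split_ground.set_families n (set xs) (extra_mset t n xs) \<longleftrightarrow>
     finite F \<and> (\<forall>B\<in>F. finite B \<and> B \<noteq> {}) \<and> segmented {1..n + 1} F \<and>
     fam_min F = {1..n} - set xs \<and> same_block F (xs ! 0) 1 \<and>
     (\<Sum>B\<in>F. mset_set B) = mset_set ({1..n} - set xs) + extra_mset t n xs"
    if "xs \<in> nonmin_lists l n" for xs F
  proof -
    interpret split_list n xs by (rule split_list_nonmin_lists[OF that l(2)])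
    show ?thesis
      unfolding set_families_def Y_def nxt_one mem_Collect_eq by blast
  qed
  define K where "K x w \<longleftrightarrow> (\<forall>p<n. w ! p = x \<longrightarrow> (\<forall>q. p < q \<and> q < n \<longrightarrow> w ! q > x))"
    for x :: nat and w
  have marked: "w \<in> marked_perms a n xs j \<longleftrightarrow>
      w \<in> permutations_of_set {1..n} \<and> lmin w = {1..n} - set xs \<and>
      (\<forall>i<l. a ! i \<le> j \<longrightarrow> K (xs ! i) w)"
    if xs: "xs \<in> nonmin_lists l n" for w xs j
  proof -
    let ?C = "{xs ! i |i. i < length xs \<and> a ! i \<le> j}"
    have len: "length xs = l" and sub: "set xs \<subseteq> {1..n}" using xs by (auto simp: nonmin_lists_def)
    have "?C \<inter> {1..n} = ?C" using sub by auto
    moreover have "({1..n} - set xs) \<inter> {1..n} = {1..n} - set xs" by auto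
    ultimately have "w \<in> marked_perms a n xs j \<longleftrightarrow> w \<in> permutations_of_set {1..n} \<and>
        lmin w = {1..n} - set xs \<and> (\<forall>i<l. a ! i \<le> j \<longrightarrow> tail_min (xs ! i) w)"
      unfolding marked_perms_def lmin_perms_def len by auto
    \<comment> \<open>The bounds by \<open>n\<close> and by \<open>length w\<close> agree, as a
      permutation of \<open>{1..n}\<close> has length \<open>n\<close>.\<close>
    moreover have "tail_min x w \<longleftrightarrow> K x w"
      if "w \<in> permutations_of_set {1..n}" for x
    proof -
      have "length w = n" using length_finite_permutations_of_set[OF that] by simp
      then show ?thesis unfolding tail_min_def K_def by (metis less_trans)
    qed
    ultimately show ?thesis by blast
  qed
  have sys: "permutation_system a t n (int n - int l) (F, ss) \<longleftrightarrow>
      F \<in> split_ground.set_families n (set xs) (extra_mset t n xs) \<and>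
      length ss = Max (set a) \<and> (\<forall>j<Max (set a). ss ! j \<in> marked_perms a n xs j)"
    if xs: "xs \<in> nonmin_lists l n" and fm: "lmin (ss ! 0) = {1..n} - set xs" for xs F ss
  proof -
    have "int (card ({1..n} - set xs)) = int n - int l"
      using sorted_list_nonmin_lists(2,3)[OF xs] by simp
    then show ?thesis
      unfolding mem[OF xs] marked[OF xs] permutation_system_def prod.case Let_def fm
        sorted_list_nonmin_lists(1)[OF xs] l(1) K_def[symmetric] by blast
  qed
  show ?thesis
  proof (intro equalityI subsetI)
    fix P assume "P \<in> ?L"
    then obtain F ss where P: "P = (F, ss)" and ss: "permutation_system a t n (int n - int l) (F, ss)"
      by (cases P) auto
    let ?Y = "lmin (ss ! 0)"
    have "\<forall>j<Max (set a). ss ! j \<in> permutations_of_set {1..n}"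
      and card: "int (card ?Y) = int n - int l"
      using ss unfolding permutation_system_def prod.case Let_def K_def[symmetric] by blast+
    then have perm: "ss ! 0 \<in> permutations_of_set {1..n}" using M by (simp add: Suc_le_eq)
    have set: "set (ss ! 0) = {1..n}" using perm by (simp add: permutations_of_set_def)
    have "?Y \<subseteq> {1..n}" using lmin_subset[of "ss ! 0"] set by simp
    moreover have "1 \<in> ?Y" using set n by (intro Min_in_lmin) auto
    ultimately have xs: "sorted_list_of_set ({1..n} - ?Y) \<in> nonmin_lists l n"
        "{1..n} - set (sorted_list_of_set ({1..n} - ?Y)) = ?Y"
      using sorted_list_in_nonmin_lists[OF _ _ card] by blast+
    show "P \<in> ?R"
      unfolding P using sys[OF xs(1) xs(2)[symmetric]] ss by (intro UN_I[OF xs(1)]) simp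
  next
    fix P assume "P \<in> ?R"
    then obtain F ss xs where P: "P = (F, ss)" and xs: "xs \<in> nonmin_lists l n"
      and *: "F \<in> split_ground.set_families n (set xs) (extra_mset t n xs)"
        "length ss = Max (set a)" "\<forall>j<Max (set a). ss ! j \<in> marked_perms a n xs j"
      by blast
    have "lmin (ss ! 0) = {1..n} - set xs"
    proof -
      have "ss ! 0 \<in> marked_perms a n xs 0" using *(3) M by (simp add: Suc_le_eq)
      then show ?thesis unfolding marked[OF xs] by blast
    qed
    from sys[OF xs this] * show "P \<in> ?L" unfolding P by blast
  qed
qed

lemma nonmin_lists_eqI:
  assumes "xs \<in> nonmin_lists l n" "ys \<in> nonmin_lists l n" "{1..n} - set xs = {1..n} - set ys"
  shows "xs = ys"
proof -
  have "xs = sorted_list_of_set ({1..n} - ({1..n} - set xs))"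
    by (rule sorted_list_nonmin_lists(1)[OF assms(1), symmetric])
  also have "\<dots> = ys"
    unfolding assms(3) by (rule sorted_list_nonmin_lists(1)[OF assms(2)])
  finally show ?thesis .
qed

lemma card_partition_systems:
  assumes l: "length a = l" "length t = l" "l \<ge> 1" and a: "\<forall>x\<in>set a. x \<ge> 1" and n: "n \<ge> 1"
  shows "card {P. partition_system a t n (int n - int l) P} =
    (\<Sum>xs\<in>nonmin_lists l n.
       (\<Prod>j<l. let g = (xs @ [n + 1]) ! Suc j - xs ! j - 1 in (t ! j - 2 + g) choose g) *
       (\<Prod>j<l. (xs ! j - Suc j) ^ (a ! j)))"
proof -
  let ?M = "Max (set a)"
  have ne: "a \<noteq> []" using l by auto
  have aM: "a ! i \<le> ?M" if "i < l" for i using that l by (intro Max_ge) auto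
  have M: "?M \<ge> 1" using a ne by (meson Max_in finite_set set_empty)
  have fin_parts: "finite (Pow (Pow {1..n}))" by simp
  have sub: "marked_partitions a n xs j \<subseteq> Pow (Pow {1..n})" for xs j
    by (auto simp: marked_partitions_def partition_on_def)
  have "card {P. partition_system a t n (int n - int l) P} =
     (\<Sum>xs\<in>nonmin_lists l n. card (split_ground.mset_families n (set xs) (extra_mset t n xs)) *
       card {ps. length ps = ?M \<and> (\<forall>j<?M. ps ! j \<in> marked_partitions a n xs j)})"
    unfolding partition_systems_eq[OF l(1,3) M n]
  proof (rule card_fibred_product)
    fix xs ys ps assume xs: "xs \<in> nonmin_lists l n" "ys \<in> nonmin_lists l n"
      and ps: "ps \<in> {ps. length ps = ?M \<and> (\<forall>j<?M. ps ! j \<in> marked_partitions a n xs j)}"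
        "ps \<in> {ps. length ps = ?M \<and> (\<forall>j<?M. ps ! j \<in> marked_partitions a n ys j)}"
    have "fam_min (ps ! 0) = {1..n} - set xs" "fam_min (ps ! 0) = {1..n} - set ys"
    proof -
      have "ps ! 0 \<in> marked_partitions a n xs 0" "ps ! 0 \<in> marked_partitions a n ys 0"
        using ps M by (simp_all add: Suc_le_eq)
      then show "fam_min (ps ! 0) = {1..n} - set xs" "fam_min (ps ! 0) = {1..n} - set ys"
        by (simp_all add: marked_partitions_def)
    qed
    then show "xs = ys" using nonmin_lists_eqI[OF xs] by simp
  next
    fix xs assume xs: "xs \<in> nonmin_lists l n"
    interpret split_list n xs by (rule split_list_nonmin_lists[OF xs l(3)])
    have "length t = length xs" using xs l by (simp add: nonmin_lists_def)
    then show "finite (mset_families (extra_mset t n xs))"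
      by (intro finite_mset_families extra_mset_facts)
  qed (simp_all add: finite_nonmin_lists finite_lists_nth[OF fin_parts sub])
  also have "\<dots> = (\<Sum>xs\<in>nonmin_lists l n.
       (\<Prod>j<l. let g = (xs @ [n + 1]) ! Suc j - xs ! j - 1 in (t ! j - 2 + g) choose g) *
       (\<Prod>j<l. (xs ! j - Suc j) ^ (a ! j)))"
  proof (rule sum.cong[OF refl])
    fix xs assume xs: "xs \<in> nonmin_lists l n"
    interpret split_list n xs by (rule split_list_nonmin_lists[OF xs l(3)])
    have len: "length xs = l" using xs by (simp add: nonmin_lists_def)
    have "card (mset_families (extra_mset t n xs)) =
        (\<Prod>j<l. let g = (xs @ [n + 1]) ! Suc j - xs ! j - 1 in (t ! j - 2 + g) choose g)"
      using card_mset_families_list[of t] len l(2) by simp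
    moreover have "card {ps. length ps = ?M \<and> (\<forall>j<?M. ps ! j \<in> marked_partitions a n xs j)} =
        (\<Prod>j<l. (xs ! j - Suc j) ^ (a ! j))"
      using card_marked_partitions[of a] aM unfolding marked_partitions_def len
      by (rule card_marked_lists)
    ultimately show "card (split_ground.mset_families n (set xs) (extra_mset t n xs)) *
       card {ps. length ps = ?M \<and> (\<forall>j<?M. ps ! j \<in> marked_partitions a n xs j)} =
       (\<Prod>j<l. let g = (xs @ [n + 1]) ! Suc j - xs ! j - 1 in (t ! j - 2 + g) choose g) *
       (\<Prod>j<l. (xs ! j - Suc j) ^ (a ! j))" by simp
  qed
  finally show ?thesis .
qed

lemma card_permutation_systems:
  assumes l: "length a = l" "length t = l" "l \<ge> 1" and a: "\<forall>x\<in>set a. x \<ge> 1" and n: "n \<ge> 1"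
  shows "card {P. permutation_system a t n (int n - int l) P} =
    (\<Sum>xs\<in>nonmin_lists l n.
       (\<Prod>j<l. ((xs @ [n + 1]) ! Suc j - xs ! j - 1) choose (t ! j - 2)) *
       (\<Prod>j<l. (xs ! j - 1) ^ (a ! j)))"
proof -
  let ?M = "Max (set a)"
  have ne: "a \<noteq> []" using l by auto
  have aM: "a ! i \<le> ?M" if "i < l" for i using that l by (intro Max_ge) auto
  have M: "?M \<ge> 1" using a ne by (meson Max_in finite_set set_empty)
  have fin_perms: "finite (permutations_of_set {1..n})" by simp
  have sub: "marked_perms a n xs j \<subseteq> permutations_of_set {1..n}" for xs j
    by (auto simp: marked_perms_def lmin_perms_def)
  have "card {P. permutation_system a t n (int n - int l) P} =
     (\<Sum>xs\<in>nonmin_lists l n. card (split_ground.set_families n (set xs) (extra_mset t n xs)) *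
       card {ps. length ps = ?M \<and> (\<forall>j<?M. ps ! j \<in> marked_perms a n xs j)})"
    unfolding permutation_systems_eq[OF l(1,3) M n]
  proof (rule card_fibred_product)
    fix xs ys ps assume xs: "xs \<in> nonmin_lists l n" "ys \<in> nonmin_lists l n"
      and ps: "ps \<in> {ps. length ps = ?M \<and> (\<forall>j<?M. ps ! j \<in> marked_perms a n xs j)}"
        "ps \<in> {ps. length ps = ?M \<and> (\<forall>j<?M. ps ! j \<in> marked_perms a n ys j)}"
    have "lmin (ps ! 0) = {1..n} - set xs" "lmin (ps ! 0) = {1..n} - set ys"
    proof -
      have "ps ! 0 \<in> marked_perms a n xs 0" "ps ! 0 \<in> marked_perms a n ys 0"
        using ps M by (simp_all add: Suc_le_eq)
      then show "lmin (ps ! 0) = {1..n} - set xs" "lmin (ps ! 0) = {1..n} - set ys"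
        unfolding marked_perms_def lmin_perms_def by blast+
    qed
    then show "xs = ys" using nonmin_lists_eqI[OF xs] by simp
  next
    fix xs assume xs: "xs \<in> nonmin_lists l n"
    interpret split_list n xs by (rule split_list_nonmin_lists[OF xs l(3)])
    have "length t = length xs" using xs l by (simp add: nonmin_lists_def)
    then show "finite (set_families (extra_mset t n xs))"
      by (intro finite_set_families extra_mset_facts)
  qed (simp_all add: finite_nonmin_lists finite_lists_nth[OF fin_perms sub])
  also have "\<dots> = (\<Sum>xs\<in>nonmin_lists l n.
       (\<Prod>j<l. ((xs @ [n + 1]) ! Suc j - xs ! j - 1) choose (t ! j - 2)) *
       (\<Prod>j<l. (xs ! j - 1) ^ (a ! j)))"
  proof (rule sum.cong[OF refl])
    fix xs assume xs: "xs \<in> nonmin_lists l n"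
    interpret split_list n xs by (rule split_list_nonmin_lists[OF xs l(3)])
    have len: "length xs = l" using xs by (simp add: nonmin_lists_def)
    have "card (set_families (extra_mset t n xs)) =
        (\<Prod>j<l. ((xs @ [n + 1]) ! Suc j - xs ! j - 1) choose (t ! j - 2))"
      using card_set_families_list[of t] len l(2) by simp
    moreover have "card {ps. length ps = ?M \<and> (\<forall>j<?M. ps ! j \<in> marked_perms a n xs j)} =
        (\<Prod>j<l. (xs ! j - 1) ^ (a ! j))"
      using card_marked_perms[of a] aM unfolding marked_perms_def len
      by (rule card_marked_lists)
    ultimately show "card (split_ground.set_families n (set xs) (extra_mset t n xs)) *
       card {ps. length ps = ?M \<and> (\<forall>j<?M. ps ! j \<in> marked_perms a n xs j)} =
       (\<Prod>j<l. ((xs @ [n + 1]) ! Suc j - xs ! j - 1) choose (t ! j - 2)) *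
       (\<Prod>j<l. (xs ! j - 1) ^ (a ! j))" by simp
  qed
  finally show ?thesis .
qed

text \<open>The substitution is \<open>i_j = x_j - j\<close>. It turns
  \<open>x_(j+1) - x_j - 1\<close>, the size of a gap, into \<open>i_(j+1) - i_j\<close>, and
  \<open>n + 1\<close> in position \<open>l + 1\<close> into \<open>m\<close>.\<close>

lemma sum_nonmin_lists_shift:
  assumes n: "n = l + m" and t: "length t = l" "\<forall>y\<in>set t. y \<ge> 2"
  shows "(\<Sum>xs\<in>nonmin_lists l n.
       (\<Prod>j<l. let g = (xs @ [n + 1]) ! Suc j - xs ! j - 1 in (t ! j - 2 + g) choose g) *
       (\<Prod>j<l. (xs ! j - Suc j) ^ (a ! j))) = chain_sum (\<le>) (B_kernel a t) l m"
proof -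
  let ?f = "\<lambda>xs. map (\<lambda>j. xs ! j - Suc j) [0..<l]"
  let ?g = "\<lambda>i. map (\<lambda>j. i ! j + Suc j) [0..<l]"
  have fwd: "?g (?f xs) = xs \<and> ?f xs \<in> chains (\<le>) l m \<and>
     (\<forall>j\<le>l. (?f xs @ [m]) ! j = (xs @ [n + 1]) ! j - Suc j) \<and>
     (\<forall>j\<le>l. (xs @ [n + 1]) ! j \<ge> Suc j) \<and> (\<forall>j<l. (xs @ [n + 1]) ! j < (xs @ [n + 1]) ! Suc j)"
    if xs: "xs \<in> nonmin_lists l n" for xs
  proof -
    let ?z = "xs @ [n + 1]"
    have len: "length xs = l" and sub: "set xs \<subseteq> {2..n}" and "sorted_wrt (<) xs"
      using xs by (auto simp: nonmin_lists_def)
    then have srt: "sorted_wrt (<) ?z" by (auto simp: sorted_wrt_append)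
    have add: "?z ! i + (j - i) \<le> ?z ! j" if "i \<le> j" "j \<le> l" for i j
      using strict_sorted_nth_add_le[OF srt, of i j] that len by simp
    \<comment> \<open>A genuine first entry is at least 2, which keeps all shifted indices positive;
      for \<open>l = 0\<close> the first entry is \<open>n + 1\<close>.\<close>
    have z0: "?z ! 0 \<ge> (if l = 0 then 1 else 2)"
      using sub len nth_mem[of 0 xs] by (fastforce simp: nth_append)
    have ge: "?z ! j \<ge> Suc j" if "j \<le> l" for j
      using add[of 0 j] z0 that by (auto split: if_splits)
    have ge2: "xs ! j \<ge> Suc (Suc j)" if "j < l" for j
      using add[of 0 j] z0 that len by (auto simp: nth_append split: if_splits)
    have nth: "(?f xs @ [m]) ! j = ?z ! j - Suc j" if "j \<le> l" for j
      using that len n by (cases "j = l") (auto simp: nth_append)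
    have "sorted_wrt (\<le>) (?f xs @ [m])"
      unfolding sorted_wrt_iff_nth_less
    proof (intro allI impI)
      fix i j assume ij: "i < j" "j < length (?f xs @ [m])"
      then show "(?f xs @ [m]) ! i \<le> (?f xs @ [m]) ! j"
        using nth[of i] nth[of j] add[of i j] ge[of i] by simp
    qed
    moreover have "0 \<notin> set (?f xs)" using ge2 by force
    ultimately have "?f xs \<in> chains (\<le>) l m" by (simp add: chains_def)
    moreover have "?g (?f xs) = xs"
    proof (rule nth_equalityI)
      fix j assume "j < length (?g (?f xs))"
      then show "?g (?f xs) ! j = xs ! j" using ge2[of j] by simp
    qed (simp add: len)
    moreover have "?z ! j < ?z ! Suc j" if "j < l" for j
      using add[of j "Suc j"] that by simp
    ultimately show ?thesis using nth ge by blast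
  qed
  have bwd: "?f (?g i) = i \<and> ?g i \<in> nonmin_lists l n" if i: "i \<in> chains (\<le>) l m" for i
  proof -
    have len: "length i = l" and pos: "0 \<notin> set i" and srt: "sorted i" and le: "\<forall>x\<in>set i. x \<le> m"
      using i by (auto simp: chains_def sorted_wrt_append)
    have "?f (?g i) = i" using len by (intro nth_equalityI) auto
    moreover have "sorted_wrt (<) (?g i)"
      unfolding sorted_wrt_iff_nth_less
    proof (intro allI impI)
      fix p q assume pq: "p < q" "q < length (?g i)"
      then have "i ! p \<le> i ! q" using len by (intro sorted_nth_mono[OF srt]) auto
      then show "?g i ! p < ?g i ! q" using pq by simp
    qed
    moreover have "i ! j \<ge> 1 \<and> i ! j \<le> m" if "j < l" for j
      using that len pos le nth_mem[of j i] by (metis One_nat_def Suc_leI gr0I)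
    then have "set (?g i) \<subseteq> {2..n}" using n by fastforce
    ultimately show ?thesis by (simp add: nonmin_lists_def)
  qed
  show ?thesis
    unfolding chain_sum_def
  proof (rule sum.reindex_bij_witness[of _ ?g ?f])
    fix xs assume xs: "xs \<in> nonmin_lists l n"
    have len: "length xs = l" using xs by (simp add: nonmin_lists_def)
    note f = fwd[OF xs]
    have "B_kernel a t j (?f xs ! j) ((?f xs @ [m]) ! Suc j) =
       (let g = (xs @ [n + 1]) ! Suc j - xs ! j - 1 in (t ! j - 2 + g) choose g) * (xs ! j - Suc j) ^ (a ! j)"
      if j: "j < l" for j
    proof -
      have p: "?f xs ! j = xs ! j - Suc j" using j by simp
      have q: "(?f xs @ [m]) ! Suc j = (xs @ [n + 1]) ! Suc j - Suc (Suc j)" using f j by simp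
      have xj: "(xs @ [n + 1]) ! j = xs ! j" using j len by (simp add: nth_append)
      have le: "Suc j \<le> xs ! j" "xs ! j < (xs @ [n + 1]) ! Suc j" using f j xj by (metis less_imp_le)+
      have tj: "t ! j \<ge> 2" using t j by simp
      have d: "(xs @ [n + 1]) ! Suc j - Suc (Suc j) - (xs ! j - Suc j) = (xs @ [n + 1]) ! Suc j - xs ! j - 1"
        using le by linarith
      have e: "t ! j + ((xs @ [n + 1]) ! Suc j - Suc (Suc j)) - (xs ! j - Suc j) - 2 =
          t ! j - 2 + ((xs @ [n + 1]) ! Suc j - xs ! j - 1)"
        using le tj by linarith
      show ?thesis unfolding B_kernel_def p q d e Let_def by (rule mult.commute)
    qed
    then have "(\<Prod>j<l. B_kernel a t j (?f xs ! j) ((?f xs @ [m]) ! Suc j)) =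
       (\<Prod>j<l. (let g = (xs @ [n + 1]) ! Suc j - xs ! j - 1 in (t ! j - 2 + g) choose g) * (xs ! j - Suc j) ^ (a ! j))"
      by (intro prod.cong[OF refl]) (simp only: lessThan_iff)
    then show "(\<Prod>j<l. B_kernel a t j (?f xs ! j) ((?f xs @ [m]) ! Suc j)) =
       (\<Prod>j<l. let g = (xs @ [n + 1]) ! Suc j - xs ! j - 1 in (t ! j - 2 + g) choose g) *
       (\<Prod>j<l. (xs ! j - Suc j) ^ (a ! j))"
      by (simp only: prod.distrib)
  qed (use fwd bwd in blast)+
qed

text \<open>Here the substitution is \<open>i_j = x_j - 1\<close>; it preserves all differences and
  sends the end point \<open>m + 1\<close> to \<open>m\<close>.\<close>

lemma sum_nonmin_lists_pred:
  "(\<Sum>xs\<in>nonmin_lists l m.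
       (\<Prod>j<l. ((xs @ [m + 1]) ! Suc j - xs ! j - 1) choose (t ! j - 2)) *
       (\<Prod>j<l. (xs ! j - 1) ^ (a ! j))) = chain_sum (<) (b_kernel a t) l m"
proof -
  let ?f = "map (\<lambda>x :: nat. x - 1)" and ?g = "map Suc"
  have fwd: "?g (?f xs) = xs \<and> ?f xs \<in> chains (<) l m"
    if xs: "xs \<in> nonmin_lists l m" for xs
  proof -
    have pos: "x \<ge> 2 \<and> x \<le> m" if "x \<in> set xs" for x
      using xs that by (auto simp: nonmin_lists_def)
    have "map (\<lambda>x. Suc (x - 1)) xs = xs"
      by (rule map_idI) (use pos in force)
    then have "?g (?f xs) = xs" by (simp add: comp_def)
    moreover have "sorted_wrt (\<lambda>x y. x - 1 < y - 1) xs"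
    proof (rule sorted_wrt_mono_rel)
      show "sorted_wrt (<) xs" using xs by (simp add: nonmin_lists_def)
    qed (use pos in fastforce)
    moreover have "0 \<notin> set (?f xs)" "\<forall>x\<in>set (?f xs). x < m" using pos by force+
    ultimately show ?thesis
      using xs by (simp add: chains_def nonmin_lists_def sorted_wrt_append sorted_wrt_map)
  qed
  have bwd: "?f (?g i) = i \<and> ?g i \<in> nonmin_lists l m" if i: "i \<in> chains (<) l m" for i
  proof -
    have "x \<noteq> 0 \<and> x < m" if "x \<in> set i" for x
      using i that by (auto simp: chains_def sorted_wrt_append intro: gr0I)
    then have "set (?g i) \<subseteq> {2..m}" by fastforce
    then show ?thesis
      using i by (simp add: chains_def nonmin_lists_def sorted_wrt_append sorted_wrt_map comp_def)
  qed
  show ?thesis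
    unfolding chain_sum_def
  proof (rule sum.reindex_bij_witness[of _ ?g ?f])
    fix xs assume xs: "xs \<in> nonmin_lists l m"
    have len: "length xs = l" using xs by (simp add: nonmin_lists_def)
    have "b_kernel a t j (?f xs ! j) ((?f xs @ [m]) ! Suc j) =
       (((xs @ [m + 1]) ! Suc j - xs ! j - 1) choose (t ! j - 2)) * (xs ! j - 1) ^ (a ! j)"
      if j: "j < l" for j
    proof -
      have p: "?f xs ! j = xs ! j - 1" using j len by simp
      have "?f xs @ [m] = ?f (xs @ [m + 1])" by simp
      then have q: "(?f xs @ [m]) ! Suc j = (xs @ [m + 1]) ! Suc j - 1"
        using j len by (metis Suc_less_eq length_append_singleton nth_map)
      have "xs ! j \<ge> 2" using xs j len nth_mem[of j xs] by (auto simp: nonmin_lists_def subset_iff)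
      then have d: "(xs @ [m + 1]) ! Suc j - 1 - (xs ! j - 1) = (xs @ [m + 1]) ! Suc j - xs ! j"
        by linarith
      show ?thesis unfolding b_kernel_def p q d by (rule mult.commute)
    qed
    then have "(\<Prod>j<l. b_kernel a t j (?f xs ! j) ((?f xs @ [m]) ! Suc j)) =
       (\<Prod>j<l. (((xs @ [m + 1]) ! Suc j - xs ! j - 1) choose (t ! j - 2)) * (xs ! j - 1) ^ (a ! j))"
      by (intro prod.cong[OF refl]) (simp only: lessThan_iff)
    then show "(\<Prod>j<l. b_kernel a t j (?f xs ! j) ((?f xs @ [m]) ! Suc j)) =
       (\<Prod>j<l. ((xs @ [m + 1]) ! Suc j - xs ! j - 1) choose (t ! j - 2)) *
       (\<Prod>j<l. (xs ! j - 1) ^ (a ! j))"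
      by (simp only: prod.distrib)
  qed (use fwd bwd in blast)+
qed

section \<open>Uniqueness of the weight and the final formulas\<close>

lemma of_weight_Cons: "of_weight (x # a) (y # t) = replicate (x - 1) 1 @ y # of_weight a t"
  by (simp add: of_weight_def)

text \<open>The first part different from 1 is \<open>t_1\<close>, and \<open>a_1 - 1\<close> ones
  precede it; the rest follows by induction.\<close>

lemma of_weight_inject:
  assumes "length a = length t" "\<forall>x\<in>set a. x \<ge> 1" "\<forall>y\<in>set t. y \<ge> 2"
    and "length a' = length t'" "\<forall>x\<in>set a'. x \<ge> 1" "\<forall>y\<in>set t'. y \<ge> 2"
    and "of_weight a t = of_weight a' t'"
  shows "a = a' \<and> t = t'"
  using assms
proof (induction a arbitrary: t a' t')
  case Nil
  then show ?case by (cases a'; cases t') (auto simp: of_weight_Cons, auto simp: of_weight_def)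
next
  case (Cons x a)
  obtain y u where t: "t = y # u" using Cons.prems by (cases t) auto
  have "of_weight a' t' \<noteq> []" using Cons.prems(7) by (simp add: t of_weight_Cons flip: Cons.prems(7))
  then obtain x' b y' u' where a't': "a' = x' # b" "t' = y' # u'"
    using Cons.prems(4) by (cases a'; cases t') (auto simp: of_weight_def)
  have eq: "replicate (x - 1) 1 @ y # of_weight a u = replicate (x' - 1) 1 @ y' # of_weight b u'"
    using Cons.prems(7) by (simp only: t a't' of_weight_Cons)
  have ys: "y \<noteq> 1" "y' \<noteq> 1" and xs: "x \<ge> 1" "x' \<ge> 1" using Cons.prems t a't' by auto
  have "takeWhile ((=) 1) (replicate p 1 @ z # r) = replicate p 1"
    "dropWhile ((=) 1) (replicate p 1 @ z # r) = z # r" if "z \<noteq> 1" for p and z :: nat and r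
    using that by (simp_all add: takeWhile_append dropWhile_append)
  from this[OF ys(1)] this[OF ys(2)] eq
  have "replicate (x - 1) (1 :: nat) = replicate (x' - 1) 1" "y # of_weight a u = y' # of_weight b u'"
    by metis+
  then have "x - 1 = x' - 1" "y = y'" "of_weight a u = of_weight b u'"
    by (metis length_replicate, simp_all)
  moreover from this(3) have "a = b \<and> u = u'"
    using Cons.prems t a't' by (intro Cons.IH) auto
  ultimately show ?case using xs by (simp add: t a't')
qed

lemma has_weight_iff:
  "has_weight k a t 0 \<longleftrightarrow> length a = length t \<and> (\<forall>x\<in>set a. x \<ge> 1) \<and> (\<forall>y\<in>set t. y \<ge> 2) \<and> k = of_weight a t"
  by (simp add: has_weight_def of_weight_def)

lemma ex_has_weight_iff:
  assumes "has_weight k a t 0"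
  shows "(\<exists>a' t'. has_weight k a' t' 0 \<and> Q a' t') \<longleftrightarrow> Q a t"
  using assms unfolding has_weight_iff by (metis of_weight_inject)

lemma S_count_chain_sum:
  assumes w: "has_weight k a t 0" and l: "length a = l" "l \<ge> 1" and m: "m > 0"
  shows "S_count k (l + m) (int m) = chain_sum (\<le>) (B_kernel a t) l m"
proof -
  have at: "length t = l" "\<forall>x\<in>set a. x \<ge> 1" "\<forall>y\<in>set t. y \<ge> 2"
    using w l by (auto simp: has_weight_iff)
  have "S_count k (l + m) (int m) = card {P. partition_system a t (l + m) (int m) P}"
    unfolding S_count_def ex_has_weight_iff[OF w] using l by simp
  also have "int m = int (l + m) - int l" by simp
  finally show ?thesis
    unfolding card_partition_systems[OF l(1) at(1) l(2) at(2) trans_le_add1[OF l(2)]]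
    using sum_nonmin_lists_shift[OF refl at(1,3)] by simp
qed

text \<open>For \<open>m \<le> l\<close> both sides are 0: \<open>{2..m}\<close> has fewer than
  \<open>l\<close> elements, and no strict chain of length \<open>l\<close> fits below
  \<open>m\<close>.\<close>

lemma s_count_chain_sum:
  assumes w: "has_weight k a t 0" and l: "length a = l" "l \<ge> 1" and m: "m > 0"
  shows "s_count k m (int m - int l) = chain_sum (<) (b_kernel a t) l m"
proof -
  have at: "length t = l" "\<forall>x\<in>set a. x \<ge> 1"
    using w l by (auto simp: has_weight_iff)
  have "s_count k m (int m - int l) = card {P. permutation_system a t m (int m - int l) P}"
    unfolding s_count_def ex_has_weight_iff[OF w] using l by simp
  then show ?thesis
    using card_permutation_systems[OF l(1) at(1) l(2) at(2), of m] m sum_nonmin_lists_pred by simp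
qed

text \<open>Separates the step to the end point \<open>m\<close>, which is not an entry of
  \<open>i\<close>, from the steps between entries, as the final formulas display it.\<close>

lemma prod_chain_split:
  fixes f :: "nat \<Rightarrow> nat"
  assumes "length i = l" "l \<ge> 1"
  shows "(\<Prod>j<l. f j * h j (i ! j) ((i @ [m]) ! Suc j)) =
    (\<Prod>j<l. f j) * (\<Prod>j<l - 1. h j (i ! j) (i ! (j + 1))) * h (l - 1) (i ! (l - 1)) m"
proof -
  obtain r where r: "l = Suc r" using assms(2) by (cases l) auto
  have "(\<Prod>j<l. h j (i ! j) ((i @ [m]) ! Suc j)) =
      (\<Prod>j<r. h j (i ! j) ((i @ [m]) ! Suc j)) * h r (i ! r) m"
    using assms(1) by (simp add: r nth_append)
  also have "(\<Prod>j<r. h j (i ! j) ((i @ [m]) ! Suc j)) = (\<Prod>j<r. h j (i ! j) (i ! (j + 1)))"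
    using assms(1) by (intro prod.cong refl) (simp add: r nth_append)
  finally show ?thesis by (simp add: prod.distrib r mult.assoc)
qed

theorem theorem3:
  fixes k a t :: "nat list" and l m :: nat
  assumes "\<forall>x \<in> set k. x > 0"
    and "has_weight k a t 0"
    and "length a = l" and "l \<ge> 1"
    and "m > 0"
  shows "stirling_B k m = of_nat (S_count k (l + m) (int m)) \<and>
    stirling_b k m = of_nat (s_count k m (int m - int l)) \<and>
    S_count k (l + m) (int m) =
      (\<Sum>i \<in> {i :: nat list. length i = l \<and> set i \<subseteq> {1..m} \<and> sorted i}.
         (\<Prod>j<l. (i ! j) ^ (a ! j)) *
         (\<Prod>j<l - 1. (t ! j + i ! (j + 1) - i ! j - 2) choose (i ! (j + 1) - i ! j)) *
         ((t ! (l - 1) + m - i ! (l - 1) - 2) choose (m - i ! (l - 1)))) \<and>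
    s_count k m (int m - int l) =
      (\<Sum>i \<in> {i :: nat list. length i = l \<and> set i \<subseteq> {1..<m} \<and> sorted_wrt (<) i}.
         (\<Prod>j<l. (i ! j) ^ (a ! j)) *
         (\<Prod>j<l - 1. (i ! (j + 1) - i ! j - 1) choose (t ! j - 2)) *
         ((m - i ! (l - 1) - 1) choose (t ! (l - 1) - 2)))"
proof -
  have w: "length a = length t" "\<forall>x\<in>set a. x \<ge> 1" "\<forall>y\<in>set t. y \<ge> 2" "k = of_weight a t"
    using assms(2) by (auto simp: has_weight_iff)
  have ne: "k \<noteq> []"
    using assms(3,4) w(1) by (cases a; cases t) (auto simp: w(4) of_weight_Cons)
  note S = S_count_chain_sum[OF assms(2-5)] and s = s_count_chain_sum[OF assms(2-5)]
  have B: "stirling_B k m = of_nat (S_count k (l + m) (int m))"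
    unfolding S stirling_B_eq[OF assms(1) ne] using B_gf_chain_sum[OF w(1-3), of m]
    by (simp only: w(4) assms(3))
  have b: "stirling_b k m = of_nat (s_count k m (int m - int l))"
    unfolding s stirling_b_eq[OF assms(1) ne] using b_gf_chain_sum[OF w(1-3) assms(5)]
    by (simp only: w(4) assms(3))
  have "chains (\<le>) l m = {i. length i = l \<and> set i \<subseteq> {1..m} \<and> sorted i}"
    by (auto simp: chains_def sorted_wrt_append Suc_le_eq intro: gr0I)
  then have S': "S_count k (l + m) (int m) =
      (\<Sum>i \<in> {i :: nat list. length i = l \<and> set i \<subseteq> {1..m} \<and> sorted i}.
         (\<Prod>j<l. (i ! j) ^ (a ! j)) *
         (\<Prod>j<l - 1. (t ! j + i ! (j + 1) - i ! j - 2) choose (i ! (j + 1) - i ! j)) *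
         ((t ! (l - 1) + m - i ! (l - 1) - 2) choose (m - i ! (l - 1))))"
    unfolding S chain_sum_def B_kernel_def
    using assms(4) prod_chain_split[where h = "\<lambda>j p q. (t ! j + q - p - 2) choose (q - p)"]
    by (intro sum.cong) simp_all
  have "chains (<) l m = {i. length i = l \<and> set i \<subseteq> {1..<m} \<and> sorted_wrt (<) i}"
    by (auto simp: chains_def sorted_wrt_append Suc_le_eq intro: gr0I)
  then have s': "s_count k m (int m - int l) =
      (\<Sum>i \<in> {i :: nat list. length i = l \<and> set i \<subseteq> {1..<m} \<and> sorted_wrt (<) i}.
         (\<Prod>j<l. (i ! j) ^ (a ! j)) *
         (\<Prod>j<l - 1. (i ! (j + 1) - i ! j - 1) choose (t ! j - 2)) *
         ((m - i ! (l - 1) - 1) choose (t ! (l - 1) - 2)))"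
    unfolding s chain_sum_def b_kernel_def
    using assms(4) prod_chain_split[where h = "\<lambda>j p q. (q - p - 1) choose (t ! j - 2)"]
    by (intro sum.cong) simp_all
  from B b S' s' show ?thesis by blast
qed

end
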